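(* Let $n\ge2$. The inclusion map $C(S^1)_{(n)}\to C^*_{\mathrm{env}}(C(S^1)_{(n)})\cong C(S^1)$ induces isomorphisms (bijections) $\mathcal V_0(C(S^1)_{(n)},m)\cong\mathcal V_0(C(S^1),m)$ for every $m\ge1$, intertwining the connecting maps $\imath_{mm'}$ ($m'\ge m$) for $C(S^1)_{(n)}$ with those for $C(S^1)$. It follows that $K_0(C(S^1)_{(n)})\cong K_0(C(S^1))\cong\mathbb Z$.
   Context: $C(S^1)_{(n)}\subseteq C(S^1)$ is the Fej\'er--Riesz operator system: the space of functions $a(z)=\sum_{k=-n+1}^{n-1}a_kz^k$, $z\in S^1$, with $a_k\in\mathbb C$; its $C^*$-envelope is $C(S^1)$. For a unital operator system $E$ with unit $e$, realized inside its $C^*$-envelope $A=C^*_{\mathrm{env}}(E)$ (with $A=E$ if $E$ is a $C^*$-algebra), let $H(E,m)$ be the space of self-adjoint elements of $M_m(E)$ that are invertible in $M_m(A)$ (with the norm topology), and $\mathcal V_0(E,m)=\pi_0(H(E,m))$ the set of its path components. The inclusion $E\subseteq A$ gives $H(E,m)\subseteq H(A,m)$ and hence a map $\mathcal V_0(E,m)\to\mathcal V_0(A,m)$. For $m'\ge m$ the connecting map $\imath_{mm'}:\mathcal V_0(E,m)\to\mathcal V_0(E,m')$ is $[x]\mapsto[x\oplus e_{m'-m}]$, where $e_k$ is the unit of $M_k(E)$. $\mathcal V_0(E)=\varinjlim_m\mathcal V_0(E,m)$ is a commutative semigroup under $[x]+[x']=[x\oplus x']$ with identity element $[e]$, and $K_0(E)$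 is its Grothendieck group. For a unital $C^*$-algebra this is isomorphic to the usual $K_0$-group. *)

theory Defs
  imports "HOL-Analysis.Analysis" "HOL-Algebra.Algebra"
begin

section \<open>Unital C*-algebras and operator systems\<close>

class unital_cstar_algebra = real_normed_algebra_1 + banach +
  fixes scaleC :: "complex \<Rightarrow> 'a \<Rightarrow> 'a" (infixr "*\<^sub>C" 75)
    and star :: "'a \<Rightarrow> 'a"
  assumes scaleC_add_right: "a *\<^sub>C (x + y) = a *\<^sub>C x + a *\<^sub>C y"
    and scaleC_add_left: "(a + b) *\<^sub>C x = a *\<^sub>C x + b *\<^sub>C x"
    and scaleC_scaleC: "a *\<^sub>C b *\<^sub>C x = (a * b) *\<^sub>C x"
    and scaleC_of_real: "of_real r *\<^sub>C x = r *\<^sub>R x"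
    and mult_scaleC_left: "a *\<^sub>C x * y = a *\<^sub>C (x * y)"
    and mult_scaleC_right: "x * a *\<^sub>C y = a *\<^sub>C (x * y)"
    and norm_scaleC: "norm (a *\<^sub>C x) = cmod a * norm x"
    and star_star [simp]: "star (star x) = x"
    and star_add: "star (x + y) = star x + star y"
    and star_mult: "star (x * y) = star y * star x"
    and star_scaleC: "star (a *\<^sub>C x) = cnj a *\<^sub>C star x"
    and cstar_identity: "norm (star x * x) = (norm x)\<^sup>2"

lemma norm_star [simp]: "norm (star x) = norm x" for x :: "'a::unital_cstar_algebra"
proof -
  have le: "norm y \<le> norm (star y)" for y :: 'a
  proof (cases "norm y = 0")
    case False
    then have pos: "norm y > 0" by simp
    have "norm y * norm y \<le> norm (star y) * norm y"
      using cstar_identity[of y] norm_mult_ineq[of "star y" y] by (simp add: power2_eq_square)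
    then show ?thesis using pos by simp
  qed simp
  show ?thesis using le[of x] le[of "star x"] by simp
qed

text \<open>An operator system is given concretely, as a subspace \<open>E\<close> of a C*-algebra \<open>'a\<close>.\<close>

definition operator_system :: "'a::unital_cstar_algebra set \<Rightarrow> bool" where
  "operator_system E \<longleftrightarrow> 1 \<in> E \<and> (\<forall>x\<in>E. \<forall>y\<in>E. x + y \<in> E) \<and>
     (\<forall>a. \<forall>x\<in>E. a *\<^sub>C x \<in> E) \<and> (\<forall>x\<in>E. star x \<in> E)"


section \<open>Matrices over an operator system\<close>

text \<open>
  An \<open>m \<times> m\<close> matrix is a function of two indices that vanishes outside \<open>{..<m} \<times> {..<m}\<close>. The
  product topology on \<^typ>\<open>nat \<Rightarrow> nat \<Rightarrow> 'a\<close> restricts to the topology of entrywise norm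
  convergence on \<open>M\<^sub>m(A)\<close>. This is the topology of the C*-norm of \<open>M\<^sub>m(A)\<close>, which satisfies
  \<open>max\<^sub>i\<^sub>j \<parallel>x\<^sub>i\<^sub>j\<parallel> \<le> \<parallel>x\<parallel> \<le> \<Sum>\<^sub>i\<^sub>j \<parallel>x\<^sub>i\<^sub>j\<parallel>\<close>.
\<close>

definition mat_over :: "nat \<Rightarrow> 'a::zero set \<Rightarrow> (nat \<Rightarrow> nat \<Rightarrow> 'a) set" where
  "mat_over m E = {x. \<forall>i j. if i < m \<and> j < m then x i j \<in> E else x i j = 0}"

definition mat_one :: "nat \<Rightarrow> nat \<Rightarrow> nat \<Rightarrow> 'a::zero_neq_one" where
  "mat_one m = (\<lambda>i j. if i < m \<and> i = j then 1 else 0)"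

definition mat_mult ::
  "nat \<Rightarrow> (nat \<Rightarrow> nat \<Rightarrow> 'a) \<Rightarrow> (nat \<Rightarrow> nat \<Rightarrow> 'a) \<Rightarrow> nat \<Rightarrow> nat \<Rightarrow> 'a::semiring_0" where
  "mat_mult m x y = (\<lambda>i j. \<Sum>k<m. x i k * y k j)"

definition mat_star :: "(nat \<Rightarrow> nat \<Rightarrow> 'a) \<Rightarrow> nat \<Rightarrow> nat \<Rightarrow> 'a::unital_cstar_algebra" where
  "mat_star x = (\<lambda>i j. star (x j i))"

text \<open>\<open>mat_dsum m x y\<close> is \<open>x \<oplus> y\<close> for an \<open>m \<times> m\<close> matrix \<open>x\<close>.\<close>

definition mat_dsum ::
  "nat \<Rightarrow> (nat \<Rightarrow> nat \<Rightarrow> 'a) \<Rightarrow> (nat \<Rightarrow> nat \<Rightarrow> 'a) \<Rightarrow> nat \<Rightarrow> nat \<Rightarrow> 'a::zero" where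
  "mat_dsum m x y = (\<lambda>i j. if i < m \<and> j < m then x i j
     else if m \<le> i \<and> m \<le> j then y (i - m) (j - m) else 0)"

definition mat_invertible :: "nat \<Rightarrow> (nat \<Rightarrow> nat \<Rightarrow> 'a::ring_1) \<Rightarrow> bool" where
  "mat_invertible m x \<longleftrightarrow>
     (\<exists>y\<in>mat_over m UNIV. mat_mult m x y = mat_one m \<and> mat_mult m y x = mat_one m)"

definition mat_pos :: "nat \<Rightarrow> (nat \<Rightarrow> nat \<Rightarrow> 'a::unital_cstar_algebra) \<Rightarrow> bool" where
  "mat_pos m x \<longleftrightarrow> (\<exists>y\<in>mat_over m UNIV. x = mat_mult m (mat_star y) y)"


section \<open>The C*-envelope\<close>

definition cstar_subalgebra :: "'a::unital_cstar_algebra set \<Rightarrow> bool" where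
  "cstar_subalgebra B \<longleftrightarrow> operator_system B \<and> (\<forall>x\<in>B. \<forall>y\<in>B. x * y \<in> B) \<and> closed B"

definition cstar_generated :: "'a::unital_cstar_algebra set \<Rightarrow> 'a set" where
  "cstar_generated E = \<Inter> {B. cstar_subalgebra B \<and> E \<subseteq> B}"

definition closed_ideal :: "'a::unital_cstar_algebra set \<Rightarrow> bool" where
  "closed_ideal J \<longleftrightarrow> 0 \<in> J \<and> (\<forall>x\<in>J. \<forall>y\<in>J. x + y \<in> J) \<and>
     (\<forall>a. \<forall>x\<in>J. a * x \<in> J \<and> x * a \<in> J) \<and> closed J"

text \<open>
  A boundary ideal for \<open>E \<subseteq> A\<close> is a closed two-sided ideal \<open>J\<close> such that \<open>A \<rightarrow> A/J\<close> is completely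
  isometric on \<open>E\<close>; for this unital map, equivalently, a complete order embedding on \<open>E\<close>.
  The class of \<open>x\<close> in \<open>M\<^sub>m(A/J) = M\<^sub>m(A)/M\<^sub>m(J)\<close> is positive iff \<open>x\<close> agrees modulo \<open>M\<^sub>m(J)\<close> with some
  \<open>p = y\<^sup>*y\<close> in \<open>M\<^sub>m(A)\<close>.
\<close>

definition boundary_ideal :: "'a::unital_cstar_algebra set \<Rightarrow> 'a set \<Rightarrow> bool" where
  "boundary_ideal E J \<longleftrightarrow> closed_ideal J \<and>
     (\<forall>m\<ge>1. \<forall>x\<in>mat_over m E. mat_star x = x \<longrightarrow>
        (\<exists>p. mat_pos m p \<and> (\<forall>i<m. \<forall>j<m. x i j - p i j \<in> J)) \<longrightarrow> mat_pos m x)"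

text \<open>
  The C*-envelope of \<open>E \<subseteq> C\<^sup>*(E)\<close> is the quotient of \<open>C\<^sup>*(E)\<close> by the Shilov ideal of \<open>E\<close>, the largest
  boundary ideal (Arveson, Hamana). So the ambient algebra \<open>'a\<close> is the C*-envelope of \<open>E\<close>
  iff \<open>E\<close> generates it and the Shilov ideal is zero.
\<close>

definition ambient_is_cstar_envelope :: "'a::unital_cstar_algebra set \<Rightarrow> bool" where
  "ambient_is_cstar_envelope E \<longleftrightarrow>
     cstar_generated E = UNIV \<and> (\<forall>J. boundary_ideal E J \<longrightarrow> J = {0})"


section \<open>The semigroups and the K-group of an operator system\<close>

text \<open>
  Below, the ambient algebra \<open>'a\<close> of \<open>E\<close> plays the role of the C*-envelope of \<open>E\<close>. For a
  C*-algebra itself, \<open>E = UNIV\<close>.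
\<close>

definition H :: "'a::unital_cstar_algebra set \<Rightarrow> nat \<Rightarrow> (nat \<Rightarrow> nat \<Rightarrow> 'a) set" where
  "H E m = {x \<in> mat_over m E. mat_star x = x \<and> mat_invertible m x}"

abbreviation H_class ::
  "'a::unital_cstar_algebra set \<Rightarrow> nat \<Rightarrow> (nat \<Rightarrow> nat \<Rightarrow> 'a) \<Rightarrow> (nat \<Rightarrow> nat \<Rightarrow> 'a) set" where
  "H_class E m x \<equiv> path_component_set (H E m) x"

definition V0 :: "'a::unital_cstar_algebra set \<Rightarrow> nat \<Rightarrow> (nat \<Rightarrow> nat \<Rightarrow> 'a) set set" where
  "V0 E m = H_class E m ` H E m"

text \<open>
  Maps out of sets of classes are defined as the union of the values over all representatives;
  since these values coincide, the union is their common value.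
\<close>

definition V0_incl :: "'a::unital_cstar_algebra set \<Rightarrow> nat \<Rightarrow>
    (nat \<Rightarrow> nat \<Rightarrow> 'a) set \<Rightarrow> (nat \<Rightarrow> nat \<Rightarrow> 'a) set" where
  "V0_incl F m c = (\<Union>x\<in>c. H_class F m x)"

definition V0_conn :: "'a::unital_cstar_algebra set \<Rightarrow> nat \<Rightarrow> nat \<Rightarrow>
    (nat \<Rightarrow> nat \<Rightarrow> 'a) set \<Rightarrow> (nat \<Rightarrow> nat \<Rightarrow> 'a) set" where
  "V0_conn E m m' c = (\<Union>x\<in>c. H_class E m' (mat_dsum m x (mat_one (m' - m))))"

definition V0_lim_rel :: "'a::unital_cstar_algebra set \<Rightarrow>
    ((nat \<times> (nat \<Rightarrow> nat \<Rightarrow> 'a) set) \<times> (nat \<times> (nat \<Rightarrow> nat \<Rightarrow> 'a) set)) set" where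
  "V0_lim_rel E = {((m, c), (m', c')). 1 \<le> m \<and> 1 \<le> m' \<and> c \<in> V0 E m \<and> c' \<in> V0 E m' \<and>
     (\<exists>N. m \<le> N \<and> m' \<le> N \<and> V0_conn E m N c = V0_conn E m' N c')}"

definition V0_lim ::
  "'a::unital_cstar_algebra set \<Rightarrow> (nat \<times> (nat \<Rightarrow> nat \<Rightarrow> 'a) set) set monoid" where
  "V0_lim E = \<lparr>
     carrier = (SIGMA m:{1..}. V0 E m) // V0_lim_rel E,
     mult = (\<lambda>P Q. \<Union>(m, c)\<in>P. \<Union>(m', c')\<in>Q. \<Union>x\<in>c. \<Union>x'\<in>c'.
        V0_lim_rel E `` {(m + m', H_class E (m + m') (mat_dsum m x x'))}),
     one = V0_lim_rel E `` {(1, H_class E 1 (mat_one 1))}\<rparr>"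

definition grothendieck_rel :: "'b monoid \<Rightarrow> (('b \<times> 'b) \<times> ('b \<times> 'b)) set" where
  "grothendieck_rel M = {((a, b), (c, d)).
     a \<in> carrier M \<and> b \<in> carrier M \<and> c \<in> carrier M \<and> d \<in> carrier M \<and>
     (\<exists>k\<in>carrier M. a \<otimes>\<^bsub>M\<^esub> d \<otimes>\<^bsub>M\<^esub> k = c \<otimes>\<^bsub>M\<^esub> b \<otimes>\<^bsub>M\<^esub> k)}"

definition grothendieck_group :: "'b monoid \<Rightarrow> ('b \<times> 'b) set monoid" where
  "grothendieck_group M = \<lparr>
     carrier = (carrier M \<times> carrier M) // grothendieck_rel M,
     mult = (\<lambda>P Q. \<Union>(a, b)\<in>P. \<Union>(c, d)\<in>Q. grothendieck_rel M `` {(a \<otimes>\<^bsub>M\<^esub> c, b \<otimes>\<^bsub>M\<^esub> d)}),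
     one = grothendieck_rel M `` {(\<one>\<^bsub>M\<^esub>, \<one>\<^bsub>M\<^esub>)}\<rparr>"

definition K0 :: "'a::unital_cstar_algebra set \<Rightarrow>
    ((nat \<times> (nat \<Rightarrow> nat \<Rightarrow> 'a) set) set \<times> (nat \<times> (nat \<Rightarrow> nat \<Rightarrow> 'a) set) set) set monoid" where
  "K0 E = grothendieck_group (V0_lim E)"

lemma V0_incl_H_class:
  assumes "E \<subseteq> F" "x \<in> H E m"
  shows "V0_incl F m (H_class E m x) = H_class F m x"
proof -
  have "mat_over m E \<subseteq> mat_over m F"
    unfolding mat_over_def using assms(1) by (auto split: if_splits)
  then have sub: "H E m \<subseteq> H F m" by (auto simp: H_def)
  have "(\<Union>y\<in>H_class E m x. H_class F m y) = (\<Union>y\<in>H_class E m x. H_class F m x)"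
  proof (intro SUP_cong refl path_component_eq)
    show "y \<in> H_class F m x" if "y \<in> H_class E m x" for y
      using path_component_of_subset[OF sub] that by blast
  qed
  moreover have "x \<in> H_class E m x" using assms(2) by (simp add: path_component_refl)
  ultimately show ?thesis unfolding V0_incl_def by (metis SUP_const empty_iff)
qed


section \<open>Continuous functions on the circle and the Fejer-Riesz operator systems\<close>

instantiation complex :: unital_cstar_algebra
begin
definition "scaleC_complex = (\<lambda>a x::complex. a * x)"
definition "star_complex = cnj"
instance
proof
  fix a b x y :: complex and r :: real
  show "norm (star x * x) = (norm x)\<^sup>2" by (simp add: star_complex_def norm_mult power2_eq_square)
  show "of_real r *\<^sub>C x = r *\<^sub>R x" by (simp add: scaleC_complex_def scaleR_conv_of_real)
  show "norm (a *\<^sub>C x) = cmod a * norm x" by (simp add: scaleC_complex_def norm_mult)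
  show "star (star x) = x" "star (x + y) = star x + star y" "star (x * y) = star y * star x"
    "star (a *\<^sub>C x) = cnj a *\<^sub>C star x"
    by (simp_all add: scaleC_complex_def star_complex_def)
  show "a *\<^sub>C (x + y) = a *\<^sub>C x + a *\<^sub>C y" "(a + b) *\<^sub>C x = a *\<^sub>C x + b *\<^sub>C x"
    "a *\<^sub>C b *\<^sub>C x = (a * b) *\<^sub>C x" "a *\<^sub>C x * y = a *\<^sub>C (x * y)" "x * a *\<^sub>C y = a *\<^sub>C (x * y)"
    by (simp_all add: scaleC_complex_def algebra_simps)
qed
end

lemma bounded_linear_scaleC: "bounded_linear (\<lambda>x::'b::unital_cstar_algebra. a *\<^sub>C x)"
proof (rule bounded_linear_intro[where K = "cmod a"])
  fix r :: real and x :: 'b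
  show "a *\<^sub>C r *\<^sub>R x = r *\<^sub>R a *\<^sub>C x"
    by (simp add: scaleC_of_real[symmetric] scaleC_scaleC mult.commute)
qed (simp_all add: scaleC_add_right norm_scaleC mult.commute)

lemma bounded_linear_star: "bounded_linear (star :: 'b::unital_cstar_algebra \<Rightarrow> 'b)"
proof (rule bounded_linear_intro[where K = 1])
  fix r :: real and x :: 'b
  show "star (r *\<^sub>R x) = r *\<^sub>R star x"
    by (simp add: scaleC_of_real[symmetric] star_scaleC)
qed (simp_all add: star_add)

lemma bounded_linear_bcontfun:
  assumes "bounded_linear h" "f \<in> bcontfun"
  shows "(\<lambda>x. h (f x)) \<in> bcontfun"
  using assms bounded_linear_image[of "range f" h]
    bounded_linear.continuous_on[of h UNIV f]
  by (auto simp: bcontfun_def image_image)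

lemma mult_bcontfun:
  fixes f g :: "_ \<Rightarrow> 'b::real_normed_algebra"
  assumes "f \<in> bcontfun" "g \<in> bcontfun"
  shows "(\<lambda>x. f x * g x) \<in> bcontfun"
proof -
  obtain a b where ab: "\<And>x. norm (f x) \<le> a" "\<And>x. norm (g x) \<le> b"
    using assms by (auto simp: bcontfun_def bounded_iff)
  have "norm (f x * g x) \<le> a * b" for x
    by (rule order_trans[OF norm_mult_ineq])
      (intro mult_mono ab norm_ge_zero order_trans[OF norm_ge_zero ab(1)[of x]])
  then show ?thesis
    using assms by (intro bcontfun_normI) (auto simp: bcontfun_def intro!: continuous_intros)
qed

text \<open>Bounded continuous functions with values in a C*-algebra, with pointwise operations and the
  supremum norm.\<close>

setup_lifting type_definition_bcontfun

instantiation bcontfun :: (metric_space, unital_cstar_algebra) unital_cstar_algebra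
begin

lift_definition one_bcontfun :: "'a \<Rightarrow>\<^sub>C 'b" is "\<lambda>_. 1"
  by (rule const_bcontfun)

lift_definition times_bcontfun :: "('a \<Rightarrow>\<^sub>C 'b) \<Rightarrow> ('a \<Rightarrow>\<^sub>C 'b) \<Rightarrow> 'a \<Rightarrow>\<^sub>C 'b"
  is "\<lambda>f g x. f x * g x"
  by (rule mult_bcontfun)

lift_definition scaleC_bcontfun :: "complex \<Rightarrow> ('a \<Rightarrow>\<^sub>C 'b) \<Rightarrow> 'a \<Rightarrow>\<^sub>C 'b"
  is "\<lambda>a f x. a *\<^sub>C f x"
  by (rule bounded_linear_bcontfun[OF bounded_linear_scaleC])

lift_definition star_bcontfun :: "('a \<Rightarrow>\<^sub>C 'b) \<Rightarrow> 'a \<Rightarrow>\<^sub>C 'b"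
  is "\<lambda>f x. star (f x)"
  by (rule bounded_linear_bcontfun[OF bounded_linear_star])

lemmas bcontfun_alg_simps =
  one_bcontfun.rep_eq times_bcontfun.rep_eq scaleC_bcontfun.rep_eq star_bcontfun.rep_eq

instance
proof
  fix f g :: "'a \<Rightarrow>\<^sub>C 'b" and a :: complex
  show "norm (f * g) \<le> norm f * norm g"
    by (intro norm_bound)
      (auto simp: bcontfun_alg_simps intro!: order_trans[OF norm_mult_ineq] mult_mono norm_bounded)
  have "norm (1 :: 'a \<Rightarrow>\<^sub>C 'b) \<le> 1"
    by (rule norm_bound) (simp add: bcontfun_alg_simps)
  moreover have "1 \<le> norm (1 :: 'a \<Rightarrow>\<^sub>C 'b)"
    using norm_bounded[of "1 :: 'a \<Rightarrow>\<^sub>C 'b"] by (simp add: bcontfun_alg_simps)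
  ultimately show "norm (1 :: 'a \<Rightarrow>\<^sub>C 'b) = 1" by simp
  show "norm (a *\<^sub>C f) = cmod a * norm f"
  proof (rule antisym)
    show "norm (a *\<^sub>C f) \<le> cmod a * norm f"
      by (intro norm_bound)
        (auto simp: bcontfun_alg_simps norm_scaleC intro!: mult_left_mono norm_bounded)
    show "cmod a * norm f \<le> norm (a *\<^sub>C f)"
    proof (cases "a = 0")
      case False
      have "norm f \<le> norm (a *\<^sub>C f) / cmod a"
        using norm_bounded[of "a *\<^sub>C f"] False
        by (intro norm_bound) (simp add: bcontfun_alg_simps norm_scaleC field_simps)
      then show ?thesis using False by (simp add: field_simps)
    qed simp
  qed
  show "norm (star f * f) = (norm f)\<^sup>2"
  proof (rule antisym)
    show "norm (star f * f) \<le> (norm f)\<^sup>2"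
      by (intro norm_bound)
        (auto simp: bcontfun_alg_simps cstar_identity intro!: power_mono norm_bounded)
    have "norm f \<le> sqrt (norm (star f * f))"
      using norm_bounded[of "star f * f"]
      by (intro norm_bound real_le_rsqrt) (simp add: bcontfun_alg_simps cstar_identity)
    then have "(norm f)\<^sup>2 \<le> (sqrt (norm (star f * f)))\<^sup>2"
      by (rule power_mono) simp
    then show "(norm f)\<^sup>2 \<le> norm (star f * f)" by simp
  qed
  have "apply_bcontfun (0 :: 'a \<Rightarrow>\<^sub>C 'b) undefined \<noteq> apply_bcontfun 1 undefined"
    by (simp add: bcontfun_alg_simps)
  then show "(0 :: 'a \<Rightarrow>\<^sub>C 'b) \<noteq> 1" by metis
  fix h :: "'a \<Rightarrow>\<^sub>C 'b" and b :: complex and r :: real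
  show "f * g * h = f * (g * h)" "(f + g) * h = f * h + g * h" "f * (g + h) = f * g + f * h"
    "1 * f = f" "f * 1 = f"
    by (auto intro!: bcontfun_eqI simp: bcontfun_alg_simps algebra_simps)
  show "r *\<^sub>R f * g = r *\<^sub>R (f * g)" "f * r *\<^sub>R g = r *\<^sub>R (f * g)"
    by (auto intro!: bcontfun_eqI simp: bcontfun_alg_simps)
  show "a *\<^sub>C (f + g) = a *\<^sub>C f + a *\<^sub>C g" "(a + b) *\<^sub>C f = a *\<^sub>C f + b *\<^sub>C f"
    "a *\<^sub>C b *\<^sub>C f = (a * b) *\<^sub>C f" "of_real r *\<^sub>C f = r *\<^sub>R f"
    "a *\<^sub>C f * g = a *\<^sub>C (f * g)" "f * a *\<^sub>C g = a *\<^sub>C (f * g)"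
    by (auto intro!: bcontfun_eqI simp: bcontfun_alg_simps scaleC_add_right scaleC_add_left
        scaleC_scaleC scaleC_of_real mult_scaleC_left mult_scaleC_right)
  show "star (star f) = f" "star (f + g) = star f + star g" "star (f * g) = star g * star f"
    "star (a *\<^sub>C f) = cnj a *\<^sub>C star f"
    by (auto intro!: bcontfun_eqI simp: bcontfun_alg_simps star_add star_mult star_scaleC)
qed

end

typedef circle = "sphere (0::complex) 1"
  morphisms circle_pt Abs_circle
  by (rule exI[of _ 1]) simp

instantiation circle :: metric_space
begin
definition "dist_circle x y = dist (circle_pt x) (circle_pt y)"
definition "uniformity_circle = (INF e\<in>{0<..}. principal {(x::circle, y). dist x y < e})"
definition "open_circle U = (\<forall>x\<in>U. \<forall>\<^sub>F (x', y) in uniformity. (x'::circle) = x \<longrightarrow> y \<in> U)"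
instance
proof
  fix x y z :: circle
  show "dist x y = 0 \<longleftrightarrow> x = y" by (simp add: dist_circle_def circle_pt_inject)
  show "dist x y \<le> dist x z + dist y z" unfolding dist_circle_def by (rule dist_triangle2)
qed (simp_all only: uniformity_circle_def open_circle_def)
end

lemma continuous_on_circle_pt: "continuous_on S circle_pt"
  unfolding continuous_on_iff by (auto simp: dist_circle_def)

lemma compact_UNIV_circle: "compact (UNIV :: circle set)"
proof -
  have "continuous_on (sphere 0 1) Abs_circle"
    unfolding continuous_on_iff by (auto simp: dist_circle_def Abs_circle_inverse)
  then have "compact (Abs_circle ` sphere 0 1)"
    by (rule compact_continuous_image) simp
  then show ?thesis by (metis type_definition.Abs_image type_definition_circle)
qed

text \<open>By compactness every continuous function is bounded, so this is all of \<open>C(S\<^sup>1)\<close>.\<close>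

type_synonym CS1 = "circle \<Rightarrow>\<^sub>C complex"

lemma continuous_imp_bcontfun_circle:
  "continuous_on UNIV f \<Longrightarrow> f \<in> bcontfun" for f :: "circle \<Rightarrow> complex"
  using compact_imp_bounded[OF compact_continuous_image[OF _ compact_UNIV_circle, of f]]
  by (simp add: bcontfun_def)

definition fejer_riesz :: "nat \<Rightarrow> CS1 set" where
  "fejer_riesz n = {a. \<exists>c :: int \<Rightarrow> complex.
     \<forall>z. apply_bcontfun a z = (\<Sum>k = - int n + 1..int n - 1. c k * circle_pt z powi k)}"

lemma operator_system_fejer_riesz:
  assumes "n \<ge> 1"
  shows "operator_system (fejer_riesz n)"
proof -
  let ?I = "{- int n + 1..int n - 1}"
  have "1 \<in> fejer_riesz n"
    unfolding fejer_riesz_def mem_Collect_eq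
  proof (intro exI[of _ "\<lambda>k. if k = 0 then 1 else 0"] allI)
    fix z
    have "(\<Sum>k\<in>?I. (if k = 0 then 1 else 0) * circle_pt z powi k) =
        (\<Sum>k\<in>?I. if k = 0 then 1 else 0)"
      by (rule sum.cong) auto
    then show "apply_bcontfun 1 z = (\<Sum>k\<in>?I. (if k = 0 then 1 else 0) * circle_pt z powi k)"
      using assms by (simp add: bcontfun_alg_simps)
  qed
  moreover have "x + y \<in> fejer_riesz n" if "x \<in> fejer_riesz n" "y \<in> fejer_riesz n" for x y
  proof -
    from that obtain c d where
      "\<forall>z. apply_bcontfun x z = (\<Sum>k\<in>?I. c k * circle_pt z powi k)"
      "\<forall>z. apply_bcontfun y z = (\<Sum>k\<in>?I. d k * circle_pt z powi k)"
      unfolding fejer_riesz_def by blast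
    then show ?thesis unfolding fejer_riesz_def
      by (auto intro!: exI[of _ "\<lambda>k. c k + d k"] simp: algebra_simps sum.distrib)
  qed
  moreover have "a *\<^sub>C x \<in> fejer_riesz n" if "x \<in> fejer_riesz n" for a x
  proof -
    from that obtain c where
      "\<forall>z. apply_bcontfun x z = (\<Sum>k\<in>?I. c k * circle_pt z powi k)"
      unfolding fejer_riesz_def by blast
    then show ?thesis unfolding fejer_riesz_def
      by (auto intro!: exI[of _ "\<lambda>k. a * c k"]
          simp: bcontfun_alg_simps scaleC_complex_def sum_distrib_left mult.assoc)
  qed
  moreover have "star x \<in> fejer_riesz n" if "x \<in> fejer_riesz n" for x
  proof -
    from that obtain c where c:
      "\<forall>z. apply_bcontfun x z = (\<Sum>k\<in>?I. c k * circle_pt z powi k)"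
      unfolding fejer_riesz_def by blast
    have "apply_bcontfun (star x) z = (\<Sum>k\<in>?I. cnj (c (- k)) * circle_pt z powi k)" for z
    proof -
      have "cmod (circle_pt z) = 1" using circle_pt[of z] by simp
      then have inv: "cnj (circle_pt z) = inverse (circle_pt z)"
        by (metis complex_norm_square inverse_unique mult_1 of_real_1 one_power2)
      have "apply_bcontfun (star x) z = (\<Sum>k\<in>?I. cnj (c k) * circle_pt z powi (- k))"
        using c by (simp add: bcontfun_alg_simps star_complex_def inv power_int_minus
            power_int_inverse)
      also have "\<dots> = (\<Sum>k\<in>?I. cnj (c (- k)) * circle_pt z powi k)"
        by (rule sum.reindex_bij_witness[of _ uminus uminus]) auto
      finally show ?thesis .
    qed
    then show ?thesis unfolding fejer_riesz_def
      by (intro CollectI exI[of _ "\<lambda>k. cnj (c (- k))"]) blast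
  qed
  ultimately show ?thesis unfolding operator_system_def by blast
qed

end

theory Submission
  imports Defs "Jordan_Normal_Form.Determinant"
    "HOL-Computational_Algebra.Fundamental_Theorem_Algebra"
begin

hide_const (open) Determinants.det Polynomials.degree Polynomials.lead_coeff up_ring.monom up_ring.coeff

text \<open>
  Put \<open>d = n - 1\<close>. An element of \<open>H(C(S\<^sup>1)\<^sub>(\<^sub>n\<^sub>), m)\<close> is a Hermitian \<open>m \<times> m\<close> matrix \<open>x(z)\<close> of Laurent
  polynomials of degree at most \<open>d\<close>, invertible at every point of the circle. The heart of the
  proof is that every such \<open>x\<close> is joined to a constant diagonal matrix of signs by a path that
  never raises the degree (\<open>joined_standard\<close>). All paths but one have the form \<open>U\<^sub>t\<^sup>* x U\<^sub>t\<close>, so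
  Hermitian symmetry and invertibility come for free and only degrees need care; since \<open>x\<close> is
  Hermitian, the bound on the positive powers of \<open>z\<close> implies the one on the negative powers.

  (1) If \<open>det x\<close> vanishes at some point off the circle, apart from \<open>0\<close> and \<open>\<infinity>\<close>, a unipotent column
  operation makes one column of \<open>x\<close> divisible by a linear factor \<open>1 - \<beta>z\<close>, with \<open>0 < |\<beta>| < 1\<close>. By
  symmetry the corresponding row is divisible by the conjugate factor. Replacing the factor by
  \<open>1 - t\<beta>z\<close> and letting \<open>t\<close> go to \<open>0\<close> sends the zero of the determinant to \<open>\<infinity>\<close> without touching the
  circle (\<open>remove_root\<close>). After finitely many such steps \<open>det x\<close> is constant
  (\<open>to_constant_determinant\<close>).

  (2) Let \<open>\<delta>\<^sub>j\<close> bound the powers of \<open>z\<close> in column \<open>j\<close>. If \<open>\<Sum>\<delta>\<^sub>j > 0\<close>, the matrix of leading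
  coefficients is singular because \<open>det x\<close> is constant, and a column operation lowers some \<open>\<delta>\<^sub>j\<close>
  (\<open>reduce_column_degrees\<close>). This ends with \<open>\<Sum>\<delta>\<^sub>j = 0\<close>.

  (3) Now the entry \<open>x\<^sub>i\<^sub>j\<close> only has powers between \<open>- \<delta>\<^sub>i\<close> and \<open>\<delta>\<^sub>j\<close>, hence vanishes when
  \<open>\<delta>\<^sub>i + \<delta>\<^sub>j < 0\<close>. Multiplying it by \<open>t\<close> to the power \<open>\<delta>\<^sub>i + \<delta>\<^sub>j\<close> does not change the determinant, and
  at \<open>t = 0\<close> only the monomial entries with \<open>\<delta>\<^sub>i + \<delta>\<^sub>j = 0\<close> survive. The limit is \<open>V\<^sup>* L V\<close> with \<open>L\<close>
  a constant matrix and \<open>V\<close> the diagonal matrix of the powers \<open>max(\<delta>\<^sub>j, 0)\<close> of \<open>z\<close>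
  (\<open>degree_zero_endpoint\<close>). Sylvester's law deforms \<open>L\<close> through constant matrices to a diagonal
  matrix of signs, which commutes with \<open>V\<close>.

  The number of negative signs is an invariant, even for paths of arbitrary continuous functions:
  it is the number of negative eigenvalues of \<open>x(1)\<close>, which is locally constant on invertible
  Hermitian matrices (\<open>neg_index_path\<close>). Trigonometric polynomials are dense in \<open>C(S\<^sup>1)\<close>, so every
  element of \<open>H(C(S\<^sup>1), m)\<close> is joined to one with polynomial entries and thereby to a diagonal
  matrix of signs (\<open>H_UNIV_standard\<close>). Thus the same index with values in \<open>{0..m}\<close> classifies the
  components for both operator systems. It is additive under direct sums and vanishes on units, so
  both direct limits are the additive semigroup of the natural numbers, and both \<open>K\<^sub>0\<close>-groups are
  the integers (\<open>index_classified\<close>).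

  The circle algebra is the C*-envelope because \<open>z\<close> generates it, and because an element \<open>f\<close> of a
  boundary ideal with \<open>f(z\<^sub>0) \<noteq> 0\<close> could be used to correct a trigonometric polynomial of degree one
  that is negative only near \<open>z\<^sub>0\<close> into a positive function (\<open>boundary_ideal_fejer_riesz\<close>).
\<close>

section \<open>Determinants of indexed matrices\<close>

text \<open>
  Sizes vary within the proof, so matrices are plain functions of two indices.
\<close>

definition mdet :: "nat \<Rightarrow> (nat \<Rightarrow> nat \<Rightarrow> 'a::comm_ring_1) \<Rightarrow> 'a" where
  "mdet m x = det (mat m m (\<lambda>(i, j). x i j))"

lemma mdet_cong:
  assumes "\<And>i j. i < m \<Longrightarrow> j < m \<Longrightarrow> x i j = y i j"
  shows "mdet m x = mdet m y"
  unfolding mdet_def by (rule arg_cong[where f = det]) (auto intro!: eq_matI simp: assms)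

lemma mdet_mult: "mdet m (mat_mult m x y) = mdet m x * mdet m y"
proof -
  have "mat m m (\<lambda>(i, j). mat_mult m x y i j) =
      mat m m (\<lambda>(i, j). x i j) * mat m m (\<lambda>(i, j). y i j)"
    by (rule eq_matI) (auto simp: mat_mult_def scalar_prod_def lessThan_atLeast0 intro!: sum.cong)
  then show ?thesis
    unfolding mdet_def using det_mult by (metis mat_carrier)
qed

lemma mdet_diag: "mdet m (\<lambda>i j. if i = j then f i else 0) = (\<Prod>i<m. f i)"
proof -
  have "upper_triangular (mat m m (\<lambda>(i, j). if i = j then f i else 0))" by auto
  then have "mdet m (\<lambda>i j. if i = j then f i else 0) =
      prod_list (diag_mat (mat m m (\<lambda>(i, j). if i = j then f i else 0)))"
    unfolding mdet_def by (rule det_upper_triangular[where n = m]) simp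
  also have "\<dots> = (\<Prod>i<m. f i)"
    by (simp add: diag_mat_def prod.list_conv_set_nth lessThan_atLeast0)
  finally show ?thesis .
qed

lemma mdet_explicit:
  "mdet m x = (\<Sum>p\<in>{p. p permutes {..<m}}. signof p * (\<Prod>i<m. x i (p i)))"
proof -
  have "mdet m x = (\<Sum>p\<in>{p. p permutes {0..<m}}. signof p *
      (\<Prod>i = 0..<m. mat m m (\<lambda>(i, j). x i j) $$ (i, p i)))"
    unfolding mdet_def by (rule det_def') simp
  also have "\<dots> = (\<Sum>p\<in>{p. p permutes {..<m}}. signof p * (\<Prod>i<m. x i (p i)))"
    unfolding lessThan_atLeast0
  proof (intro sum.cong arg_cong2[where f = "(*)"] prod.cong refl)
    fix p i assume "p \<in> {p. p permutes {0..<m}}" "i \<in> {0..<m}"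
    then show "mat m m (\<lambda>(i, j). x i j) $$ (i, p i) = x i (p i)"
      using permutes_in_image by fastforce
  qed
  finally show ?thesis .
qed

lemma mdet_transpose: "mdet m (\<lambda>i j. x j i) = mdet m x"
proof -
  have "mat m m (\<lambda>(i, j). x j i) = transpose_mat (mat m m (\<lambda>(i, j). x i j))"
    by (rule eq_matI) auto
  then show ?thesis unfolding mdet_def using det_transpose by (metis mat_carrier)
qed

lemma (in comm_ring_hom) mdet_hom: "mdet m (\<lambda>i j. hom (x i j)) = hom (mdet m x)"
proof -
  have "mat m m (\<lambda>(i, j). hom (x i j)) = map_mat hom (mat m m (\<lambda>(i, j). x i j))"
    by (rule eq_matI) auto
  then show ?thesis unfolding mdet_def by simp
qed

lemma mdet_poly: "mdet m (\<lambda>i j. poly (p i j) z) = poly (mdet m p) z"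
proof -
  interpret comm_ring_hom "\<lambda>p. poly p z" by unfold_locales auto
  show ?thesis by (rule mdet_hom)
qed

lemma mdet_cnj: "mdet m (\<lambda>i j. cnj (x i j)) = cnj (mdet m x)"
proof -
  interpret comm_ring_hom cnj by unfold_locales auto
  show ?thesis by (rule mdet_hom)
qed

lemma mdet_eq_0_iff:
  fixes x :: "nat \<Rightarrow> nat \<Rightarrow> 'a::field"
  shows "mdet m x = 0 \<longleftrightarrow> (\<exists>v. (\<exists>i<m. v i \<noteq> 0) \<and> (\<forall>i<m. (\<Sum>j<m. x i j * v j) = 0))"
proof -
  let ?A = "mat m m (\<lambda>(i, j). x i j)"
  have *: "(?A *\<^sub>v v) $ i = (\<Sum>j<m. x i j * v $ j)" if "v \<in> carrier_vec m" "i < m" for v i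
    using that by (auto simp: scalar_prod_def lessThan_atLeast0 intro!: sum.cong)
  have "mdet m x = 0 \<longleftrightarrow> (\<exists>v. v \<in> carrier_vec m \<and> v \<noteq> 0\<^sub>v m \<and> ?A *\<^sub>v v = 0\<^sub>v m)"
    unfolding mdet_def by (rule det_0_iff_vec_prod_zero_field) simp
  also have "\<dots> \<longleftrightarrow> (\<exists>v. (\<exists>i<m. v i \<noteq> 0) \<and> (\<forall>i<m. (\<Sum>j<m. x i j * v j) = 0))"
  proof safe
    fix v assume v: "v \<in> carrier_vec m" "v \<noteq> 0\<^sub>v m" "?A *\<^sub>v v = 0\<^sub>v m"
    show "\<exists>v. (\<exists>i<m. v i \<noteq> 0) \<and> (\<forall>i<m. (\<Sum>j<m. x i j * v j) = 0)"
    proof (intro exI[of _ "\<lambda>i. v $ i"] conjI)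
      show "\<exists>i<m. v $ i \<noteq> 0" using v(1,2) by (metis eq_vecI carrier_vecD index_zero_vec)
      show "\<forall>i<m. (\<Sum>j<m. x i j * v $ j) = 0"
        using *[OF v(1)] v(3) by (metis index_zero_vec(1))
    qed
  next
    fix v i assume v: "i < m" "v i \<noteq> 0" "\<forall>i<m. (\<Sum>j<m. x i j * v j) = 0"
    show "\<exists>v. v \<in> carrier_vec m \<and> v \<noteq> 0\<^sub>v m \<and> ?A *\<^sub>v v = 0\<^sub>v m"
    proof (intro exI[of _ "vec m v"] conjI)
      show "vec m v \<noteq> 0\<^sub>v m" using v by (metis index_vec index_zero_vec(1))
      show "?A *\<^sub>v vec m v = 0\<^sub>v m"
        by (rule eq_vecI) (use v(3) * in \<open>auto simp del: index_mult_mat_vec\<close>)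
    qed simp
  qed
  finally show ?thesis .
qed

text \<open>
  The adjugate is spelled out through minors because its entries must be seen to be continuous in
  the entries of \<open>x\<close>.
\<close>

definition madj :: "nat \<Rightarrow> (nat \<Rightarrow> nat \<Rightarrow> 'a::comm_ring_1) \<Rightarrow> nat \<Rightarrow> nat \<Rightarrow> 'a" where
  "madj m x i j = (- 1) ^ (j + i) *
     mdet (m - 1) (\<lambda>a b. x (if a < j then a else Suc a) (if b < i then b else Suc b))"

lemma madj:
  fixes x :: "nat \<Rightarrow> nat \<Rightarrow> 'a::comm_ring_1"
  assumes "i < m" "j < m"
  shows "(\<Sum>k<m. x i k * madj m x k j) = (if i = j then mdet m x else 0)"
    and "(\<Sum>k<m. madj m x i k * x k j) = (if i = j then mdet m x else 0)"
proof -
  let ?A = "mat m m (\<lambda>(i, j). x i j)"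
  have A: "?A \<in> carrier_mat m m" by simp
  have adj: "adj_mat ?A $$ (k, l) = madj m x k l" if "k < m" "l < m" for k l
  proof -
    have "mat_delete ?A l k = mat (m - 1) (m - 1)
        (\<lambda>(a, b). x (if a < l then a else Suc a) (if b < k then b else Suc b))"
      unfolding mat_delete_def using that by (intro eq_matI) auto
    then show ?thesis
      using that by (simp add: adj_mat_def cofactor_def madj_def mdet_def)
  qed
  have "(?A * adj_mat ?A) $$ (i, j) = (\<Sum>k<m. x i k * madj m x k j)"
    using assms adj adj_mat(1)[OF A]
    by (auto simp: scalar_prod_def lessThan_atLeast0 intro!: sum.cong)
  then show "(\<Sum>k<m. x i k * madj m x k j) = (if i = j then mdet m x else 0)"
    using adj_mat(2)[OF A] assms by (cases "i = j") (simp_all add: mdet_def)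
  have "(adj_mat ?A * ?A) $$ (i, j) = (\<Sum>k<m. madj m x i k * x k j)"
    using assms adj adj_mat(1)[OF A]
    by (auto simp: scalar_prod_def lessThan_atLeast0 intro!: sum.cong)
  then show "(\<Sum>k<m. madj m x i k * x k j) = (if i = j then mdet m x else 0)"
    using adj_mat(3)[OF A] assms by (cases "i = j") (simp_all add: mdet_def)
qed

lemma continuous_on_mdet:
  fixes x :: "'b::topological_space \<Rightarrow> nat \<Rightarrow> nat \<Rightarrow> complex"
  assumes "\<And>i j. i < m \<Longrightarrow> j < m \<Longrightarrow> continuous_on S (\<lambda>t. x t i j)"
  shows "continuous_on S (\<lambda>t. mdet m (x t))"
  unfolding mdet_explicit
proof (intro continuous_on_sum continuous_on_mult continuous_on_const continuous_on_prod)
  fix p i assume "p \<in> {p. p permutes {..<m}}" "i \<in> {..<m}"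
  then show "continuous_on S (\<lambda>t. x t i (p i))"
    using assms permutes_in_image by fastforce
qed

lemma continuous_on_madj:
  fixes x :: "'b::topological_space \<Rightarrow> nat \<Rightarrow> nat \<Rightarrow> complex"
  assumes "\<And>i j. i < m \<Longrightarrow> j < m \<Longrightarrow> continuous_on S (\<lambda>t. x t i j)" "i < m" "j < m"
  shows "continuous_on S (\<lambda>t. madj m (x t) i j)"
  unfolding madj_def using assms
  by (intro continuous_on_mult continuous_on_const continuous_on_mdet) auto

lemma mat_mult_assoc:
  "mat_mult m (mat_mult m x y) z = mat_mult m x (mat_mult m y z)"
proof (intro ext)
  fix i j
  have "(\<Sum>k<m. \<Sum>l<m. x i l * y l k * z k j) = (\<Sum>l<m. \<Sum>k<m. x i l * y l k * z k j)"
    by (rule sum.swap)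
  then show "mat_mult m (mat_mult m x y) z i j = mat_mult m x (mat_mult m y z) i j"
    by (simp add: mat_mult_def sum_distrib_left sum_distrib_right mult.assoc)
qed

text \<open>
  The only permutation that avoids the zero entries is the identity: rows other than \<open>l\<close> can only be
  matched with their own column or with column \<open>l\<close>, which row \<open>l\<close> needs for itself.
\<close>

lemma mdet_column_unipotent:
  fixes u :: "nat \<Rightarrow> 'a::comm_ring_1"
  assumes "l < m"
  shows "mdet m (\<lambda>i j. if i = j then 1 else if j = l then u i else 0) = 1"
proof -
  let ?U = "\<lambda>i j. if i = j then 1 else if j = l then u i else 0"
  have zero: "(\<Prod>i<m. ?U i (p i)) = 0" if p: "p permutes {..<m}" "p \<noteq> id" for p
  proof -
    have "\<exists>i<m. p i \<noteq> i \<and> p i \<noteq> l"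
    proof (rule ccontr)
      assume *: "\<not> (\<exists>i<m. p i \<noteq> i \<and> p i \<noteq> l)"
      have "p l = l" using * assms by metis
      have "p i = i" for i
      proof (cases "i < m")
        case True
        then show ?thesis using * \<open>p l = l\<close> permutes_inj[OF p(1)] by (metis injD)
      qed (use p(1) permutes_not_in in fastforce)
      then show False using p(2) by auto
    qed
    then obtain i where i: "i < m" "p i \<noteq> i" "p i \<noteq> l" by blast
    then have "?U i (p i) = 0" by auto
    then have "\<exists>a\<in>{..<m}. ?U a (p a) = 0" using i(1) by blast
    then show ?thesis by (rule prod_zero[OF finite_lessThan])
  qed
  have "mdet m ?U = (\<Sum>p\<in>{p. p permutes {..<m}}. if p = id then 1 else 0)"
    unfolding mdet_explicit using zero by (intro sum.cong) auto
  then show ?thesis by (simp add: finite_permutations permutes_id)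
qed

section \<open>Hermitian matrices and congruence\<close>

definition hermitian :: "nat \<Rightarrow> (nat \<Rightarrow> nat \<Rightarrow> complex) \<Rightarrow> bool" where
  "hermitian m h \<longleftrightarrow> (\<forall>i<m. \<forall>j<m. h j i = cnj (h i j))"

text \<open>
  \<open>congr m U h\<close> is the congruence \<open>U\<^sup>* h U\<close>.
\<close>

definition congr :: "nat \<Rightarrow> (nat \<Rightarrow> nat \<Rightarrow> complex) \<Rightarrow> (nat \<Rightarrow> nat \<Rightarrow> complex) \<Rightarrow> nat \<Rightarrow> nat \<Rightarrow> complex"
  where "congr m U h = mat_mult m (\<lambda>i j. cnj (U j i)) (mat_mult m h U)"

lemma hermitianD: "hermitian m h \<Longrightarrow> i < m \<Longrightarrow> j < m \<Longrightarrow> h j i = cnj (h i j)"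
  unfolding hermitian_def by blast

definition sign_mat :: "nat set \<Rightarrow> nat \<Rightarrow> nat \<Rightarrow> complex" where
  "sign_mat A i j = (if i = j then if i \<in> A then - 1 else 1 else 0)"

definition id_mat :: "nat \<Rightarrow> nat \<Rightarrow> complex" where
  "id_mat i j = (if i = j then 1 else 0)"

lemma congr_entry: "congr m U h i j = (\<Sum>k<m. \<Sum>l<m. cnj (U k i) * h k l * U l j)"
  by (simp add: congr_def mat_mult_def sum_distrib_left mult.assoc)

lemma congr_cong:
  assumes "\<And>k l. k < m \<Longrightarrow> l < m \<Longrightarrow> h k l = h' k l" "\<And>k l. k < m \<Longrightarrow> l < m \<Longrightarrow> U k l = U' k l"
    and "i < m" "j < m"
  shows "congr m U h i j = congr m U' h' i j"
  unfolding congr_entry using assms by (intro sum.cong refl) auto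

lemma mdet_congr: "mdet m (congr m U h) = cnj (mdet m U) * mdet m h * mdet m U"
proof -
  have "mdet m (\<lambda>i j. cnj (U j i)) = cnj (mdet m U)"
    using mdet_transpose[of m "\<lambda>i j. cnj (U i j)"] mdet_cnj[of m U] by simp
  then show ?thesis by (simp add: congr_def mdet_mult)
qed

lemma hermitian_congr: "hermitian m h \<Longrightarrow> hermitian m (congr m U h)"
  unfolding hermitian_def[of m "congr m U h"] congr_entry
proof (intro allI impI)
  fix i j assume h: "hermitian m h"
  have "(\<Sum>k<m. \<Sum>l<m. cnj (U k j) * h k l * U l i) = (\<Sum>l<m. \<Sum>k<m. cnj (U k j) * h k l * U l i)"
    by (rule sum.swap)
  also have "\<dots> = (\<Sum>k<m. \<Sum>l<m. cnj (cnj (U k i) * h k l * U l j))"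
  proof (intro sum.cong refl)
    fix k l assume "k \<in> {..<m}" "l \<in> {..<m}"
    then show "cnj (U l j) * h l k * U k i = cnj (cnj (U k i) * h k l * U l j)"
      using hermitianD[OF h, of k l] by simp
  qed
  finally show "(\<Sum>k<m. \<Sum>l<m. cnj (U k j) * h k l * U l i) =
      cnj (\<Sum>k<m. \<Sum>l<m. cnj (U k i) * h k l * U l j)" by simp
qed

lemma congr_congr: "congr m V (congr m U h) = congr m (mat_mult m U V) h"
proof -
  have "(\<lambda>i j. cnj (mat_mult m U V j i)) =
      mat_mult m (\<lambda>i j. cnj (V j i)) (\<lambda>i j. cnj (U j i))"
    by (intro ext) (simp add: mat_mult_def mult.commute)
  then show ?thesis by (simp add: congr_def mat_mult_assoc)
qed

lemma congr_reindex:
  assumes "p i < m" "p j < m"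
  shows "congr m (\<lambda>k l. if k = p l then 1 else 0) h i j = h (p i) (p j)"
  unfolding congr_entry using assms
  by (simp add: if_distrib[of cnj] mult_delta_left mult_delta_right cong: if_cong)

lemma congr_id_mat: "i < m \<Longrightarrow> j < m \<Longrightarrow> congr m id_mat h i j = h i j"
  using congr_reindex[where p = "\<lambda>i. i"] unfolding id_mat_def[abs_def] .

lemma mdet_sign_mat: "mdet m (sign_mat A) \<noteq> 0"
  unfolding sign_mat_def[abs_def] mdet_diag by (simp add: prod_zero_iff)

lemma hermitian_sign_mat: "hermitian m (sign_mat A)"
  by (auto simp: hermitian_def sign_mat_def)

lemma mdet_id_mat: "mdet m id_mat = 1"
  unfolding id_mat_def[abs_def] mdet_diag by simp

lemma mat_inverse_exists:
  fixes S :: "nat \<Rightarrow> nat \<Rightarrow> complex"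
  assumes "mdet m S \<noteq> 0"
  obtains T where "mdet m T \<noteq> 0" "\<And>i j. i < m \<Longrightarrow> j < m \<Longrightarrow> mat_mult m S T i j = id_mat i j"
    "\<And>i j. i < m \<Longrightarrow> j < m \<Longrightarrow> mat_mult m T S i j = id_mat i j"
proof -
  define T where "T i j = madj m S i j / mdet m S" for i j
  have 1: "mat_mult m S T i j = id_mat i j" if "i < m" "j < m" for i j
    using madj(1)[of i m j S] that assms
    by (simp add: mat_mult_def T_def id_mat_def flip: sum_divide_distrib)
  have 2: "mat_mult m T S i j = id_mat i j" if "i < m" "j < m" for i j
    using madj(2)[of i m j S] that assms
    by (simp add: mat_mult_def T_def id_mat_def flip: sum_divide_distrib)
  have "mdet m (mat_mult m S T) = mdet m id_mat" by (rule mdet_cong) (rule 1)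
  then have "mdet m T \<noteq> 0" by (auto simp: mdet_mult mdet_id_mat)
  then show ?thesis using that 1 2 by blast
qed

lemma congr_inverse:
  assumes "\<And>i j. i < m \<Longrightarrow> j < m \<Longrightarrow> mat_mult m S T i j = id_mat i j"
    and "\<And>i j. i < m \<Longrightarrow> j < m \<Longrightarrow> congr m S h i j = g i j" "i < m" "j < m"
  shows "h i j = congr m T g i j"
proof -
  have "congr m T g i j = congr m T (congr m S h) i j"
    by (rule congr_cong) (use assms in auto)
  also have "\<dots> = congr m id_mat h i j"
    unfolding congr_congr by (rule congr_cong) (use assms in auto)
  finally show ?thesis using congr_id_mat assms by simp
qed

text \<open>
  A linear system with fewer equations than unknowns: pad with zero rows to a singular square
  matrix.
\<close>

lemma underdetermined:
  fixes T :: "nat \<Rightarrow> nat \<Rightarrow> complex"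
  assumes "finite I" "finite J" "card J < card I"
  obtains v where "\<exists>j\<in>I. v j \<noteq> 0" "\<And>i. i \<in> J \<Longrightarrow> (\<Sum>j\<in>I. T i j * v j) = 0"
proof -
  define k where "k = card I"
  obtain f where f: "bij_betw f {..<k} I"
    using ex_bij_betw_nat_finite[OF assms(1)] by (auto simp: k_def lessThan_atLeast0)
  obtain g where g: "bij_betw g {..<card J} J"
    using ex_bij_betw_nat_finite[OF assms(2)] by (auto simp: lessThan_atLeast0)
  define x where "x a b = (if a < card J then T (g a) (f b) else 0)" for a b
  have "mdet k (\<lambda>i j. x j i) = 0"
    unfolding mdet_eq_0_iff
  proof (intro exI[of _ "\<lambda>a. if a = card J then 1 else 0"] conjI allI impI)
    show "\<exists>i<k. (if i = card J then 1 else 0 :: complex) \<noteq> 0"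
      using assms(3) by (intro exI[of _ "card J"]) (simp add: k_def)
    show "(\<Sum>j<k. x j i * (if j = card J then 1 else 0)) = 0" for i
      by (rule sum.neutral) (auto simp: x_def)
  qed
  then have "mdet k x = 0" using mdet_transpose[of k x] by simp
  then obtain v where v: "\<exists>i<k. v i \<noteq> 0" "\<And>i. i < k \<Longrightarrow> (\<Sum>j<k. x i j * v j) = 0"
    unfolding mdet_eq_0_iff by blast
  define w where "w j = v (inv_into {..<k} f j)" for j
  have w: "w (f b) = v b" if "b < k" for b
    using f that by (simp add: w_def bij_betw_def)
  show ?thesis
  proof
    show "\<exists>j\<in>I. w j \<noteq> 0"
      using v(1) w f by (metis bij_betwE lessThan_iff)
    fix i assume "i \<in> J"
    then obtain a where a: "a < card J" "i = g a"
      using g by (metis bij_betw_iff_bijections lessThan_iff)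
    have "(\<Sum>j\<in>I. T i j * w j) = (\<Sum>b<k. T i (f b) * w (f b))"
      by (rule sum.reindex_bij_betw[OF f, symmetric])
    also have "\<dots> = (\<Sum>b<k. x a b * v b)" using a w by (simp add: x_def)
    also have "\<dots> = 0" using v(2)[of a] a assms(3) k_def by simp
    finally show "(\<Sum>j\<in>I. T i j * w j) = 0" .
  qed
qed

section \<open>Sylvester's law of inertia\<close>

definition sesq :: "nat \<Rightarrow> (nat \<Rightarrow> nat \<Rightarrow> complex) \<Rightarrow> (nat \<Rightarrow> complex) \<Rightarrow> (nat \<Rightarrow> complex) \<Rightarrow> complex"
  where "sesq m h u w = (\<Sum>i<m. \<Sum>j<m. cnj (u i) * h i j * w j)"

lemma sesq_add: "sesq m h u (\<lambda>i. w i + w' i) = sesq m h u w + sesq m h u w'"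
    "sesq m h (\<lambda>i. u i + u' i) w = sesq m h u w + sesq m h u' w"
  by (simp_all add: sesq_def algebra_simps sum.distrib)

lemma sesq_scale: "sesq m h u (\<lambda>i. c * w i) = c * sesq m h u w"
    "sesq m h (\<lambda>i. c * u i) w = cnj c * sesq m h u w"
  by (simp_all add: sesq_def algebra_simps sum_distrib_left)

lemma sesq_sum: "sesq m h u (\<lambda>i. \<Sum>a\<in>A. w a i) = (\<Sum>a\<in>A. sesq m h u (w a))"
proof (induction A rule: infinite_finite_induct)
  case (insert a A)
  then show ?case by (simp add: sesq_add)
qed (simp_all add: sesq_def)

lemma sesq_herm: "hermitian m h \<Longrightarrow> sesq m h w u = cnj (sesq m h u w)"
proof -
  assume h: "hermitian m h"
  have "sesq m h w u = (\<Sum>j<m. \<Sum>i<m. cnj (w i) * h i j * u j)"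
    unfolding sesq_def by (rule sum.swap)
  also have "\<dots> = (\<Sum>j<m. \<Sum>i<m. cnj (cnj (u j) * h j i * w i))"
  proof (intro sum.cong refl)
    fix i j assume "i \<in> {..<m}" "j \<in> {..<m}"
    then show "cnj (w i) * h i j * u j = cnj (cnj (u j) * h j i * w i)"
      using hermitianD[OF h, of j i] by simp
  qed
  also have "\<dots> = cnj (sesq m h u w)" by (simp add: sesq_def)
  finally show ?thesis .
qed

text \<open>
  The orthogonal complement of the vectors found so far contains a nonzero vector for dimension
  reasons. If the form vanished on the diagonal of this complement, it would vanish on it by
  polarization, and then the complement would lie in the kernel of the whole form.
\<close>

lemma sylvester_step:
  assumes h: "hermitian m h" "mdet m h \<noteq> 0" and "k < m"
    and v: "\<And>a b. a < k \<Longrightarrow> b < k \<Longrightarrow> sesq m h (v a) (v b) = sign_mat A a b"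
  obtains w where "sesq m h w w = 1 \<or> sesq m h w w = - 1" "\<And>a. a < k \<Longrightarrow> sesq m h (v a) w = 0"
proof -
  define W where "W = {w. \<forall>a<k. sesq m h (v a) w = 0}"
  have add: "(\<lambda>i. w i + w' i) \<in> W" if "w \<in> W" "w' \<in> W" for w w'
    using that by (simp add: W_def sesq_add)
  have scale: "(\<lambda>i. c * w i) \<in> W" if "w \<in> W" for w c
    using that by (simp add: W_def sesq_scale)
  obtain w0 where w0: "\<exists>j\<in>{..<m}. w0 j \<noteq> 0"
    "\<And>a. a \<in> {..<k} \<Longrightarrow> (\<Sum>j\<in>{..<m}. (\<Sum>i<m. cnj (v a i) * h i j) * w0 j) = 0"
    using underdetermined[of "{..<m}" "{..<k}" "\<lambda>a j. \<Sum>i<m. cnj (v a i) * h i j"] assms(3) by auto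
  have w0W: "w0 \<in> W"
    unfolding W_def sesq_def
    using w0(2) sum.swap[of "\<lambda>i j. cnj (v _ i) * h i j * w0 j" "{..<m}" "{..<m}"]
    by (simp add: sum_distrib_right)
  have "\<exists>w\<in>W. sesq m h w w \<noteq> 0"
  proof (rule ccontr)
    assume *: "\<not> ?thesis"
    have pol: "sesq m h w w' = 0" if w: "w \<in> W" "w' \<in> W" for w w'
    proof -
      have "sesq m h (\<lambda>i. w i + w' i) (\<lambda>i. w i + w' i) = 0" using * add w by blast
      then have 1: "sesq m h w w' + sesq m h w' w = 0" using * w by (simp add: sesq_add add.commute)
      have "sesq m h (\<lambda>i. w i + \<i> * w' i) (\<lambda>i. w i + \<i> * w' i) = 0"
        using * add[OF w(1) scale[OF w(2)]] by blast
      then have 2: "\<i> * sesq m h w w' - \<i> * sesq m h w' w = 0"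
        using * w by (simp add: sesq_add sesq_scale)
      have "sesq m h w w' - sesq m h w' w = 0"
        using 2 by (metis complex_i_not_zero mult_eq_0_iff right_diff_distrib)
      with 1 show ?thesis by simp
    qed
    have all: "sesq m h w0 u = 0" for u
    proof -
      define u' where "u' i = u i + (\<Sum>a<k. (- sign_mat A a a * sesq m h (v a) u) * v a i)" for i
      have exp: "sesq m h x u' = sesq m h x u +
          (\<Sum>a<k. - sign_mat A a a * sesq m h (v a) u * sesq m h x (v a))" for x
        unfolding u'_def[abs_def] sesq_add sesq_sum sesq_scale ..
      have "sesq m h (v b) u' = 0" if "b < k" for b
      proof -
        have "sesq m h (v b) u' = sesq m h (v b) u +
            (\<Sum>a<k. if a = b then - sesq m h (v b) u else 0)"
          unfolding exp using v that by (intro arg_cong2[where f = "(+)"] sum.cong refl) (auto simp: sign_mat_def)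
        then show ?thesis using that by simp
      qed
      then have "u' \<in> W" by (simp add: W_def)
      then have "0 = sesq m h w0 u'" using pol[OF w0W] by simp
      also have "\<dots> = sesq m h w0 u"
        unfolding exp using w0W sesq_herm[OF h(1), of w0 "v _"] by (simp add: W_def)
      finally show ?thesis by simp
    qed
    have "mdet m h = 0"
      unfolding mdet_eq_0_iff
    proof (intro exI[of _ w0] conjI allI impI)
      fix j assume j: "j < m"
      have "0 = sesq m h w0 (\<lambda>i. if i = j then 1 else 0)" using all by simp
      also have "\<dots> = (\<Sum>i<m. cnj (w0 i) * h i j)"
        unfolding sesq_def using j by (simp add: if_distrib cong: if_cong)
      finally have "cnj (\<Sum>i<m. cnj (w0 i) * h i j) = 0" by simp
      moreover have "(\<Sum>i<m. h j i * w0 i) = (\<Sum>i<m. cnj (cnj (w0 i) * h i j))"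
        using hermitianD[OF h(1) _ j] by (intro sum.cong refl) simp
      ultimately show "(\<Sum>i<m. h j i * w0 i) = 0" by simp
    qed (use w0 in auto)
    then show False using h(2) by simp
  qed
  then obtain w where w: "w \<in> W" "sesq m h w w \<noteq> 0" by blast
  define r where "r = Re (sesq m h w w)"
  have "sesq m h w w = complex_of_real r"
    using sesq_herm[OF h(1), of w w] by (simp add: r_def complex_eq_iff)
  with w(2) have r: "sesq m h w w = complex_of_real r" "r \<noteq> 0" by auto
  define c where "c = complex_of_real (1 / sqrt \<bar>r\<bar>)"
  have "c * c = complex_of_real (1 / \<bar>r\<bar>)"
    unfolding c_def of_real_mult[symmetric] by simp
  then have "sesq m h (\<lambda>i. c * w i) (\<lambda>i. c * w i) = complex_of_real (1 / \<bar>r\<bar> * r)"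
    using r(1) unfolding sesq_scale by (simp add: c_def)
  moreover have "1 / \<bar>r\<bar> * r = 1 \<or> 1 / \<bar>r\<bar> * r = - 1" using r(2) by (auto simp: abs_if)
  ultimately have "sesq m h (\<lambda>i. c * w i) (\<lambda>i. c * w i) = 1 \<or> sesq m h (\<lambda>i. c * w i) (\<lambda>i. c * w i) = - 1"
    by (metis of_real_1 of_real_minus)
  moreover have "sesq m h (v a) (\<lambda>i. c * w i) = 0" if "a < k" for a
    using scale[OF w(1)] that by (simp add: W_def)
  ultimately show ?thesis using that by blast
qed

lemma sylvester_basis:
  assumes h: "hermitian m h" "mdet m h \<noteq> 0" and "k \<le> m"
  shows "\<exists>v A. A \<subseteq> {..<k} \<and> (\<forall>a<k. \<forall>b<k. sesq m h (v a) (v b) = sign_mat A a b)"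
  using assms(3)
proof (induction k)
  case (Suc k)
  then obtain v A where A: "A \<subseteq> {..<k}"
    and v: "\<And>a b. a < k \<Longrightarrow> b < k \<Longrightarrow> sesq m h (v a) (v b) = sign_mat A a b"
    using Suc_leD by blast
  obtain w where w: "sesq m h w w = 1 \<or> sesq m h w w = - 1" "\<And>a. a < k \<Longrightarrow> sesq m h (v a) w = 0"
    using sylvester_step[OF h _ v] Suc.prems by (metis Suc_le_lessD)
  have w': "sesq m h w (v a) = 0" if "a < k" for a
    using sesq_herm[OF h(1)] w(2) that by (metis complex_cnj_zero)
  define A' where "A' = (if sesq m h w w = 1 then A else insert k A)"
  have "sesq m h ((v(k := w)) a) ((v(k := w)) b) = sign_mat A' a b" if "a < Suc k" "b < Suc k" for a b
    using that A v[of a b] w w' less_antisym by (auto simp: sign_mat_def A'_def)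
  moreover have "A' \<subseteq> {..<Suc k}" using A by (auto simp: A'_def)
  ultimately show ?case by blast
qed auto

lemma sylvester:
  assumes "hermitian m h" "mdet m h \<noteq> 0"
  obtains A T where "A \<subseteq> {..<m}" "mdet m T \<noteq> 0"
    "\<And>i j. i < m \<Longrightarrow> j < m \<Longrightarrow> h i j = congr m T (sign_mat A) i j"
proof -
  obtain v A where A: "A \<subseteq> {..<m}"
    and v: "\<And>a b. a < m \<Longrightarrow> b < m \<Longrightarrow> sesq m h (v a) (v b) = sign_mat A a b"
    using sylvester_basis[OF assms le_refl] by blast
  define S where "S i a = v a i" for i a
  have S: "congr m S h a b = sign_mat A a b" if "a < m" "b < m" for a b
    using v that by (simp add: congr_entry S_def sesq_def)
  have "mdet m (congr m S h) = mdet m (sign_mat A)" by (rule mdet_cong) (rule S)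
  then have "mdet m (congr m S h) \<noteq> 0" using mdet_sign_mat by simp
  then have "mdet m S \<noteq> 0" by (auto simp: mdet_congr)
  then obtain T where T: "mdet m T \<noteq> 0" "\<And>i j. i < m \<Longrightarrow> j < m \<Longrightarrow> mat_mult m S T i j = id_mat i j"
    using mat_inverse_exists by metis
  show ?thesis using that[OF A T(1)] congr_inverse[OF T(2) S] by blast
qed

lemma sign_mat_permute:
  assumes "A \<subseteq> {..<m}"
  obtains T where "mdet m T \<noteq> 0"
    "\<And>i j. i < m \<Longrightarrow> j < m \<Longrightarrow> congr m T (sign_mat A) i j = sign_mat {..<card A} i j"
proof -
  have fin: "finite A" using assms finite_subset by blast
  have le: "card A \<le> m" using card_mono[OF _ assms] by simp
  obtain f where f: "bij_betw f {..<card A} A"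
    using ex_bij_betw_nat_finite[OF fin] by (auto simp: lessThan_atLeast0)
  have "card {card A..<m} = card ({..<m} - A)" using fin assms by (simp add: card_Diff_subset)
  then obtain g where g: "bij_betw g {card A..<m} ({..<m} - A)"
    by (metis finite_same_card_bij finite_Diff finite_atLeastLessThan finite_lessThan)
  define p where "p i = (if i < card A then f i else g i)" for i
  have p1: "p i \<in> A" if "i < card A" for i using f that by (auto simp: p_def bij_betw_def)
  have p2: "p i \<in> {..<m} - A" if "card A \<le> i" "i < m" for i
    using g that by (force simp: p_def bij_betw_def)
  have pm: "p i < m" if "i < m" for i using p1[of i] p2[of i] that assms by (cases "i < card A") auto
  have inj: "p i = p j \<longleftrightarrow> i = j" if "i < m" "j < m" for i j
  proof -
    have "inj_on f {..<card A}" "inj_on g {card A..<m}" using f g by (auto simp: bij_betw_def)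
    then have "i < card A \<Longrightarrow> j < card A \<Longrightarrow> f i = f j \<longleftrightarrow> i = j"
      "\<not> i < card A \<Longrightarrow> \<not> j < card A \<Longrightarrow> g i = g j \<longleftrightarrow> i = j"
      using that by (auto simp: inj_on_eq_iff)
    moreover have "p i \<noteq> p j" if "(i < card A) \<noteq> (j < card A)"
      using p1[of i] p2[of i] p1[of j] p2[of j] that \<open>i < m\<close> \<open>j < m\<close>
      by (metis DiffD2 not_less)
    ultimately show ?thesis
    proof (cases "(i < card A) = (j < card A)")
      case True
      with \<open>i < card A \<Longrightarrow> j < card A \<Longrightarrow> f i = f j \<longleftrightarrow> i = j\<close>
        \<open>\<not> i < card A \<Longrightarrow> \<not> j < card A \<Longrightarrow> g i = g j \<longleftrightarrow> i = j\<close>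
      show ?thesis by (cases "i < card A") (simp_all add: p_def)
    qed blast
  qed
  define T where "T i j = (if i = p j then 1 else 0 :: complex)" for i j
  have T: "congr m T (sign_mat A) i j = sign_mat {..<card A} i j" if "i < m" "j < m" for i j
  proof -
    have "congr m T (sign_mat A) i j = sign_mat A (p i) (p j)"
      unfolding T_def[abs_def] using pm that by (intro congr_reindex) auto
    also have "\<dots> = sign_mat {..<card A} i j"
      using inj[OF that] p1[of i] p2[of i] that by (auto simp: sign_mat_def not_less)
    finally show ?thesis .
  qed
  have "mdet m (congr m T (sign_mat A)) = mdet m (sign_mat {..<card A})" by (rule mdet_cong) (rule T)
  then have "mdet m (congr m T (sign_mat A)) \<noteq> 0" using mdet_sign_mat by simp
  then have "mdet m T \<noteq> 0" by (auto simp: mdet_congr)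
  then show ?thesis using that T by blast
qed

lemma sesq_congr:
  "sesq m (congr m T h) v v = sesq m h (\<lambda>i. \<Sum>j<m. T i j * v j) (\<lambda>i. \<Sum>j<m. T i j * v j)"
proof -
  have prod: "(\<Sum>i<m. f i) * c * (\<Sum>j<m. g j) = (\<Sum>i<m. \<Sum>j<m. f i * c * g j)"
    for f g and c :: complex
    unfolding sum_distrib_right by (simp add: sum_distrib_left)
  let ?f = "\<lambda>i j k l. cnj (T k i * v i) * h k l * (T l j * v j)"
  have "sesq m (congr m T h) v v = (\<Sum>i<m. \<Sum>j<m. \<Sum>k<m. \<Sum>l<m. ?f i j k l)"
    by (simp add: sesq_def congr_entry sum_distrib_left sum_distrib_right mult_ac)
  also have "\<dots> = (\<Sum>i<m. \<Sum>k<m. \<Sum>j<m. \<Sum>l<m. ?f i j k l)"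
    by (rule sum.cong[OF refl], rule sum.swap)
  also have "\<dots> = (\<Sum>k<m. \<Sum>i<m. \<Sum>j<m. \<Sum>l<m. ?f i j k l)"
    by (rule sum.swap)
  also have "\<dots> = (\<Sum>k<m. \<Sum>i<m. \<Sum>l<m. \<Sum>j<m. ?f i j k l)"
    by (rule sum.cong[OF refl], rule sum.cong[OF refl], rule sum.swap)
  also have "\<dots> = (\<Sum>k<m. \<Sum>l<m. \<Sum>i<m. \<Sum>j<m. ?f i j k l)"
    by (rule sum.cong[OF refl], rule sum.swap)
  also have "\<dots> = sesq m h (\<lambda>i. \<Sum>j<m. T i j * v j) (\<lambda>i. \<Sum>j<m. T i j * v j)"
    unfolding sesq_def cnj_sum complex_cnj_mult prod by (rule refl)
  finally show ?thesis .
qed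

lemma sesq_diag:
  fixes d :: "nat \<Rightarrow> complex"
  shows "sesq m (\<lambda>i j. if i = j then d i else 0) v v = (\<Sum>i<m. d i * (cmod (v i))\<^sup>2)"
  unfolding sesq_def
proof (intro sum.cong refl)
  fix i assume i: "i \<in> {..<m}"
  have "(\<Sum>j<m. cnj (v i) * (if i = j then d i else 0) * v j) =
      (\<Sum>j<m. if i = j then cnj (v i) * d i * v j else 0)" by (intro sum.cong) auto
  also have "\<dots> = d i * (v i * cnj (v i))" using i by simp
  finally show "(\<Sum>j<m. cnj (v i) * (if i = j then d i else 0) * v j) = d i * (cmod (v i))\<^sup>2"
    by (simp only: complex_norm_square)
qed

text \<open>
  If the form \<open>h\<close> is negative definite on a coordinate subspace of dimension larger than the number
  of negative coefficients, some nonzero vector of that subspace is mapped by \<open>T\<close> to a vector with zero coordinates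
  at all negative coefficients, and the form is nonnegative on it: a contradiction.
\<close>

lemma inertia_le:
  fixes s :: "nat \<Rightarrow> real" and T :: "nat \<Rightarrow> nat \<Rightarrow> complex"
  assumes I: "I \<subseteq> {..<m}"
    and h: "\<And>i j. i < m \<Longrightarrow> j < m \<Longrightarrow> h i j = congr m T (\<lambda>i j. if i = j then of_real (s i) else 0) i j"
    and neg: "\<And>v :: nat \<Rightarrow> complex. \<lbrakk>\<exists>i\<in>I. v i \<noteq> 0; \<And>i. i \<notin> I \<Longrightarrow> v i = 0\<rbrakk> \<Longrightarrow> Re (sesq m h v v) < 0"
  shows "card I \<le> card {i. i < m \<and> s i < 0}"
proof (rule ccontr)
  assume "\<not> ?thesis"
  then obtain v where v: "\<exists>j\<in>I. v j \<noteq> 0"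
    "\<And>i. i \<in> {i. i < m \<and> s i < 0} \<Longrightarrow> (\<Sum>j\<in>I. T i j * v j) = 0"
    using underdetermined[of I "{i. i < m \<and> s i < 0}" T] finite_subset[OF I] by auto
  define w where "w j = (if j \<in> I then v j else 0)" for j
  define u where "u i = (\<Sum>j<m. T i j * w j)" for i
  have u: "u i = 0" if "i < m" "s i < 0" for i
  proof -
    have "u i = (\<Sum>j\<in>I. T i j * v j)"
      unfolding u_def by (rule sum.mono_neutral_cong_right) (use I in \<open>auto simp: w_def\<close>)
    then show ?thesis using v(2) that by simp
  qed
  have "sesq m h w w = sesq m (congr m T (\<lambda>i j. if i = j then of_real (s i) else 0)) w w"
    unfolding sesq_def using h by (intro sum.cong refl) auto
  also have "\<dots> = (\<Sum>i<m. complex_of_real (s i) * complex_of_real ((cmod (u i))\<^sup>2))"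
    unfolding sesq_congr sesq_diag u_def by (rule refl)
  finally have "Re (sesq m h w w) = (\<Sum>i<m. s i * (cmod (u i))\<^sup>2)" by simp
  also have "\<dots> \<ge> 0" by (rule sum_nonneg) (use u in \<open>metis lessThan_iff mult_nonneg_nonneg norm_eq_zero not_le order_refl zero_le_power2 mult_zero_right power_zero_numeral norm_zero\<close>)
  finally have "Re (sesq m h w w) \<ge> 0" .
  moreover have "Re (sesq m h w w) < 0" using neg[of w] v(1) by (auto simp: w_def)
  ultimately show False by simp
qed

text \<open>
  Entrywise errors below \<open>1/m\<close> change the form by less than the squared norm, since
  \<open>|v\<^sub>i v\<^sub>j| \<le> (|v\<^sub>i|\<^sup>2 + |v\<^sub>j|\<^sup>2) / 2\<close>.
\<close>

lemma sesq_close_diag: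
  fixes s :: "nat \<Rightarrow> real" and v :: "nat \<Rightarrow> complex"
  assumes close: "\<And>i j. i < m \<Longrightarrow> j < m \<Longrightarrow> cmod (h i j - (if i = j then of_real (s i) else 0)) < 1 / m"
    and s: "\<And>i. i \<in> I \<Longrightarrow> s i = - 1"
    and I: "I \<subseteq> {..<m}" and v: "\<exists>i\<in>I. v i \<noteq> 0" "\<And>i. i \<notin> I \<Longrightarrow> v i = 0"
  shows "Re (sesq m h v v) < 0"
proof -
  define D where "D i j = (if i = j then complex_of_real (s i) else 0)" for i j
  define N where "N = (\<Sum>i<m. (cmod (v i))\<^sup>2)"
  obtain a where a: "a < m" "v a \<noteq> 0" using v(1) I by auto
  have "sesq m h v v = sesq m D v v + (\<Sum>i<m. \<Sum>j<m. cnj (v i) * (h i j - D i j) * v j)"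
    unfolding sesq_def by (simp add: algebra_simps flip: sum.distrib)
  moreover have "Re (sesq m D v v) = - N"
  proof -
    have "Re (sesq m D v v) = (\<Sum>i<m. s i * (cmod (v i))\<^sup>2)"
      unfolding D_def[abs_def] sesq_diag by simp
    also have "\<dots> = (\<Sum>i<m. - (cmod (v i))\<^sup>2)"
      using s v(2) by (intro sum.cong refl) (metis mult_minus1 norm_zero power_zero_numeral mult_zero_right neg_equal_0_iff_equal)
    finally show ?thesis by (simp add: N_def sum_negf)
  qed
  moreover have "cmod (\<Sum>i<m. \<Sum>j<m. cnj (v i) * (h i j - D i j) * v j) < N"
  proof -
    have *: "cmod (cnj (v i) * (h i j - D i j) * v j) \<le>
        1 / m * (((cmod (v i))\<^sup>2 + (cmod (v j))\<^sup>2) / 2)" if "i < m" "j < m" for i j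
    proof -
      have "cmod (cnj (v i) * (h i j - D i j) * v j) =
          cmod (h i j - D i j) * (cmod (v i) * cmod (v j))" by (simp add: norm_mult)
      also have "\<dots> \<le> 1 / m * (((cmod (v i))\<^sup>2 + (cmod (v j))\<^sup>2) / 2)"
        using close[OF that] sum_squares_bound[of "cmod (v i)" "cmod (v j)"]
        by (intro mult_mono) (auto simp: D_def intro: less_imp_le)
      finally show ?thesis .
    qed
    have strict: "cmod (cnj (v a) * (h a a - D a a) * v a) <
        1 / m * (((cmod (v a))\<^sup>2 + (cmod (v a))\<^sup>2) / 2)"
    proof -
      have "cmod (cnj (v a) * (h a a - D a a) * v a) = cmod (h a a - D a a) * (cmod (v a))\<^sup>2"
        by (simp add: norm_mult power2_eq_square)
      also have "\<dots> < 1 / m * (cmod (v a))\<^sup>2"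
        using close[OF a(1) a(1)] a(2) by (intro mult_strict_right_mono) (auto simp: D_def)
      finally show ?thesis by simp
    qed
    have "cmod (\<Sum>i<m. \<Sum>j<m. cnj (v i) * (h i j - D i j) * v j) \<le>
        (\<Sum>i<m. \<Sum>j<m. cmod (cnj (v i) * (h i j - D i j) * v j))"
      by (intro order_trans[OF norm_sum] sum_mono norm_sum)
    also have "\<dots> < (\<Sum>i<m. \<Sum>j<m. 1 / m * (((cmod (v i))\<^sup>2 + (cmod (v j))\<^sup>2) / 2))"
    proof (rule sum_strict_mono_ex1)
      show "\<forall>i\<in>{..<m}. (\<Sum>j<m. cmod (cnj (v i) * (h i j - D i j) * v j)) \<le>
          (\<Sum>j<m. 1 / m * (((cmod (v i))\<^sup>2 + (cmod (v j))\<^sup>2) / 2))"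
        using * by (auto intro!: sum_mono)
      show "\<exists>i\<in>{..<m}. (\<Sum>j<m. cmod (cnj (v i) * (h i j - D i j) * v j)) <
          (\<Sum>j<m. 1 / m * (((cmod (v i))\<^sup>2 + (cmod (v j))\<^sup>2) / 2))"
        using * strict a(1) by (intro bexI[of _ a] sum_strict_mono_ex1) auto
    qed simp
    also have "\<dots> = 1 / m * (\<Sum>i<m. \<Sum>j<m. ((cmod (v i))\<^sup>2 + (cmod (v j))\<^sup>2) / 2)"
      by (simp add: sum_distrib_left)
    also have "(\<Sum>i<m. \<Sum>j<m. ((cmod (v i))\<^sup>2 + (cmod (v j))\<^sup>2) / 2) = m * N"
      by (simp add: N_def sum.distrib flip: sum_divide_distrib sum_distrib_left)
    finally show ?thesis using a by simp
  qed
  ultimately show ?thesis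
    using abs_Re_le_cmod[of "\<Sum>i<m. \<Sum>j<m. cnj (v i) * (h i j - D i j) * v j"] by simp
qed

text \<open>
  This contains both the uniqueness in Sylvester's law and its stability under perturbation.
\<close>

lemma inertia_close:
  assumes A: "A \<subseteq> {..<m}" "A' \<subseteq> {..<m}"
    and close: "\<And>i j. i < m \<Longrightarrow> j < m \<Longrightarrow> cmod (h i j - sign_mat A i j) < 1 / m"
    and h: "\<And>i j. i < m \<Longrightarrow> j < m \<Longrightarrow> h i j = congr m T (sign_mat A') i j"
  shows "card A' = card A"
proof -
  define s where "s B i = (if i \<in> B then - 1 else 1 :: real)" for B :: "nat set" and i
  have D: "sign_mat B = (\<lambda>i j. if i = j then of_real (s B i) else 0)" for B
    by (intro ext) (simp add: sign_mat_def s_def)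
  have "card A \<le> card {i. i < m \<and> s A' i < 0}"
  proof (rule inertia_le[OF A(1) h[unfolded D]])
    fix v :: "nat \<Rightarrow> complex" assume "\<exists>i\<in>A. v i \<noteq> 0" "\<And>i. i \<notin> A \<Longrightarrow> v i = 0"
    then show "Re (sesq m h v v) < 0"
      by (intro sesq_close_diag[OF close[unfolded D] _ A(1)]) (auto simp: s_def)
  qed
  also have "{i. i < m \<and> s A' i < 0} = A'" using A(2) by (auto simp: s_def)
  finally have 1: "card A \<le> card A'" .
  have "card ({..<m} - A) \<le> card {i. i < m \<and> - s A' i < 0}"
  proof (rule inertia_le[where h = "\<lambda>i j. - h i j"])
    fix i j assume ij: "i < m" "j < m"
    have "- h i j = - congr m T (sign_mat A') i j" using h ij by simp
    also have "\<dots> = congr m T (\<lambda>i j. if i = j then of_real (- s A' i) else 0) i j"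
      unfolding D congr_entry sum_negf[symmetric] by (intro sum.cong refl) auto
    finally show "- h i j = congr m T (\<lambda>i j. if i = j then of_real (- s A' i) else 0) i j" .
  next
    fix v :: "nat \<Rightarrow> complex" assume v: "\<exists>i\<in>{..<m} - A. v i \<noteq> 0" "\<And>i. i \<notin> {..<m} - A \<Longrightarrow> v i = 0"
    show "Re (sesq m (\<lambda>i j. - h i j) v v) < 0"
    proof (rule sesq_close_diag[where s = "\<lambda>i. - s A i", OF _ _ _ v])
      fix i j assume ij: "i < m" "j < m"
      have "- h i j - (if i = j then complex_of_real (- s A i) else 0) = - (h i j - sign_mat A i j)"
        by (simp add: D)
      then show "cmod (- h i j - (if i = j then complex_of_real (- s A i) else 0)) < 1 / m"
        using close[OF ij] by (simp only: norm_minus_cancel)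
    qed (auto simp: s_def)
  qed auto
  also have "{i. i < m \<and> - s A' i < 0} = {..<m} - A'" by (auto simp: s_def)
  finally have "m - card A \<le> m - card A'"
    using A by (simp add: card_Diff_subset finite_subset[OF A(1)] finite_subset[OF A(2)])
  moreover have "card A \<le> m" "card A' \<le> m" using A card_mono[of "{..<m}"] by auto
  ultimately show ?thesis using 1 by linarith
qed

text \<open>
  The number of negative eigenvalues of an invertible Hermitian matrix, defined through Sylvester's
  law.
\<close>

definition neg_index :: "nat \<Rightarrow> (nat \<Rightarrow> nat \<Rightarrow> complex) \<Rightarrow> nat" where
  "neg_index m h = (SOME q. \<exists>A T. A \<subseteq> {..<m} \<and> card A = q \<and> mdet m T \<noteq> 0 \<and>
     (\<forall>i<m. \<forall>j<m. h i j = congr m T (sign_mat A) i j))"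

lemma neg_index_witness:
  assumes "hermitian m h" "mdet m h \<noteq> 0"
  obtains A T where "A \<subseteq> {..<m}" "card A = neg_index m h" "mdet m T \<noteq> 0"
    "\<And>i j. i < m \<Longrightarrow> j < m \<Longrightarrow> h i j = congr m T (sign_mat A) i j"
proof -
  have "\<exists>q A T. A \<subseteq> {..<m} \<and> card A = q \<and> mdet m T \<noteq> 0 \<and>
     (\<forall>i<m. \<forall>j<m. h i j = congr m T (sign_mat A) i j)"
    using sylvester[OF assms] by metis
  from someI_ex[OF this] show ?thesis unfolding neg_index_def[symmetric] using that by blast
qed

lemma neg_index_close:
  assumes A: "A \<subseteq> {..<m}" and h: "hermitian m h" "mdet m h \<noteq> 0"
    and close: "\<And>i j. i < m \<Longrightarrow> j < m \<Longrightarrow> cmod (congr m R h i j - sign_mat A i j) < 1 / m"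
  shows "neg_index m h = card A"
proof -
  obtain A' T where T: "A' \<subseteq> {..<m}" "card A' = neg_index m h"
    "\<And>i j. i < m \<Longrightarrow> j < m \<Longrightarrow> h i j = congr m T (sign_mat A') i j"
    using neg_index_witness[OF h] by metis
  have "card A' = card A"
  proof (rule inertia_close[OF A T(1) close])
    fix i j assume "i < m" "j < m"
    then have "congr m R h i j = congr m R (congr m T (sign_mat A')) i j"
      using T(3) by (intro congr_cong) auto
    then show "congr m R h i j = congr m (mat_mult m T R) (sign_mat A') i j"
      by (simp add: congr_congr)
  qed
  then show ?thesis using T(2) by simp
qed

lemma neg_index_sign_mat:
  assumes "A \<subseteq> {..<m}"
  shows "neg_index m (sign_mat A) = card A"
  by (rule neg_index_close[OF assms hermitian_sign_mat mdet_sign_mat, where R = id_mat]) (auto simp: congr_id_mat)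

lemma neg_index_cong:
  assumes "\<And>i j. i < m \<Longrightarrow> j < m \<Longrightarrow> h i j = h' i j"
  shows "neg_index m h = neg_index m h'"
  unfolding neg_index_def using assms by (intro arg_cong[where f = Eps] ext) auto

lemma neg_index_path:
  fixes h :: "real \<Rightarrow> nat \<Rightarrow> nat \<Rightarrow> complex"
  assumes cont: "\<And>i j. i < m \<Longrightarrow> j < m \<Longrightarrow> continuous_on {0..1} (\<lambda>t. h t i j)"
    and h: "\<And>t. t \<in> {0..1} \<Longrightarrow> hermitian m (h t)" "\<And>t. t \<in> {0..1} \<Longrightarrow> mdet m (h t) \<noteq> 0"
  shows "neg_index m (h 0) = neg_index m (h 1)"
proof -
  have "(\<lambda>t. neg_index m (h t)) constant_on {0..1}"
  proof (rule locally_constant_imp_constant)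
    fix t0 :: real assume t0: "t0 \<in> {0..1}"
    obtain A T where A: "A \<subseteq> {..<m}" "card A = neg_index m (h t0)" and T: "mdet m T \<noteq> 0"
      "\<And>i j. i < m \<Longrightarrow> j < m \<Longrightarrow> h t0 i j = congr m T (sign_mat A) i j"
      using neg_index_witness[OF h(1)[OF t0] h(2)[OF t0]] by metis
    obtain R where R: "\<And>i j. i < m \<Longrightarrow> j < m \<Longrightarrow> mat_mult m T R i j = id_mat i j"
      using mat_inverse_exists[OF T(1)] by metis
    have at_t0: "sign_mat A i j = congr m R (h t0) i j" if "i < m" "j < m" for i j
      using congr_inverse[OF R T(2)[symmetric] that] .
    have contR: "continuous_on {0..1} (\<lambda>t. congr m R (h t) i j)" for i j
      unfolding congr_entry using cont by (intro continuous_intros) auto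
    have "\<forall>\<^sub>F t in at t0 within {0..1}. cmod (congr m R (h t) i j - sign_mat A i j) < 1 / m"
      if "i < m" "j < m" for i j
    proof -
      have "((\<lambda>t. congr m R (h t) i j) \<longlongrightarrow> sign_mat A i j) (at t0 within {0..1})"
        using contR[of i j] t0 unfolding continuous_on_def at_t0[OF that] by blast
      then show ?thesis using that unfolding tendsto_iff dist_norm by simp
    qed
    then have "\<forall>\<^sub>F t in at t0 within {0..1}. \<forall>i\<in>{..<m}. \<forall>j\<in>{..<m}.
        cmod (congr m R (h t) i j - sign_mat A i j) < 1 / m"
      by (intro eventually_ball_finite ballI) auto
    then obtain U where U: "open U" "t0 \<in> U"
      "\<And>t. t \<in> U \<Longrightarrow> t \<noteq> t0 \<Longrightarrow> t \<in> {0..1} \<Longrightarrow> \<forall>i\<in>{..<m}. \<forall>j\<in>{..<m}.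
        cmod (congr m R (h t) i j - sign_mat A i j) < 1 / m"
      unfolding eventually_at_topological by blast
    have "neg_index m (h t) = neg_index m (h t0)" if "t \<in> {0..1} \<inter> U" for t
    proof (cases "t = t0")
      case False
      then have "neg_index m (h t) = card A"
        using U(3)[of t] that h by (intro neg_index_close[OF A(1)]) auto
      then show ?thesis using A(2) by simp
    qed simp
    then show "\<exists>T. openin (top_of_set {0..1}) T \<and> t0 \<in> T \<and>
        (\<forall>x\<in>T. neg_index m (h x) = neg_index m (h t0))"
      using U(1,2) t0 by (intro exI[of _ "{0..1} \<inter> U"] conjI ballI openin_open_Int IntI)
  qed simp
  then show ?thesis by (auto simp: constant_on_def)
qed

section \<open>Connectedness of the general linear group\<close>

text \<open>
  On the complex line through the identity and \<open>S\<close> the determinant has finitely many zeros, and the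
  complement of a finite subset of the plane is path connected.
\<close>

lemma GL_path:
  fixes S :: "nat \<Rightarrow> nat \<Rightarrow> complex"
  assumes "mdet m S \<noteq> 0"
  obtains \<gamma> :: "real \<Rightarrow> complex" where "continuous_on {0..1} \<gamma>" "\<gamma> 0 = 0" "\<gamma> 1 = 1"
    "\<And>t. t \<in> {0..1} \<Longrightarrow> mdet m (\<lambda>i j. (1 - \<gamma> t) * id_mat i j + \<gamma> t * S i j) \<noteq> 0"
proof -
  \<comment> \<open>the determinant along the line, as a polynomial in the parameter\<close>
  define p where "p = mdet m (\<lambda>i j. [:id_mat i j, S i j - id_mat i j:])"
  have p: "poly p c = mdet m (\<lambda>i j. (1 - c) * id_mat i j + c * S i j)" for c
    unfolding p_def mdet_poly[symmetric] by (rule mdet_cong) (simp add: algebra_simps)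
  have p01: "poly p 0 \<noteq> 0" "poly p 1 \<noteq> 0"
    using assms unfolding p by (simp_all add: mdet_id_mat)
  then have "p \<noteq> 0" by auto
  then have "path_connected (- {c. poly p c = 0})"
    by (intro path_connected_complement_countable uncountable_infinite countable_finite poly_roots_finite) simp_all
  then obtain \<gamma> where \<gamma>: "path \<gamma>" "path_image \<gamma> \<subseteq> - {c. poly p c = 0}"
    "pathstart \<gamma> = 0" "pathfinish \<gamma> = 1"
    using p01 unfolding path_connected_def by blast
  show ?thesis
  proof
    show "continuous_on {0..1} \<gamma>" using \<gamma>(1) by (simp add: path_def)
    show "\<gamma> 0 = 0" "\<gamma> 1 = 1" using \<gamma>(3,4) by (simp_all add: pathstart_def pathfinish_def)
    show "mdet m (\<lambda>i j. (1 - \<gamma> t) * id_mat i j + \<gamma> t * S i j) \<noteq> 0" if "t \<in> {0..1}" for t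
      using \<gamma>(2) that unfolding p[symmetric] path_image_def by (auto simp: image_subset_iff)
  qed
qed

section \<open>Laurent polynomials on the unit circle\<close>

abbreviation S1 :: "complex set" where "S1 \<equiv> sphere 0 1"

lemma S1_nz: "z \<in> S1 \<Longrightarrow> z \<noteq> 0" by auto

lemma S1_cnj: "z \<in> S1 \<Longrightarrow> cnj z = inverse z"
  by (simp add: complex_norm_square cis_cnj divide_conv_cnj inverse_eq_divide)

lemma S1_inverse: "z \<in> S1 \<Longrightarrow> inverse z \<in> S1"
  by (simp add: norm_inverse)

lemma infinite_S1: "infinite S1"
proof
  assume "finite S1"
  moreover have "connected S1" by (rule connected_sphere) simp
  ultimately obtain a where "S1 = {a}"
    by (metis connected_finite_iff_sing mem_sphere_0 norm_one empty_iff)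
  moreover have "1 \<in> S1" "-1 \<in> S1" by simp_all
  ultimately show False by (metis one_neq_neg_one singletonD)
qed

lemma poly_eq_on_S1:
  fixes p q :: "complex poly"
  assumes "\<And>z. z \<in> S1 \<Longrightarrow> poly p z = poly q z"
  shows "p = q"
proof (rule ccontr)
  assume "p \<noteq> q"
  then have "finite {z. poly (p - q) z = 0}" by (intro poly_roots_finite) simp
  moreover have "S1 \<subseteq> {z. poly (p - q) z = 0}" using assms by auto
  ultimately show False using infinite_S1 finite_subset by blast
qed

text \<open>
  \<open>deg_le k f\<close> says that, on the circle, \<open>f\<close> lies in \<open>z\<^sup>k \<complex>[z\<^sup>-\<^sup>1]\<close>: a Laurent polynomial with powers
  at most \<open>k\<close>. A lower bound \<open>- l\<close> on the powers of \<open>f\<close> is expressed as \<open>deg_le l\<close> of the conjugate.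
\<close>

definition deg_le :: "int \<Rightarrow> (complex \<Rightarrow> complex) \<Rightarrow> bool" where
  "deg_le k f \<longleftrightarrow> (\<exists>p. \<forall>z\<in>S1. f z = z powi k * poly p (inverse z))"

lemma deg_le_I: "(\<And>z. z \<in> S1 \<Longrightarrow> f z = z powi k * poly p (inverse z)) \<Longrightarrow> deg_le k f"
  unfolding deg_le_def by blast

lemma deg_le_eqI: "deg_le k g \<Longrightarrow> (\<And>z. z \<in> S1 \<Longrightarrow> f z = g z) \<Longrightarrow> deg_le k f"
  unfolding deg_le_def by auto

lemma deg_le_mono: "deg_le k f \<Longrightarrow> k \<le> l \<Longrightarrow> deg_le l f"
proof -
  assume "deg_le k f" "k \<le> l"
  then obtain p where p: "\<And>z. z \<in> S1 \<Longrightarrow> f z = z powi k * poly p (inverse z)"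
    unfolding deg_le_def by blast
  show "deg_le l f"
  proof (rule deg_le_I)
    fix z assume z: "z \<in> S1"
    have "z powi k = z powi l * inverse z ^ nat (l - k)"
      using \<open>k \<le> l\<close> S1_nz[OF z]
      by (simp add: power_int_diff field_simps flip: power_int_of_nat power_int_minus)
    then show "f z = z powi l * poly (monom 1 (nat (l - k)) * p) (inverse z)"
      using p[OF z] by (simp add: poly_monom)
  qed
qed

lemma deg_le_add: "deg_le k f \<Longrightarrow> deg_le k g \<Longrightarrow> deg_le k (\<lambda>z. f z + g z)"
  unfolding deg_le_def
proof (elim exE)
  fix p q assume "\<forall>z\<in>S1. f z = z powi k * poly p (inverse z)" "\<forall>z\<in>S1. g z = z powi k * poly q (inverse z)"
  then show "\<exists>p. \<forall>z\<in>S1. f z + g z = z powi k * poly p (inverse z)"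
    by (intro exI[of _ "p + q"]) (simp add: algebra_simps)
qed

lemma deg_le_mult: "deg_le k f \<Longrightarrow> deg_le l g \<Longrightarrow> deg_le (k + l) (\<lambda>z. f z * g z)"
  unfolding deg_le_def
proof (elim exE)
  fix p q assume "\<forall>z\<in>S1. f z = z powi k * poly p (inverse z)" "\<forall>z\<in>S1. g z = z powi l * poly q (inverse z)"
  then show "\<exists>p. \<forall>z\<in>S1. f z * g z = z powi (k + l) * poly p (inverse z)"
    using S1_nz by (intro exI[of _ "p * q"]) (simp add: power_int_add)
qed

lemma deg_le_powi: "k \<le> l \<Longrightarrow> deg_le l (\<lambda>z. c * z powi k)"
  by (rule deg_le_mono[of k], rule deg_le_I[where p = "[:c:]"]) simp_all

lemma deg_le_const: "0 \<le> k \<Longrightarrow> deg_le k (\<lambda>z. c)"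
  using deg_le_powi[of 0 k c] by simp

lemma deg_le_cmult: "deg_le k f \<Longrightarrow> deg_le k (\<lambda>z. c * f z)"
  using deg_le_mult[OF deg_le_const[of 0 c], of k f] by simp

lemma deg_le_sum: "(\<And>i. i \<in> I \<Longrightarrow> deg_le k (f i)) \<Longrightarrow> deg_le k (\<lambda>z. \<Sum>i\<in>I. f i z)"
proof (induction I rule: infinite_finite_induct)
  case (insert i I)
  then show ?case by (simp add: deg_le_add)
qed (auto intro: deg_le_I[where p = 0])

lemma deg_le_continuous: "deg_le k f \<Longrightarrow> continuous_on S1 f"
proof -
  assume "deg_le k f"
  then obtain p where p: "\<And>z. z \<in> S1 \<Longrightarrow> f z = z powi k * poly p (inverse z)"
    unfolding deg_le_def by blast
  have "continuous_on S1 (\<lambda>z. z powi k)"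
    using S1_nz by (intro continuous_on_power_int continuous_on_id disjI2) blast
  moreover have "continuous_on S1 (\<lambda>z. poly p (inverse z))"
    using S1_nz by (intro continuous_on_poly continuous_on_inverse continuous_on_id) blast
  ultimately have "continuous_on S1 (\<lambda>z. z powi k * poly p (inverse z))"
    by (rule continuous_on_mult)
  then show ?thesis by (rule continuous_on_eq) (simp only: p)
qed

text \<open>
  Comparing the expansions from above and from below, after multiplication by a power of \<open>w = z\<^sup>-\<^sup>1\<close>,
  gives an identity between polynomials in \<open>w\<close>, from which the degree is read off.
\<close>

lemma laurent_degree:
  assumes p: "\<And>z. z \<in> S1 \<Longrightarrow> f z = z powi b * poly p (inverse z)"
    and "deg_le a (\<lambda>z. cnj (f z))" and "p \<noteq> 0"
  shows "int (degree p) \<le> a + b"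
proof -
  obtain q0 where q0: "\<And>z. z \<in> S1 \<Longrightarrow> cnj (f z) = z powi a * poly q0 (inverse z)"
    using assms(2) unfolding deg_le_def by blast
  define q where "q = map_poly cnj q0"
  have q: "poly q z = cnj (poly q0 (cnj z))" for z
    unfolding q_def by (metis complex_cnj_cnj poly_cnj)
  define r where "r = reflect_poly q"
  \<comment> \<open>large enough to make all exponents below nonnegative\<close>
  define M where "M = nat \<bar>a\<bar> + nat \<bar>b\<bar>"
  have eq: "monom 1 (nat (int (M + degree q) - b)) * p = monom 1 (nat (int M + a)) * r"
  proof (rule poly_eq_on_S1)
    fix w :: complex assume w: "w \<in> S1"
    then have z: "inverse w \<in> S1" and nz: "w \<noteq> 0" by (auto simp: norm_inverse)
    have "f (inverse w) = cnj (inverse w powi a * poly q0 w)"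
      using q0[OF z] by (metis complex_cnj_cnj inverse_inverse_eq)
    also have "\<dots> = w powi a * poly q (inverse w)"
      using S1_cnj[OF w] by (simp add: q)
    finally have "inverse w powi b * poly p w = w powi a * poly q (inverse w)"
      using p[OF z] by simp
    then have "w powi (- b) * poly p w * w ^ degree q = w powi a * poly r w"
      using nz by (simp add: r_def poly_reflect_poly_nz power_int_minus power_int_inverse)
    then have "w powi (int M) * (w powi (- b) * w powi (int (degree q))) * poly p w =
        w powi (int M) * w powi a * poly r w"
      by (simp add: power_int_of_nat mult_ac)
    moreover have k: "int (nat (int (M + degree q) - b)) = int M + (- b + int (degree q))"
      "int (nat (int M + a)) = int M + a" by (simp_all add: M_def)
    have "w powi (int M) * (w powi (- b) * w powi (int (degree q))) =
        w powi int (nat (int (M + degree q) - b))"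
      "w powi (int M) * w powi a = w powi int (nat (int M + a))"
      unfolding k using nz
      by (simp_all add: power_int_add power_int_diff power_int_minus divide_inverse mult_ac)
    ultimately show "poly (monom 1 (nat (int (M + degree q) - b)) * p) w =
        poly (monom 1 (nat (int M + a)) * r) w"
      by (simp only: poly_mult poly_monom power_int_of_nat mult_1_left)
  qed
  then have "r \<noteq> 0" using \<open>p \<noteq> 0\<close> by (metis monom_eq_0_iff mult_eq_0_iff one_neq_zero)
  have "nat (int (M + degree q) - b) + degree p = nat (int M + a) + degree r"
    using arg_cong[OF eq, of degree] \<open>p \<noteq> 0\<close> \<open>r \<noteq> 0\<close> by (simp add: degree_mult_eq degree_monom_eq)
  moreover have "degree r \<le> degree q" unfolding r_def by (rule degree_reflect_poly_le)
  ultimately show ?thesis unfolding M_def by linarith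
qed

text \<open>
  When \<open>a + b < 0\<close> the sum is empty, so that \<open>f\<close> vanishes; the third deformation depends on this.
\<close>

lemma laurent_coeffs:
  assumes "deg_le b f" and "deg_le a (\<lambda>z. cnj (f z))"
  shows "\<exists>c. \<forall>z\<in>S1. f z = (\<Sum>k=-a..b. c k * z powi k)"
proof -
  obtain p where p: "\<And>z. z \<in> S1 \<Longrightarrow> f z = z powi b * poly p (inverse z)"
    using assms(1) unfolding deg_le_def by blast
  have *: "f z = (\<Sum>k=-a..b. coeff p (nat (b - k)) * z powi k)" if z: "z \<in> S1" for z
  proof (cases "p = 0")
    case False
    then have deg: "int (degree p) \<le> a + b" using laurent_degree[OF p assms(2)] by simp
    have "poly p (inverse z) = (\<Sum>i\<le>nat (a + b). coeff p i * inverse z ^ i)"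
      unfolding poly_altdef by (rule sum.mono_neutral_left) (use deg in \<open>auto simp: coeff_eq_0\<close>)
    then have "f z = z powi b * (\<Sum>i\<le>nat (a + b). coeff p i * inverse z ^ i)"
      using p[OF z] by simp
    also have "\<dots> = (\<Sum>i\<le>nat (a + b). coeff p i * z powi (b - int i))"
      using S1_nz[OF z]
      by (simp add: sum_distrib_left power_int_diff power_int_of_nat field_simps)
    also have "\<dots> = (\<Sum>k=-a..b. coeff p (nat (b - k)) * z powi k)"
      by (rule sum.reindex_bij_witness[of _ "\<lambda>k. nat (b - k)" "\<lambda>i. b - int i"]) (use deg in auto)
    finally show ?thesis .
  qed (use p[OF z] in simp)
  then show ?thesis by (intro exI[of _ "\<lambda>k. coeff p (nat (b - k))"] ballI)
qed

lemma deg_le_laurent: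
  assumes "a \<ge> 0" "\<And>z. z \<in> S1 \<Longrightarrow> f z = (\<Sum>k=-a..a. c k * z powi k)"
  shows "deg_le a f" "deg_le a (\<lambda>z. cnj (f z))"
proof -
  have "deg_le a (\<lambda>z. \<Sum>k=-a..a. c k * z powi k)"
    by (intro deg_le_sum deg_le_powi) auto
  then show "deg_le a f" by (rule deg_le_eqI) (rule assms(2))
  have "cnj (f z) = (\<Sum>k=-a..a. cnj (c k) * z powi (- k))" if "z \<in> S1" for z
    using assms(2)[OF that] S1_cnj[OF that] by (simp add: power_int_minus power_int_inverse)
  moreover have "deg_le a (\<lambda>z. \<Sum>k=-a..a. cnj (c k) * z powi (- k))"
    by (intro deg_le_sum deg_le_powi) auto
  ultimately show "deg_le a (\<lambda>z. cnj (f z))" by (blast intro: deg_le_eqI)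
qed

section \<open>Matrices of functions on the circle\<close>

lemma cmod_circle_pt [simp]: "cmod (circle_pt z) = 1" using circle_pt[of z] by simp

lemma Bcontfun_apply:
  fixes f :: "complex \<Rightarrow> complex"
  assumes "continuous_on S1 f"
  shows "apply_bcontfun (Bcontfun (\<lambda>z. f (circle_pt z))) z = f (circle_pt z)"
proof -
  have "continuous_on UNIV (f \<circ> circle_pt)"
    by (rule continuous_on_compose[OF continuous_on_circle_pt continuous_on_subset[OF assms]])
      (use circle_pt in blast)
  then have "(\<lambda>z. f (circle_pt z)) \<in> bcontfun"
    unfolding o_def by (rule continuous_imp_bcontfun_circle)
  then show ?thesis by (simp add: Bcontfun_inverse)
qed

text \<open>
  Passage between a matrix over \<open>C(S\<^sup>1)\<close> and its symbol, a function on the unit circle of the complex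
  plane whose values are matrices.
\<close>

definition of_symbol :: "nat \<Rightarrow> (complex \<Rightarrow> nat \<Rightarrow> nat \<Rightarrow> complex) \<Rightarrow> nat \<Rightarrow> nat \<Rightarrow> CS1" where
  "of_symbol m f i j = (if i < m \<and> j < m then Bcontfun (\<lambda>z. f (circle_pt z) i j) else 0)"

definition symbol :: "(nat \<Rightarrow> nat \<Rightarrow> CS1) \<Rightarrow> complex \<Rightarrow> nat \<Rightarrow> nat \<Rightarrow> complex" where
  "symbol x z i j = apply_bcontfun (x i j) (Abs_circle z)"

lemma symbol_circle_pt: "symbol x (circle_pt z) i j = apply_bcontfun (x i j) z"
  by (simp add: symbol_def circle_pt_inverse)

lemma continuous_on_Abs_circle: "continuous_on S1 Abs_circle"
  unfolding continuous_on_iff by (auto simp: dist_circle_def Abs_circle_inverse)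

lemma continuous_on_symbol: "continuous_on S1 (\<lambda>z. symbol x z i j)"
  unfolding symbol_def
  using continuous_on_compose[OF continuous_on_Abs_circle, of "apply_bcontfun (x i j)"]
  by (simp add: o_def continuous_on_apply_bcontfun)

lemma symbol_of_symbol:
  assumes "continuous_on S1 (\<lambda>z. f z i j)" "z \<in> S1" "i < m" "j < m"
  shows "symbol (of_symbol m f) z i j = f z i j"
  using Bcontfun_apply[OF assms(1), of "Abs_circle z"] assms(2-)
  by (simp add: symbol_def of_symbol_def Abs_circle_inverse)

lemma of_symbol_cong:
  assumes "\<And>z i j. z \<in> S1 \<Longrightarrow> i < m \<Longrightarrow> j < m \<Longrightarrow> f z i j = g z i j"
  shows "of_symbol m f = of_symbol m g"
  by (intro ext) (use assms in \<open>auto simp: of_symbol_def intro!: arg_cong[where f = Bcontfun] ext\<close>)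

lemma of_symbol_symbol: "x \<in> mat_over m UNIV \<Longrightarrow> of_symbol m (symbol x) = x"
  by (intro ext) (auto simp: of_symbol_def mat_over_def symbol_circle_pt apply_bcontfun_inverse)

lemma mat_over_ext:
  assumes "x \<in> mat_over m UNIV" "y \<in> mat_over m UNIV"
    and "\<And>z i j. z \<in> S1 \<Longrightarrow> i < m \<Longrightarrow> j < m \<Longrightarrow> symbol x z i j = symbol y z i j"
  shows "x = y"
  using of_symbol_symbol[OF assms(1)] of_symbol_symbol[OF assms(2)] of_symbol_cong[of m "symbol x" "symbol y"] assms(3) by metis

lemma apply_bcontfun_sum: "apply_bcontfun (\<Sum>i\<in>I. f i) z = (\<Sum>i\<in>I. apply_bcontfun (f i) z)"
  by (induction I rule: infinite_finite_induct) auto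

lemma symbol_mat_mult: "symbol (mat_mult m x y) z = mat_mult m (symbol x z) (symbol y z)"
  by (intro ext) (simp add: symbol_def mat_mult_def apply_bcontfun_sum bcontfun_alg_simps)

lemma symbol_mat_one: "i < m \<Longrightarrow> symbol (mat_one m) z i j = id_mat i j"
  by (simp add: symbol_def mat_one_def id_mat_def bcontfun_alg_simps)

lemma symbol_mat_star: "symbol (mat_star x) z i j = cnj (symbol x z j i)"
  by (simp add: symbol_def mat_star_def bcontfun_alg_simps star_complex_def)

lemma mat_over_zero: "x \<in> mat_over m E \<Longrightarrow> \<not> (i < m \<and> j < m) \<Longrightarrow> x i j = 0"
  unfolding mat_over_def by (auto split: if_splits)

lemma mat_over_mat_star:
  fixes x :: "nat \<Rightarrow> nat \<Rightarrow> 'a::unital_cstar_algebra"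
  shows "x \<in> mat_over m UNIV \<Longrightarrow> mat_star x \<in> mat_over m UNIV"
proof -
  have "star (0::'a) = 0"
    by (rule linear_0[OF bounded_linear.linear[OF bounded_linear_star]])
  then show "x \<in> mat_over m UNIV \<Longrightarrow> mat_star x \<in> mat_over m UNIV"
    using mat_over_zero[of x m UNIV] by (auto simp: mat_over_def[of m UNIV] mat_star_def)
qed

lemma mat_over_mat_mult: "x \<in> mat_over m UNIV \<Longrightarrow> y \<in> mat_over m UNIV \<Longrightarrow>
    mat_mult m x y \<in> mat_over m UNIV" for x y :: "nat \<Rightarrow> nat \<Rightarrow> CS1"
  using mat_over_zero[of x m UNIV] mat_over_zero[of y m UNIV]
  by (auto simp: mat_over_def[of m UNIV] mat_mult_def)

lemma mat_over_mat_one: "mat_one m \<in> mat_over m UNIV"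
  by (auto simp: mat_over_def mat_one_def)

lemma mat_over_of_symbol: "of_symbol m f \<in> mat_over m UNIV"
  by (auto simp: mat_over_def of_symbol_def)

lemma mat_star_eq_iff:
  assumes "x \<in> mat_over m UNIV"
  shows "mat_star x = x \<longleftrightarrow> (\<forall>z\<in>S1. hermitian m (symbol x z))"
proof
  assume "mat_star x = x"
  then have "symbol x z i j = cnj (symbol x z j i)" for z i j using symbol_mat_star by metis
  then show "\<forall>z\<in>S1. hermitian m (symbol x z)" unfolding hermitian_def by blast
next
  assume h: "\<forall>z\<in>S1. hermitian m (symbol x z)"
  show "mat_star x = x"
    by (rule mat_over_ext[OF mat_over_mat_star[OF assms] assms])
      (metis symbol_mat_star h hermitianD)
qed

lemma mat_invertible_iff:
  fixes x :: "nat \<Rightarrow> nat \<Rightarrow> CS1"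
  assumes x: "x \<in> mat_over m UNIV"
  shows "mat_invertible m x \<longleftrightarrow> (\<forall>z\<in>S1. mdet m (symbol x z) \<noteq> 0)"
proof
  assume "mat_invertible m x"
  then obtain y where y: "mat_mult m x y = mat_one m" unfolding mat_invertible_def by blast
  show "\<forall>z\<in>S1. mdet m (symbol x z) \<noteq> 0"
  proof
    fix z
    have "mdet m (mat_mult m (symbol x z) (symbol y z)) = mdet m id_mat"
      by (rule mdet_cong) (simp add: y symbol_mat_one flip: symbol_mat_mult)
    then show "mdet m (symbol x z) \<noteq> 0" by (auto simp: mdet_mult mdet_id_mat)
  qed
next
  assume det: "\<forall>z\<in>S1. mdet m (symbol x z) \<noteq> 0"
  define f where "f z i j = madj m (symbol x z) i j / mdet m (symbol x z)" for z i j
  have cont: "continuous_on S1 (\<lambda>z. f z i j)" if "i < m" "j < m" for i j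
    unfolding f_def using that det
    by (intro continuous_on_divide continuous_on_madj continuous_on_mdet continuous_on_symbol) auto
  have symbol: "symbol (of_symbol m f) z i j = f z i j" if "z \<in> S1" "i < m" "j < m" for z i j
    using symbol_of_symbol cont that by blast
  show "mat_invertible m x"
    unfolding mat_invertible_def
  proof (intro bexI[of _ "of_symbol m f"] conjI)
    show "mat_mult m x (of_symbol m f) = mat_one m"
    proof (rule mat_over_ext)
      fix z i j assume z: "z \<in> S1" "i < m" "j < m"
      have "symbol (mat_mult m x (of_symbol m f)) z i j =
          (\<Sum>k<m. symbol x z i k * madj m (symbol x z) k j) / mdet m (symbol x z)"
        unfolding symbol_mat_mult unfolding mat_mult_def sum_divide_distrib using z symbol
        by (intro sum.cong refl) (simp add: f_def)
      then show "symbol (mat_mult m x (of_symbol m f)) z i j = symbol (mat_one m) z i j"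
        using madj(1)[OF z(2,3), of "symbol x z"] z det by (auto simp: symbol_mat_one id_mat_def)
    qed (intro mat_over_mat_mult mat_over_mat_one mat_over_of_symbol x)+
    show "mat_mult m (of_symbol m f) x = mat_one m"
    proof (rule mat_over_ext)
      fix z i j assume z: "z \<in> S1" "i < m" "j < m"
      have "symbol (mat_mult m (of_symbol m f) x) z i j =
          (\<Sum>k<m. madj m (symbol x z) i k * symbol x z k j) / mdet m (symbol x z)"
        unfolding symbol_mat_mult unfolding mat_mult_def sum_divide_distrib using z symbol
        by (intro sum.cong refl) (simp add: f_def)
      then show "symbol (mat_mult m (of_symbol m f) x) z i j = symbol (mat_one m) z i j"
        using madj(2)[OF z(2,3), of "symbol x z"] z det by (auto simp: symbol_mat_one id_mat_def)
    qed (intro mat_over_mat_mult mat_over_mat_one mat_over_of_symbol x)+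
  qed (rule mat_over_of_symbol)
qed

lemma mat_over_mono: "E \<subseteq> F \<Longrightarrow> mat_over m E \<subseteq> mat_over m F"
  unfolding mat_over_def by (auto split: if_splits)

lemma H_iff:
  fixes x :: "nat \<Rightarrow> nat \<Rightarrow> CS1"
  shows "x \<in> H E m \<longleftrightarrow>
    x \<in> mat_over m E \<and> (\<forall>z\<in>S1. hermitian m (symbol x z)) \<and> (\<forall>z\<in>S1. mdet m (symbol x z) \<noteq> 0)"
  using mat_over_mono[of E UNIV m] unfolding H_def
  by (auto simp: mat_star_eq_iff mat_invertible_iff)

lemma of_symbol_in_H:
  assumes "\<And>i j. i < m \<Longrightarrow> j < m \<Longrightarrow> continuous_on S1 (\<lambda>z. f z i j)"
    and "\<And>i j. i < m \<Longrightarrow> j < m \<Longrightarrow> of_symbol m f i j \<in> E"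
    and "\<And>z. z \<in> S1 \<Longrightarrow> hermitian m (f z)" "\<And>z. z \<in> S1 \<Longrightarrow> mdet m (f z) \<noteq> 0"
  shows "of_symbol m f \<in> H E m"
proof -
  have symbol: "symbol (of_symbol m f) z i j = f z i j" if "z \<in> S1" "i < m" "j < m" for z i j
    using symbol_of_symbol assms(1) that by blast
  have "hermitian m (symbol (of_symbol m f) z)" if "z \<in> S1" for z
    unfolding hermitian_def
  proof (intro allI impI)
    fix i j assume ij: "i < m" "j < m"
    have "f z j i = cnj (f z i j)" using hermitianD[OF assms(3)[OF that] ij] .
    then show "symbol (of_symbol m f) z j i = cnj (symbol (of_symbol m f) z i j)" using symbol that ij by simp
  qed
  moreover have "mdet m (symbol (of_symbol m f) z) = mdet m (f z)" if "z \<in> S1" for z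
    using symbol that by (intro mdet_cong) auto
  ultimately show ?thesis
    using assms(2,4) unfolding H_iff by (auto simp: mat_over_def of_symbol_def)
qed

text \<open>
  On the compact set \<open>[0,1] \<times> S\<^sup>1\<close> joint continuity is uniform, so it yields a path for the supremum
  norm. No continuity of the coefficients of the entries has to be checked.
\<close>

lemma path_component_of_symbol:
  fixes F :: "real \<Rightarrow> complex \<Rightarrow> nat \<Rightarrow> nat \<Rightarrow> complex"
  assumes cont: "\<And>i j. i < m \<Longrightarrow> j < m \<Longrightarrow> continuous_on ({0..1} \<times> S1) (\<lambda>(t, z). F t z i j)"
    and E: "\<And>t i j. t \<in> {0..1} \<Longrightarrow> i < m \<Longrightarrow> j < m \<Longrightarrow> of_symbol m (F t) i j \<in> E"
    and herm: "\<And>t z. t \<in> {0..1} \<Longrightarrow> z \<in> S1 \<Longrightarrow> hermitian m (F t z)"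
    and det: "\<And>t z. t \<in> {0..1} \<Longrightarrow> z \<in> S1 \<Longrightarrow> mdet m (F t z) \<noteq> 0"
  shows "path_component (H E m) (of_symbol m (F 0)) (of_symbol m (F 1))"
proof -
  have cont1: "continuous_on S1 (\<lambda>z. F t z i j)" if "t \<in> {0..1}" "i < m" "j < m" for t i j
  proof -
    have "continuous_on S1 ((\<lambda>(t, z). F t z i j) \<circ> (\<lambda>z. (t, z)))"
      by (intro continuous_on_compose continuous_intros continuous_on_subset[OF cont]) (use that in auto)
    then show ?thesis by (simp add: o_def)
  qed
  have "path (\<lambda>t. of_symbol m (F t))"
    unfolding path_def
  proof (intro continuous_on_coordinatewise_then_product)
    fix i j
    show "continuous_on {0..1} (\<lambda>t. of_symbol m (F t) i j)"
    proof (cases "i < m \<and> j < m")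
      case True
      have unif: "uniformly_continuous_on ({0..1} \<times> S1) (\<lambda>(t, z). F t z i j)"
        using True by (intro compact_uniformly_continuous cont compact_Times) auto
      show ?thesis
        unfolding continuous_on_iff
      proof (intro ballI allI impI)
        fix t0 e :: real assume t0: "t0 \<in> {0..1}" and "e > 0"
        then obtain \<delta> where \<delta>: "\<delta> > 0" "\<And>p q. p \<in> {0..1} \<times> S1 \<Longrightarrow> q \<in> {0..1} \<times> S1 \<Longrightarrow> dist q p < \<delta> \<Longrightarrow>
            dist (case q of (t, z) \<Rightarrow> F t z i j) (case p of (t, z) \<Rightarrow> F t z i j) < e / 2"
          using unif unfolding uniformly_continuous_on_def by (metis half_gt_zero)
        show "\<exists>\<delta>>0. \<forall>t\<in>{0..1}. dist t t0 < \<delta> \<longrightarrow> dist (of_symbol m (F t) i j) (of_symbol m (F t0) i j) < e"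
        proof (intro exI[of _ \<delta>] conjI ballI impI \<delta>(1))
          fix t :: real assume t: "t \<in> {0..1}" "dist t t0 < \<delta>"
          have "dist (of_symbol m (F t) i j) (of_symbol m (F t0) i j) \<le> e / 2"
          proof (rule dist_bound)
            fix z
            have "dist (F t (circle_pt z) i j) (F t0 (circle_pt z) i j) < e / 2"
              using \<delta>(2)[of "(t0, circle_pt z)" "(t, circle_pt z)"] t t0 by (simp add: dist_Pair_Pair)
            then show "dist (apply_bcontfun (of_symbol m (F t) i j) z) (apply_bcontfun (of_symbol m (F t0) i j) z) \<le> e / 2"
              using Bcontfun_apply[OF cont1[OF t(1)], of i j z] Bcontfun_apply[OF cont1[OF t0], of i j z] True
              by (simp add: of_symbol_def)
          qed
          then show "dist (of_symbol m (F t) i j) (of_symbol m (F t0) i j) < e" using \<open>e > 0\<close> by simp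
        qed
      qed
    next
      case False
      then have "of_symbol m (F t) i j = 0" for t by (auto simp: of_symbol_def)
      then show ?thesis by simp
    qed
  qed
  moreover have "path_image (\<lambda>t. of_symbol m (F t)) \<subseteq> H E m"
    unfolding path_image_def using of_symbol_in_H[OF cont1 E herm det] by blast
  ultimately show ?thesis
    unfolding path_component_def pathstart_def pathfinish_def by blast
qed

lemma of_symbol_in_fejer_riesz:
  assumes "deg_le (int d) (\<lambda>z. f z i j)" "deg_le (int d) (\<lambda>z. cnj (f z i j))" "i < m" "j < m"
  shows "of_symbol m f i j \<in> fejer_riesz (d + 1)"
proof -
  obtain c where c: "\<And>z. z \<in> S1 \<Longrightarrow> f z i j = (\<Sum>k=-int d..int d. c k * z powi k)"
    using laurent_coeffs[OF assms(1,2)] by blast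
  show ?thesis
    unfolding fejer_riesz_def mem_Collect_eq
    using assms(3,4) Bcontfun_apply[OF deg_le_continuous[OF assms(1)]] c
    by (intro exI[of _ c] allI) (simp add: of_symbol_def)
qed

section \<open>Admissible symbols and their deformations\<close>

text \<open>
  The symbols of the elements of \<open>H(C(S\<^sup>1)\<^sub>(\<^sub>d\<^sub>+\<^sub>1\<^sub>), m)\<close>. Only upper degree bounds are required: the
  lower ones follow by Hermitian symmetry.
\<close>

definition admissible :: "nat \<Rightarrow> nat \<Rightarrow> (complex \<Rightarrow> nat \<Rightarrow> nat \<Rightarrow> complex) \<Rightarrow> bool" where
  "admissible d m f \<longleftrightarrow> (\<forall>i<m. \<forall>j<m. deg_le (int d) (\<lambda>z. f z i j)) \<and>
     (\<forall>z\<in>S1. hermitian m (f z)) \<and> (\<forall>z\<in>S1. mdet m (f z) \<noteq> 0)"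

definition joined :: "nat \<Rightarrow> nat \<Rightarrow> (complex \<Rightarrow> nat \<Rightarrow> nat \<Rightarrow> complex) \<Rightarrow>
    (complex \<Rightarrow> nat \<Rightarrow> nat \<Rightarrow> complex) \<Rightarrow> bool" where
  "joined d m f g \<longleftrightarrow> path_component (H (fejer_riesz (d + 1)) m) (of_symbol m f) (of_symbol m g)"

lemma admissible_deg_le_cnj:
  assumes "admissible d m f" "i < m" "j < m"
  shows "deg_le (int d) (\<lambda>z. cnj (f z i j))"
proof -
  have "deg_le (int d) (\<lambda>z. f z j i)" using assms by (simp add: admissible_def)
  moreover have "cnj (f z i j) = f z j i" if "z \<in> S1" for z
    using assms that unfolding admissible_def by (intro hermitianD[symmetric]) auto
  ultimately show ?thesis by (rule deg_le_eqI)
qed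

lemma joined_path:
  fixes F :: "real \<Rightarrow> complex \<Rightarrow> nat \<Rightarrow> nat \<Rightarrow> complex"
  assumes cont: "\<And>i j. i < m \<Longrightarrow> j < m \<Longrightarrow> continuous_on ({0..1} \<times> S1) (\<lambda>(t, z). F t z i j)"
    and F: "\<And>t. t \<in> {0..1} \<Longrightarrow> admissible d m (F t)"
    and "\<And>z i j. z \<in> S1 \<Longrightarrow> i < m \<Longrightarrow> j < m \<Longrightarrow> F 0 z i j = f z i j"
    and "\<And>z i j. z \<in> S1 \<Longrightarrow> i < m \<Longrightarrow> j < m \<Longrightarrow> F 1 z i j = g z i j"
  shows "joined d m f g"
proof -
  have "path_component (H (fejer_riesz (d + 1)) m) (of_symbol m (F 0)) (of_symbol m (F 1))"
  proof (rule path_component_of_symbol[OF cont])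
    fix t :: real and i j assume "t \<in> {0..1}" "i < m" "j < m"
    then show "of_symbol m (F t) i j \<in> fejer_riesz (d + 1)"
      using F[of t] admissible_deg_le_cnj[of d m "F t" i j]
      by (intro of_symbol_in_fejer_riesz) (auto simp: admissible_def)
  qed (use F in \<open>auto simp: admissible_def\<close>)
  moreover have "of_symbol m (F 0) = of_symbol m f" "of_symbol m (F 1) = of_symbol m g"
    using assms(3,4) by (auto intro!: of_symbol_cong)
  ultimately show ?thesis by (simp add: joined_def)
qed

lemma joined_trans: "joined d m f g \<Longrightarrow> joined d m g h \<Longrightarrow> joined d m f h"
  unfolding joined_def by (rule path_component_trans)

lemma joined_sym: "joined d m f g \<Longrightarrow> joined d m g f"
  unfolding joined_def by (rule path_component_sym)

lemma admissible_continuous: "admissible d m f \<Longrightarrow> i < m \<Longrightarrow> j < m \<Longrightarrow> continuous_on S1 (\<lambda>z. f z i j)"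
  by (auto simp: admissible_def intro: deg_le_continuous)

lemma joined_congruence:
  fixes U :: "real \<Rightarrow> complex \<Rightarrow> nat \<Rightarrow> nat \<Rightarrow> complex"
  assumes f: "admissible d m f"
    and U: "\<And>i j. i < m \<Longrightarrow> j < m \<Longrightarrow> continuous_on ({0..1} \<times> S1) (\<lambda>(t, z). U t z i j)"
    and det: "\<And>t z. t \<in> {0..1} \<Longrightarrow> z \<in> S1 \<Longrightarrow> mdet m (U t z) \<noteq> 0"
    and deg: "\<And>t i j. t \<in> {0..1} \<Longrightarrow> i < m \<Longrightarrow> j < m \<Longrightarrow> deg_le (int d) (\<lambda>z. congr m (U t z) (f z) i j)"
    and id: "\<And>z i j. z \<in> S1 \<Longrightarrow> i < m \<Longrightarrow> j < m \<Longrightarrow> U 0 z i j = id_mat i j"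
  shows "joined d m f (\<lambda>z. congr m (U 1 z) (f z))" "admissible d m (\<lambda>z. congr m (U 1 z) (f z))"
proof -
  have hf: "admissible d m (\<lambda>z. congr m (U t z) (f z))" if "t \<in> {0..1}" for t
    using f deg that det unfolding admissible_def by (auto simp: hermitian_congr mdet_congr)
  from hf[of 1] show "admissible d m (\<lambda>z. congr m (U 1 z) (f z))" by simp
  show "joined d m f (\<lambda>z. congr m (U 1 z) (f z))"
  proof (rule joined_path[where F = "\<lambda>t z. congr m (U t z) (f z)"])
    fix i j assume ij: "i < m" "j < m"
    have fc: "continuous_on ({0..1::real} \<times> S1) (\<lambda>p. f (snd p) k l)" if "k < m" "l < m" for k l
      by (rule continuous_on_compose2[OF admissible_continuous[OF f that]]) (auto intro: continuous_intros)
    have "continuous_on ({0..1} \<times> S1) (\<lambda>p. \<Sum>k<m. \<Sum>l<m.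
        cnj (U (fst p) (snd p) k i) * f (snd p) k l * U (fst p) (snd p) l j)"
      using U[unfolded case_prod_unfold] ij by (intro continuous_intros fc) auto
    then show "continuous_on ({0..1} \<times> S1) (\<lambda>(t, z). congr m (U t z) (f z) i j)"
      by (simp add: congr_entry case_prod_unfold)
  next
    fix z i j assume z: "z \<in> S1" "i < m" "j < m"
    have "congr m (U 0 z) (f z) i j = congr m id_mat (f z) i j"
      using z id by (intro congr_cong) auto
    then show "congr m (U 0 z) (f z) i j = f z i j" using z congr_id_mat by simp
  qed (use hf in auto)
qed

section \<open>Column operations\<close>

lemma congr_diag:
  assumes "i < m" "j < m"
  shows "congr m (\<lambda>i j. if i = j then a j else 0) h i j = cnj (a i) * h i j * a j"
  unfolding congr_entry using assms
  by (simp add: if_distrib[of cnj] mult_delta_left mult_delta_right cong: if_cong)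

lemma mdet_col_scale: "mdet m (\<lambda>i j. c j * x i j) = (\<Prod>j<m. c j) * mdet m x"
proof -
  have "mdet m (\<lambda>i j. c j * x i j) = mdet m (mat_mult m x (\<lambda>i j. if i = j then c i else 0))"
    by (rule mdet_cong) (simp add: mat_mult_def mult_delta_right mult.commute cong: if_cong)
  then show ?thesis by (simp add: mdet_mult mdet_diag mult.commute)
qed

text \<open>
  The values \<open>P(0)\<close> form the matrix of leading coefficients of the columns.
\<close>

definition column_rep :: "nat \<Rightarrow> (nat \<Rightarrow> int) \<Rightarrow> (complex \<Rightarrow> nat \<Rightarrow> nat \<Rightarrow> complex) \<Rightarrow>
    (nat \<Rightarrow> nat \<Rightarrow> complex poly) \<Rightarrow> bool" where
  "column_rep m \<delta> f P \<longleftrightarrow>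
    (\<forall>z\<in>S1. \<forall>i<m. \<forall>j<m. f z i j = z powi \<delta> j * poly (P i j) (inverse z))"

lemma column_repD: "column_rep m \<delta> f P \<Longrightarrow> z \<in> S1 \<Longrightarrow> i < m \<Longrightarrow> j < m \<Longrightarrow>
    f z i j = z powi \<delta> j * poly (P i j) (inverse z)"
  unfolding column_rep_def by blast

lemma column_rep_exists:
  assumes "\<forall>i<m. \<forall>j<m. deg_le (\<delta> j) (\<lambda>z. f z i j)"
  shows "\<exists>P. column_rep m \<delta> f P"
proof -
  have "\<forall>i j. \<exists>p. i < m \<longrightarrow> j < m \<longrightarrow> (\<forall>z\<in>S1. f z i j = z powi \<delta> j * poly p (inverse z))"
    using assms unfolding deg_le_def by blast
  then obtain P where "\<And>i j. i < m \<longrightarrow> j < m \<longrightarrow> (\<forall>z\<in>S1. f z i j = z powi \<delta> j * poly (P i j) (inverse z))"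
    by metis
  then show ?thesis unfolding column_rep_def by blast
qed

lemma column_rep_deg_le: "column_rep m \<delta> f P \<Longrightarrow> i < m \<Longrightarrow> j < m \<Longrightarrow> deg_le (\<delta> j) (\<lambda>z. f z i j)"
  by (rule deg_le_I) (rule column_repD)

lemma mdet_column_rep:
  assumes "column_rep m \<delta> f P" and z: "z \<in> S1"
  shows "mdet m (f z) = z powi (\<Sum>j<m. \<delta> j) * poly (mdet m P) (inverse z)"
proof -
  have "mdet m (f z) = mdet m (\<lambda>i j. z powi \<delta> j * poly (P i j) (inverse z))"
    by (rule mdet_cong) (rule column_repD[OF assms])
  also have "\<dots> = (\<Prod>j<m. z powi \<delta> j) * poly (mdet m P) (inverse z)"
    by (simp add: mdet_col_scale mdet_poly)
  also have "(\<Prod>j<m. z powi \<delta> j) = z powi (\<Sum>j<m. \<delta> j)"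
    using S1_nz[OF z] by (induction m) (simp_all add: power_int_add)
  finally show ?thesis .
qed

text \<open>
  The column \<open>l\<close> is replaced by the combination \<open>\<Sum>\<^sub>k v\<^sub>k z\<^sup>e f\<^sub>k\<close> of columns, \<open>e = \<delta>\<^sub>l - \<delta>\<^sub>k\<close>. Maximality
  of \<open>\<delta>\<^sub>l\<close> makes all exponents nonnegative, so the adjoint row operation only multiplies by
  nonpositive powers and raises no degree. The same step serves two purposes: for a finite \<open>\<beta>\<close> it
  makes a column vanish at a zero of the determinant, for \<open>\<beta> = 0\<close> it kills the leading coefficient of
  a column.
\<close>

lemma column_operation:
  assumes f: "admissible d m f" and \<delta>: "\<forall>j<m. \<delta> j \<le> int d" and P: "column_rep m \<delta> f P"
    and l: "l < m" "v l = 1" "\<forall>k<m. v k \<noteq> 0 \<longrightarrow> \<delta> k \<le> \<delta> l"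
    and ker: "\<forall>i<m. (\<Sum>k<m. poly (P i k) \<beta> * v k) = 0"
  shows "\<exists>g Q. admissible d m g \<and> joined d m f g \<and> (\<forall>z\<in>S1. mdet m (g z) = mdet m (f z)) \<and>
    column_rep m \<delta> g Q \<and> (\<forall>i<m. poly (Q i l) \<beta> = 0)"
proof -
  \<comment> \<open>truncation to \<open>0\<close> only happens where the coefficient \<open>v k\<close> vanishes\<close>
  define e where "e k = nat (\<delta> l - \<delta> k)" for k
  define c where "c t k = (if k = l then 1 else complex_of_real t * v k)" for t k
  define U where "U t z i j = (if j = l then c t i * z ^ e i else if i = j then 1 else 0)" for t z i j
  define Q where "Q t i j = (if j = l then \<Sum>k<m. Polynomial.smult (c t k) (P i k) else P i j)" for t i j
  define R where "R t i j = (if i = l then \<Sum>k<m. Polynomial.smult (cnj (c t k)) (monom 1 (e k) * Q t k j)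
    else Q t i j)" for t i j
  have detU: "mdet m (U t z) = 1" for t z
  proof -
    have "mdet m (U t z) = mdet m (\<lambda>i j. if i = j then 1 else if j = l then c t i * z ^ e i else 0)"
      by (rule mdet_cong) (auto simp: U_def c_def e_def)
    then show ?thesis using mdet_column_unipotent[OF l(1)] by simp
  qed
  have fU: "mat_mult m (f z) (U t z) i j = z powi \<delta> j * poly (Q t i j) (inverse z)"
    if z: "z \<in> S1" "i < m" "j < m" for t z i j
  proof (cases "j = l")
    case True
    have "mat_mult m (f z) (U t z) i j = (\<Sum>k<m. z powi \<delta> l * (c t k * poly (P i k) (inverse z)))"
      unfolding mat_mult_def
    proof (intro sum.cong refl)
      fix k assume k: "k \<in> {..<m}"
      have "c t k = 0 \<or> z powi \<delta> k * z ^ e k = z powi \<delta> l"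
      proof (cases "k = l \<or> v k \<noteq> 0")
        case True
        then have "\<delta> l = \<delta> k + int (e k)" using l k by (auto simp: e_def)
        then show ?thesis using S1_nz[OF z(1)] by (simp add: power_int_add)
      qed (simp add: c_def)
      then show "f z i k * U t z k j = z powi \<delta> l * (c t k * poly (P i k) (inverse z))"
        using column_repD[OF P z(1,2), of k] k True by (auto simp: U_def mult_ac)
    qed
    then show ?thesis using True by (simp add: Q_def poly_sum sum_distrib_left)
  next
    case False
    then have "mat_mult m (f z) (U t z) i j = (\<Sum>k<m. if k = j then f z i k else 0)"
      unfolding mat_mult_def U_def by (intro sum.cong refl) auto
    then show ?thesis using False column_repD[OF P z] z by (simp add: Q_def)
  qed
  have UfU: "congr m (U t z) (f z) i j = z powi \<delta> j * poly (R t i j) (inverse z)"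
    if z: "z \<in> S1" "i < m" "j < m" for t z i j
  proof -
    have "congr m (U t z) (f z) i j = (\<Sum>k<m. cnj (U t z k i) * (z powi \<delta> j * poly (Q t k j) (inverse z)))"
      unfolding congr_def mat_mult_def[of m "\<lambda>i j. cnj (U t z j i)"]
      using fU z by (intro sum.cong refl) simp
    also have "\<dots> = z powi \<delta> j * poly (R t i j) (inverse z)"
    proof (cases "i = l")
      case True
      then show ?thesis using S1_cnj[OF z(1)]
        by (simp add: U_def R_def poly_sum poly_monom sum_distrib_left mult_ac)
    next
      case False
      then have "(\<Sum>k<m. cnj (U t z k i) * (z powi \<delta> j * poly (Q t k j) (inverse z))) =
          (\<Sum>k<m. if k = i then z powi \<delta> j * poly (Q t k j) (inverse z) else 0)"
        by (intro sum.cong refl) (auto simp: U_def)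
      then show ?thesis using False z by (simp add: R_def)
    qed
    finally show ?thesis .
  qed
  have U_cont: "continuous_on ({0..1} \<times> S1) (\<lambda>(t, z). U t z i j)" for i j
    unfolding U_def c_def case_prod_unfold
    by (cases "j = l"; cases "i = l"; cases "i = j") (auto intro!: continuous_intros)
  have deg_le: "deg_le (int d) (\<lambda>z. congr m (U t z) (f z) i j)" if "i < m" "j < m" for t i j
  proof (rule deg_le_mono[of "\<delta> j"])
    show "\<delta> j \<le> int d" using \<delta> that by blast
    show "deg_le (\<delta> j) (\<lambda>z. congr m (U t z) (f z) i j)"
      by (rule deg_le_I) (rule UfU[OF _ that])
  qed
  have U0: "U 0 z i j = id_mat i j" for z i j
    by (auto simp: U_def c_def id_mat_def e_def)
  have "joined d m f (\<lambda>z. congr m (U 1 z) (f z))" "admissible d m (\<lambda>z. congr m (U 1 z) (f z))"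
    using joined_congruence[of d m f U, OF f U_cont _ deg_le U0] detU by auto
  moreover have "mdet m (congr m (U 1 z) (f z)) = mdet m (f z)" for z
    by (simp add: mdet_congr detU)
  moreover have "poly (R 1 i l) \<beta> = 0" if "i < m" for i
  proof -
    have c1: "c 1 k = v k" for k using l(2) by (simp add: c_def)
    have "poly (Q 1 k l) \<beta> = 0" if "k < m" for k
      using ker that by (simp add: Q_def poly_sum c1 mult.commute)
    then show ?thesis using that by (simp add: R_def poly_sum)
  qed
  moreover have "column_rep m \<delta> (\<lambda>z. congr m (U 1 z) (f z)) (R 1)"
    unfolding column_rep_def using UfU by blast
  ultimately show ?thesis by blast
qed

lemma joined_refl:
  assumes f: "admissible d m f"
  shows "joined d m f f"
proof (rule joined_path[where F = "\<lambda>t. f"])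
  fix i j assume ij: "i < m" "j < m"
  have "continuous_on ({0..1::real} \<times> S1) (\<lambda>p. f (snd p) i j)"
    by (rule continuous_on_compose2[OF admissible_continuous[OF f ij]]) (auto intro: continuous_intros)
  then show "continuous_on ({0..1::real} \<times> S1) (\<lambda>(t, z). f z i j)" by (simp add: case_prod_unfold)
qed (use f in auto)

section \<open>Removal of zeros of the determinant\<close>

lemma deg_le_cnj_poly:
  assumes "\<And>z. z \<in> S1 \<Longrightarrow> f z = z powi k * poly q (inverse z)" "int (degree q) \<le> k + l"
  shows "deg_le l (\<lambda>z. cnj (f z))"
proof -
  have "deg_le l (\<lambda>z. \<Sum>i\<le>degree q. cnj (coeff q i) * z powi (int i - k))"
    using assms(2) by (intro deg_le_sum deg_le_powi) auto
  then show ?thesis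
  proof (rule deg_le_eqI)
    fix z assume z: "z \<in> S1"
    have "cnj (f z) = inverse z powi k * (\<Sum>i\<le>degree q. cnj (coeff q i) * z ^ i)"
      using assms(1)[OF z] S1_cnj[OF z] by (simp add: poly_altdef)
    then show "cnj (f z) = (\<Sum>i\<le>degree q. cnj (coeff q i) * z powi (int i - k))"
      using S1_nz[OF z]
      by (simp add: sum_distrib_left power_int_diff power_int_inverse field_simps)
  qed
qed

lemma one_minus_nz: "cmod \<beta> < 1 \<Longrightarrow> z \<in> S1 \<Longrightarrow> 0 \<le> s \<Longrightarrow> s \<le> 1 \<Longrightarrow> 1 - of_real s * \<beta> * z \<noteq> 0"
proof
  assume *: "cmod \<beta> < 1" "z \<in> S1" "0 \<le> s" "s \<le> 1" "1 - of_real s * \<beta> * z = 0"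
  then have "cmod (of_real s * \<beta> * z) = 1" by (metis norm_one right_minus_eq)
  then have "s * cmod \<beta> = 1" using * by (simp add: norm_mult)
  then show False using * by (metis mult_left_le_one_le norm_ge_zero not_le)
qed

text \<open>
  A zero of \<open>p\<close> at \<open>\<beta>\<close> is a zero of \<open>f\<close> at \<open>z = 1/\<beta>\<close>, and \<open>1 - \<beta>z\<close> is the factor that is divided out.
  It has a power series inverse in \<open>z\<close>, which is why the lowest power does not change.
\<close>

lemma root_division:
  assumes p: "\<And>z. z \<in> S1 \<Longrightarrow> f z = z powi k * poly p (inverse z)" and \<beta>: "poly p \<beta> = 0" "cmod \<beta> < 1"
  shows "deg_le (k - 1) (\<lambda>z. f z / (1 - \<beta> * z))"
    and "deg_le l (\<lambda>z. cnj (f z)) \<Longrightarrow> deg_le l (\<lambda>z. cnj (f z / (1 - \<beta> * z)))"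
proof -
  obtain q where q: "p = [:- \<beta>, 1:] * q" using \<beta>(1) by (metis dvdE poly_eq_0_iff_dvd)
  have *: "f z / (1 - \<beta> * z) = z powi (k - 1) * poly q (inverse z)" if z: "z \<in> S1" for z
  proof -
    have "1 - \<beta> * z \<noteq> 0" using one_minus_nz[OF \<beta>(2) z, of 1] by simp
    moreover have "inverse z - \<beta> = (1 - \<beta> * z) * inverse z" using S1_nz[OF z] by (simp add: field_simps)
    ultimately show ?thesis
      using p[OF z] S1_nz[OF z] by (simp add: q power_int_diff field_simps)
  qed
  show "deg_le (k - 1) (\<lambda>z. f z / (1 - \<beta> * z))" by (rule deg_le_I) (rule *)
  assume l: "deg_le l (\<lambda>z. cnj (f z))"
  show "deg_le l (\<lambda>z. cnj (f z / (1 - \<beta> * z)))"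
  proof (cases "q = 0")
    case True
    have "cnj (f z / (1 - \<beta> * z)) = z powi l * poly 0 (inverse z)" if "z \<in> S1" for z
      unfolding *[OF that] True by simp
    then show ?thesis by (rule deg_le_I)
  next
    case False
    then have "p \<noteq> 0" unfolding q mult_eq_0_iff by simp
    then have "int (degree p) \<le> l + k" by (intro laurent_degree[OF p l])
    moreover have "degree p = 1 + degree q" unfolding q using False by (subst degree_mult_eq) auto
    ultimately show ?thesis by (intro deg_le_cnj_poly[OF *]) auto
  qed
qed

text \<open>
  A real \<open>f\<close> also vanishes at the reflected point, so it can be divided by both factors.
\<close>

lemma root_division_real:
  assumes p: "\<And>z. z \<in> S1 \<Longrightarrow> f z = z powi k * poly p (inverse z)" and \<beta>: "poly p \<beta> = 0" "cmod \<beta> < 1"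
    and real: "\<And>z. z \<in> S1 \<Longrightarrow> cnj (f z) = f z"
  shows "deg_le (k - 1) (\<lambda>z. f z / ((1 - \<beta> * z) * cnj (1 - \<beta> * z)))"
proof -
  have nz: "1 - \<beta> * z \<noteq> 0" if "z \<in> S1" for z using one_minus_nz[OF \<beta>(2) that, of 1] by simp
  have "deg_le k f" by (rule deg_le_I) (rule p)
  then have "deg_le k (\<lambda>z. cnj (f z))" by (rule deg_le_eqI) (rule real)
  then have "deg_le k (\<lambda>z. cnj (f z / (1 - \<beta> * z)))" by (rule root_division(2)[OF p \<beta>, rotated])
  then obtain q where q: "\<And>z. z \<in> S1 \<Longrightarrow> cnj (f z / (1 - \<beta> * z)) = z powi k * poly q (inverse z)"
    unfolding deg_le_def by blast
  have "[:1, - cnj \<beta>:] * q = p"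
  proof (rule poly_eq_on_S1)
    fix w :: complex assume w: "w \<in> S1"
    define z where "z = inverse w"
    have z: "z \<in> S1" "inverse z = w" using S1_inverse[OF w] by (simp_all add: z_def)
    have "cnj (1 - \<beta> * z) \<noteq> 0" using nz[OF z(1)] by (metis complex_cnj_zero_iff)
    then have "f z = z powi k * poly q w * cnj (1 - \<beta> * z)"
      using q[OF z(1)] real[OF z(1)] z(2) by (simp add: field_simps)
    then have "z powi k * poly p w = z powi k * (poly q w * (1 - cnj \<beta> * w))"
      using p[OF z(1)] z S1_cnj[OF z(1)] by simp
    then have "poly p w = poly q w * (1 - cnj \<beta> * w)" using S1_nz[OF z(1)] by simp
    then show "poly ([:1, - cnj \<beta>:] * q) w = poly p w" by (simp add: algebra_simps)
  qed
  then have "(1 - cnj \<beta> * \<beta>) * poly q \<beta> = 0" using \<beta>(1) by (auto simp: algebra_simps)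
  moreover have "1 - cnj \<beta> * \<beta> \<noteq> 0"
  proof
    assume "1 - cnj \<beta> * \<beta> = 0"
    then have "cmod \<beta> * cmod \<beta> = 1" by (metis complex_mod_cnj norm_mult norm_one right_minus_eq)
    then show False using \<beta>(2) by (metis abs_norm_cancel abs_square_eq_1 less_irrefl power2_eq_square)
  qed
  ultimately have "poly q \<beta> = 0" by simp
  then have "deg_le (k - 1) (\<lambda>z. cnj (f z / (1 - \<beta> * z)) / (1 - \<beta> * z))"
    by (rule root_division(1)[OF q _ \<beta>(2), rotated])
  then show ?thesis
    by (rule deg_le_eqI) (simp add: real mult.commute)
qed

text \<open>
  Column \<open>l\<close> is divided by \<open>1 - \<beta>z\<close> and row \<open>l\<close> by its conjugate, along the path of congruences by the
  diagonal matrix with entry \<open>(1 - (1 - t)\<beta>z) / (1 - \<beta>z)\<close> at \<open>l\<close>. For each \<open>t\<close> the division lowers a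
  degree that the multiplication restores.
\<close>

lemma remove_root:
  assumes f: "admissible d m f"
    and P: "column_rep m (\<lambda>_. int d) f P"
    and l: "l < m" "\<forall>i<m. poly (P i l) \<beta> = 0" and \<beta>: "cmod \<beta> < 1"
  shows "\<exists>g. admissible d m g \<and> joined d m f g \<and>
    (\<forall>z\<in>S1. mdet m (f z) = (1 - \<beta> * z) * cnj (1 - \<beta> * z) * mdet m (g z))"
proof -
  \<comment> \<open>the factor at time \<open>t\<close>; it is \<open>1\<close> at \<open>t = 0\<close> and the full quotient at \<open>t = 1\<close>\<close>
  define \<kappa> where "\<kappa> t z = (1 - of_real (1 - t) * \<beta> * z) / (1 - \<beta> * z)" for t :: real and z
  define U where "U t z i j = (if i = j then if j = l then \<kappa> t z else 1 else 0)" for t z and i j :: nat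
  have nz: "1 - \<beta> * z \<noteq> 0" if "z \<in> S1" for z using one_minus_nz[OF \<beta> that, of 1] by simp
  have detU: "mdet m (U t z) = \<kappa> t z" for t z
  proof -
    have "mdet m (U t z) = mdet m (\<lambda>i j. if i = j then (if i = l then \<kappa> t z else 1) else 0)"
      by (rule mdet_cong) (simp add: U_def)
    then show ?thesis using l(1) mdet_diag[of m "\<lambda>j. if j = l then \<kappa> t z else 1"] by simp
  qed
  have \<kappa>_nz: "\<kappa> t z \<noteq> 0" if "t \<in> {0..1}" "z \<in> S1" for t z
    using one_minus_nz[OF \<beta> that(2), of "1 - t"] nz that by (simp add: \<kappa>_def)
  have entry: "congr m (U t z) (f z) i j =
      cnj (if i = l then \<kappa> t z else 1) * f z i j * (if j = l then \<kappa> t z else 1)"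
    if "i < m" "j < m" for t z i j
    unfolding U_def[abs_def] using congr_diag[OF that, of "\<lambda>j. if j = l then \<kappa> t z else 1"] by simp
  have U_cont: "continuous_on ({0..1} \<times> S1) (\<lambda>(t, z). U t z i j)" for i j
  proof -
    have "continuous_on ({0..1} \<times> S1) (\<lambda>p. \<kappa> (fst p) (snd p))"
      unfolding \<kappa>_def using nz by (auto intro!: continuous_intros)
    then show ?thesis unfolding U_def case_prod_unfold by (cases "i = j"; cases "j = l") simp_all
  qed
  have s1: "deg_le 1 (\<lambda>z. 1 - of_real (1 - t) * \<beta> * z)" for t
    by (rule deg_le_eqI[OF deg_le_add[OF deg_le_const[of 1 1] deg_le_powi[of 1 1 "- of_real (1 - t) * \<beta>"]]])
      (simp_all add: algebra_simps)
  have s0: "deg_le 0 (\<lambda>z. cnj (1 - of_real (1 - t) * \<beta> * z))" for t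
  proof (rule deg_le_eqI[OF deg_le_add[OF deg_le_const[of 0 1] deg_le_powi[of "-1" 0 "- cnj (of_real (1 - t) * \<beta>)"]]])
    fix z assume "z \<in> S1"
    then show "cnj (1 - of_real (1 - t) * \<beta> * z) = 1 + - cnj (of_real (1 - t) * \<beta>) * z powi -1"
      using S1_cnj by (simp add: power_int_minus)
  qed simp_all
  have deg_le: "deg_le (int d) (\<lambda>z. congr m (U t z) (f z) i j)" if t: "t \<in> {0..1}" and ij: "i < m" "j < m" for t i j
  proof -
    have fl: "f z i' l = z powi int d * poly (P i' l) (inverse z)" if "z \<in> S1" "i' < m" for z i'
      using column_repD[OF P] that l(1) by blast
    have l2: "poly (P i' l) \<beta> = 0" if "i' < m" for i' using l(2) that by blast
    consider (1) "i \<noteq> l" "j \<noteq> l" | (2) "i \<noteq> l" "j = l" | (3) "i = l" "j \<noteq> l" | (4) "i = l" "j = l"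
      by blast
    then show ?thesis
    proof cases
      case 1
      have "deg_le (int d) (\<lambda>z. f z i j)" using f ij by (simp add: admissible_def)
      then show ?thesis using entry[OF ij] 1 by simp
    next
      case 2
      have "deg_le (int d - 1) (\<lambda>z. f z i l / (1 - \<beta> * z))"
        by (rule root_division(1)[OF fl l2[OF ij(1)] \<beta>]) (use ij in auto)
      then have "deg_le (int d - 1 + 1) (\<lambda>z. f z i l / (1 - \<beta> * z) * (1 - of_real (1 - t) * \<beta> * z))"
        using s1 by (rule deg_le_mult)
      then show ?thesis using entry[OF ij] 2 by (simp add: \<kappa>_def)
    next
      case 3
      have "deg_le (int d) (\<lambda>z. cnj (f z j l / (1 - \<beta> * z)))"
        by (rule root_division(2)[OF fl l2[OF ij(2)] \<beta> admissible_deg_le_cnj[OF f ij(2) l(1)]]) (use ij in auto)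
      then have "deg_le (int d + 0) (\<lambda>z. cnj (f z j l / (1 - \<beta> * z)) * cnj (1 - of_real (1 - t) * \<beta> * z))"
        using s0 by (rule deg_le_mult)
      then have "deg_le (int d) (\<lambda>z. cnj (f z j l / (1 - \<beta> * z)) * cnj (1 - of_real (1 - t) * \<beta> * z))"
        by (simp only: add_0_right)
      then show ?thesis
      proof (rule deg_le_eqI)
        fix z assume z: "z \<in> S1"
        have "f z l j = cnj (f z j l)" using f z ij l(1) unfolding admissible_def by (intro hermitianD) auto
        then show "congr m (U t z) (f z) i j = cnj (f z j l / (1 - \<beta> * z)) * cnj (1 - of_real (1 - t) * \<beta> * z)"
          using entry[OF ij] 3 by (simp add: \<kappa>_def)
      qed
    next
      case 4
      have "cnj (f z l l) = f z l l" if "z \<in> S1" for z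
        using f that l(1) unfolding admissible_def by (intro hermitianD[symmetric]) auto
      then have "deg_le (int d - 1) (\<lambda>z. f z l l / ((1 - \<beta> * z) * cnj (1 - \<beta> * z)))"
        by (intro root_division_real[OF fl l2[OF l(1)] \<beta>]) (use l in auto)
      then have "deg_le (int d - 1 + (1 + 0)) (\<lambda>z. f z l l / ((1 - \<beta> * z) * cnj (1 - \<beta> * z)) *
          ((1 - of_real (1 - t) * \<beta> * z) * cnj (1 - of_real (1 - t) * \<beta> * z)))"
        using deg_le_mult[OF s1 s0] by (rule deg_le_mult)
      then show ?thesis using entry[OF ij] 4 by (simp add: \<kappa>_def mult_ac)
    qed
  qed
  have U0: "U 0 z i j = id_mat i j" if "z \<in> S1" for z i j
    using nz[OF that] by (simp add: U_def id_mat_def \<kappa>_def)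
  have "joined d m f (\<lambda>z. congr m (U 1 z) (f z))" "admissible d m (\<lambda>z. congr m (U 1 z) (f z))"
    using joined_congruence[of d m f U, OF f U_cont _ deg_le U0] detU \<kappa>_nz by auto
  moreover have "mdet m (f z) = (1 - \<beta> * z) * cnj (1 - \<beta> * z) * mdet m (congr m (U 1 z) (f z))"
    if "z \<in> S1" for z
  proof -
    have "cnj (1 - \<beta> * z) \<noteq> 0" using nz[OF that] by (metis complex_cnj_zero_iff)
    then show ?thesis using nz[OF that] by (simp add: mdet_congr detU \<kappa>_def)
  qed
  ultimately show ?thesis by blast
qed

text \<open>
  A function that is real on the circle has zeros symmetric under reflection in it. If there are none
  except at \<open>0\<close> and \<open>\<infinity>\<close>, it is a monomial, and symmetry of the exponents makes it constant.
\<close>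

lemma constant_determinant:
  fixes \<Delta> :: "complex poly"
  assumes real: "\<forall>z\<in>S1. cnj (z ^ N * poly \<Delta> (inverse z)) = z ^ N * poly \<Delta> (inverse z)"
    and nz: "\<forall>w\<in>S1. poly \<Delta> w \<noteq> 0"
    and roots: "\<not> (\<exists>\<beta>. 0 < cmod \<beta> \<and> cmod \<beta> < 1 \<and> poly \<Delta> \<beta> = 0)"
  shows "\<exists>c. c \<noteq> 0 \<and> (\<forall>z\<in>S1. z ^ N * poly \<Delta> (inverse z) = c)"
proof -
  define D where "D = map_poly cnj \<Delta>"
  have D: "poly D z = cnj (poly \<Delta> (cnj z))" for z
    unfolding D_def by (metis complex_cnj_cnj poly_cnj)
  have degD: "degree D = degree \<Delta>" unfolding D_def by (rule degree_map_poly) simp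
  have id: "monom 1 (degree \<Delta>) * \<Delta> = monom 1 (N + N) * reflect_poly D"
  proof (rule poly_eq_on_S1)
    fix w :: complex assume w: "w \<in> S1"
    then have w0: "w \<noteq> 0" and z: "inverse w \<in> S1" by (auto simp: norm_inverse)
    have "cnj (inverse w) = w" using S1_cnj[OF z] by simp
    then have "inverse w ^ N * poly \<Delta> w = w ^ N * poly D (inverse w)"
      using bspec[OF real z] by (simp add: D S1_cnj[OF w])
    then have "w ^ (N + degree \<Delta>) * (inverse w ^ N * poly \<Delta> w) =
        w ^ (N + degree \<Delta>) * (w ^ N * poly D (inverse w))" by simp
    then have "w ^ degree \<Delta> * poly \<Delta> w = w ^ (N + N) * (w ^ degree \<Delta> * poly D (inverse w))"
      using w0 by (simp add: power_add field_simps)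
    then show "poly (monom 1 (degree \<Delta>) * \<Delta>) w = poly (monom 1 (N + N) * reflect_poly D) w"
      using w0 by (simp add: poly_monom poly_reflect_poly_nz degD)
  qed
  have root0: "x = 0" if x: "poly \<Delta> x = 0" for x
  proof (rule ccontr)
    assume "x \<noteq> 0"
    have "cmod x > 1" using roots nz x \<open>x \<noteq> 0\<close> by (cases "cmod x" "1 :: real" rule: linorder_cases) auto
    have "poly (monom 1 (N + N) * reflect_poly D) x = 0" using x unfolding id[symmetric] by simp
    then have "poly D (inverse x) = 0" using \<open>x \<noteq> 0\<close> by (simp add: poly_monom poly_reflect_poly_nz)
    then have "poly \<Delta> (cnj (inverse x)) = 0" by (simp add: D)
    moreover have "0 < cmod (cnj (inverse x))" "cmod (cnj (inverse x)) < 1"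
      using \<open>cmod x > 1\<close> \<open>x \<noteq> 0\<close> by (simp_all add: norm_inverse inverse_less_1_iff)
    ultimately show False using roots by blast
  qed
  have "\<Delta> \<noteq> 0" using bspec[OF nz, of 1] by auto
  obtain q where q: "\<Delta> = [:- 0, 1:] ^ Polynomial.order 0 \<Delta> * q" "\<not> [:- 0, 1:] dvd q"
    using Polynomial.order_decomp[OF \<open>\<Delta> \<noteq> 0\<close>] by blast
  have "poly q x \<noteq> 0" for x
  proof
    assume "poly q x = 0"
    then have "poly \<Delta> x = 0" by (subst q(1)) simp
    then have "x = 0" by (rule root0)
    then show False using q(2) \<open>poly q x = 0\<close> by (simp add: poly_eq_0_iff_dvd)
  qed
  then have "constant (poly q)" using fundamental_theorem_of_algebra by blast
  then obtain a where qa: "q = [:a:]" by (metis constant_degree degree_eq_zeroE)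
  define k where "k = Polynomial.order 0 \<Delta>"
  have \<Delta>: "\<Delta> = monom a k" using q(1) unfolding qa k_def[symmetric]
    by (simp add: monom_altdef)
  have "a \<noteq> 0" using \<Delta> \<open>\<Delta> \<noteq> 0\<close> by auto
  have Dm: "reflect_poly D = [:cnj a:]"
  proof -
    have "D = monom (cnj a) k" unfolding D_def \<Delta> by (simp add: map_poly_monom)
    then show ?thesis using \<open>a \<noteq> 0\<close>
      by (intro poly_eqI) (auto simp: coeff_reflect_poly degree_monom_eq coeff_pCons split: nat.split)
  qed
  have "degree (monom 1 k * monom a k) = degree (monom 1 (N + N) * [:cnj a:])"
    using id \<open>a \<noteq> 0\<close> unfolding Dm by (simp add: \<Delta> degree_monom_eq)
  then have "k = N" using \<open>a \<noteq> 0\<close> by (simp add: degree_mult_eq degree_monom_eq)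
  then have "z ^ N * poly \<Delta> (inverse z) = a" if "z \<in> S1" for z
    using S1_nz[OF that] by (simp add: \<Delta> poly_monom field_simps)
  then show ?thesis using \<open>a \<noteq> 0\<close> by blast
qed

lemma admissible_det_real:
  assumes "admissible d m f" "z \<in> S1"
  shows "cnj (mdet m (f z)) = mdet m (f z)"
proof -
  have "mdet m (f z) = mdet m (\<lambda>i j. f z j i)" by (rule mdet_transpose[of m "f z", symmetric])
  also have "\<dots> = mdet m (\<lambda>i j. cnj (f z i j))"
  proof (rule mdet_cong)
    fix i j assume "i < m" "j < m"
    then show "f z j i = cnj (f z i j)" using assms unfolding admissible_def by (intro hermitianD) auto
  qed
  finally show ?thesis unfolding mdet_cnj by (rule sym)
qed

text \<open>
  Maximality of \<open>\<delta>\<close> at the pivot \<open>l\<close> is what keeps column operations polynomial in \<open>z\<close>.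
\<close>

lemma normalized_kernel_vector:
  fixes x :: "nat \<Rightarrow> nat \<Rightarrow> complex" and \<delta> :: "nat \<Rightarrow> int"
  assumes "mdet m x = 0"
  shows "\<exists>v l. l < m \<and> v l = 1 \<and> (\<forall>k<m. v k \<noteq> 0 \<longrightarrow> \<delta> k \<le> \<delta> l) \<and>
    (\<forall>i<m. (\<Sum>k<m. x i k * v k) = 0)"
proof -
  obtain u where u: "\<exists>i<m. u i \<noteq> 0" "\<forall>i<m. (\<Sum>k<m. x i k * u k) = 0"
    using assms unfolding mdet_eq_0_iff by blast
  define I where "I = {k. k < m \<and> u k \<noteq> 0}"
  have I: "finite I" "I \<noteq> {}" using u(1) by (auto simp: I_def)
  then have "Max (\<delta> ` I) \<in> \<delta> ` I" by (intro Max_in) auto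
  then obtain l where l: "l \<in> I" "Max (\<delta> ` I) = \<delta> l" by blast
  have max: "\<delta> k \<le> \<delta> l" if "k \<in> I" for k
    using Max_ge[of "\<delta> ` I" "\<delta> k"] I that l(2) by simp
  have "(\<Sum>k<m. x i k * (u k / u l)) = 0" if "i < m" for i
    using u(2) that by (simp flip: sum_divide_distrib)
  then show ?thesis
    using l(1) max by (intro exI[of _ "\<lambda>k. u k / u l"] exI[of _ l]) (auto simp: I_def)
qed

text \<open>
  Each round lowers the degree of the determinant, as a polynomial in \<open>w = z\<^sup>-\<^sup>1\<close>, by one: two linear
  factors are removed and one power of \<open>w\<close> is gained.
\<close>

lemma to_constant_determinant_column_rep:
  assumes "admissible d m f" "column_rep m (\<lambda>_. int d) f P"
  shows "\<exists>g c. admissible d m g \<and> joined d m f g \<and> c \<noteq> 0 \<and> (\<forall>z\<in>S1. mdet m (g z) = c)"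
  using assms
proof (induction "degree (mdet m P)" arbitrary: f P rule: less_induct)
  case less
  note f = less.prems(1) and P = less.prems(2)
  have rep: "mdet m (h z) = z ^ (m * d) * poly (mdet m R) (inverse z)"
    if "column_rep m (\<lambda>_. int d) h R" "z \<in> S1" for h R z
  proof -
    have "(\<Sum>j<m. int d) = int (m * d)" by simp
    then show ?thesis using mdet_column_rep[OF that] by (simp only: power_int_of_nat)
  qed
  note det = rep[OF P]
  have nz: "poly (mdet m P) w \<noteq> 0" if "w \<in> S1" for w
  proof -
    have "mdet m (f (inverse w)) \<noteq> 0" using f S1_inverse[OF that] by (simp add: admissible_def)
    then show ?thesis using det[OF S1_inverse[OF that]] by auto
  qed
  show ?case
  proof (cases "\<exists>\<beta>. 0 < cmod \<beta> \<and> cmod \<beta> < 1 \<and> poly (mdet m P) \<beta> = 0")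
    case False
    have "\<forall>z\<in>S1. cnj (z ^ (m * d) * poly (mdet m P) (inverse z)) = z ^ (m * d) * poly (mdet m P) (inverse z)"
      using admissible_det_real[OF f] det by (metis (no_types, lifting))
    moreover have "\<forall>w\<in>S1. poly (mdet m P) w \<noteq> 0" using nz by blast
    ultimately obtain c where "c \<noteq> 0" "\<forall>z\<in>S1. z ^ (m * d) * poly (mdet m P) (inverse z) = c"
      using constant_determinant[OF _ _ False] by blast
    then show ?thesis using det f joined_refl[OF f] by (intro exI[of _ f] exI[of _ c]) simp
  next
    case True
    then obtain \<beta> where \<beta>: "0 < cmod \<beta>" "cmod \<beta> < 1" "poly (mdet m P) \<beta> = 0" by blast
    have "mdet m (\<lambda>i j. poly (P i j) \<beta>) = 0" using \<beta>(3) by (simp add: mdet_poly)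
    then obtain v l where l: "l < m" "v l = 1"
      and ker: "\<forall>i<m. (\<Sum>k<m. poly (P i k) \<beta> * v k) = 0"
      using normalized_kernel_vector by blast
    obtain g Q where g: "admissible d m g" "joined d m f g" "\<forall>z\<in>S1. mdet m (g z) = mdet m (f z)"
      and Q: "column_rep m (\<lambda>_. int d) g Q" "\<forall>i<m. poly (Q i l) \<beta> = 0"
      using column_operation[OF f _ P l _ ker] by auto
    obtain h where h: "admissible d m h" "joined d m g h"
      "\<forall>z\<in>S1. mdet m (g z) = (1 - \<beta> * z) * cnj (1 - \<beta> * z) * mdet m (h z)"
      using remove_root[OF g(1) Q(1) l(1) Q(2) \<beta>(2)] by blast
    obtain R where R: "column_rep m (\<lambda>_. int d) h R"
      using column_rep_exists[of m "\<lambda>_. int d" h] h(1) by (auto simp: admissible_def)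
    have id: "[:0, 1:] * mdet m P = ([:- \<beta>, 1:] * [:1, - cnj \<beta>:]) * mdet m R"
    proof (rule poly_eq_on_S1)
      fix w :: complex assume w: "w \<in> S1"
      define z where "z = inverse w"
      have z: "z \<in> S1" "inverse z = w" "w \<noteq> 0" "cnj z = w"
        using S1_inverse[OF w] S1_nz[OF w] S1_cnj[OF S1_inverse[OF w]] by (simp_all add: z_def)
      have "mdet m (f z) = (1 - \<beta> * z) * cnj (1 - \<beta> * z) * mdet m (h z)"
        using g(3) h(3) z(1) by metis
      then have "z ^ (m * d) * poly (mdet m P) w =
          z ^ (m * d) * ((1 - \<beta> * z) * (1 - cnj \<beta> * w) * poly (mdet m R) w)"
        unfolding det[OF z(1)] rep[OF R z(1)] using z by (simp add: mult_ac)
      moreover have "z ^ (m * d) \<noteq> 0" using S1_nz[OF z(1)] by simp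
      ultimately have "poly (mdet m P) w = (1 - \<beta> * z) * (1 - cnj \<beta> * w) * poly (mdet m R) w"
        using mult_left_cancel by blast
      then have "w * poly (mdet m P) w = (w * (1 - \<beta> * z)) * (1 - cnj \<beta> * w) * poly (mdet m R) w"
        by simp
      also have "w * (1 - \<beta> * z) = w - \<beta>" using z(3) by (simp add: z_def field_simps)
      finally show "poly ([:0, 1:] * mdet m P) w = poly ([:- \<beta>, 1:] * [:1, - cnj \<beta>:] * mdet m R) w"
        by (simp only: poly_mult) (simp add: algebra_simps)
    qed
    have P0: "mdet m P \<noteq> 0" using nz[of 1] by auto
    have R0: "mdet m R \<noteq> 0"
    proof
      assume "mdet m R = 0"
      then have "[:0, 1:] * mdet m P = 0" using id by (simp only: mult_zero_right)
      then show False using P0 by (simp only: mult_eq_0_iff) simp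
    qed
    have "degree ([:0, 1:] * mdet m P) = degree [:0, 1 :: complex:] + degree (mdet m P)"
      using P0 by (intro degree_mult_eq) auto
    moreover have "degree ([:- \<beta>, 1:] * [:1, - cnj \<beta>:] * mdet m R) =
        degree ([:- \<beta>, 1:] * [:1, - cnj \<beta>:]) + degree (mdet m R)"
      using R0 by (intro degree_mult_eq) (auto simp only: mult_eq_0_iff, auto)
    moreover have "degree ([:- \<beta>, 1:] * [:1, - cnj \<beta>:]) = degree [:- \<beta>, 1:] + degree [:1, - cnj \<beta>:]"
      by (intro degree_mult_eq) auto
    moreover have "degree [:0, 1 :: complex:] = 1" "degree [:- \<beta>, 1:] = 1" "degree [:1, - cnj \<beta>:] = 1"
      using \<beta>(1) by auto
    ultimately have "degree (mdet m R) < degree (mdet m P)"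
      using arg_cong[OF id, of degree] by linarith
    from less.hyps[OF this h(1) R] show ?thesis
      using g(2) h(2) joined_trans by blast
  qed
qed

lemma to_constant_determinant:
  assumes "admissible d m f"
  shows "\<exists>g c. admissible d m g \<and> joined d m f g \<and> c \<noteq> 0 \<and> (\<forall>z\<in>S1. mdet m (g z) = c)"
  using column_rep_exists[of m "\<lambda>_. int d" f] assms to_constant_determinant_column_rep[OF assms]
  by (auto simp: admissible_def)

section \<open>Reduction of the column degrees\<close>

text \<open>
  On the circle \<open>det f\<close> is \<open>z\<close> to the power \<open>s = \<Sum>\<delta>\<^sub>j\<close> times a polynomial in \<open>z\<^sup>-\<^sup>1\<close> with value
  \<open>det P(0)\<close> at \<open>0\<close>. As \<open>det f\<close> is a nonzero constant, \<open>s\<close> cannot be negative, and \<open>s > 0\<close> forces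
  \<open>det P(0) = 0\<close>.
\<close>

lemma reduce_column_degrees:
  assumes "admissible d m f" "c \<noteq> 0" "\<forall>z\<in>S1. mdet m (f z) = c"
    and "\<forall>j<m. \<delta> j \<le> int d" "\<forall>i<m. \<forall>j<m. deg_le (\<delta> j) (\<lambda>z. f z i j)"
  shows "\<exists>g \<delta>. admissible d m g \<and> joined d m f g \<and> (\<forall>z\<in>S1. mdet m (g z) = c) \<and> (\<Sum>j<m. \<delta> j) = 0 \<and>
    (\<forall>j<m. \<delta> j \<le> int d) \<and> (\<forall>i<m. \<forall>j<m. deg_le (\<delta> j) (\<lambda>z. g z i j))"
  using assms
proof (induction "nat (\<Sum>j<m. \<delta> j)" arbitrary: f \<delta> rule: less_induct)
  case less
  note f = less.prems(1) and c = less.prems(2) and det = less.prems(3) and \<delta> = less.prems(4,5)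
  obtain P where P: "column_rep m \<delta> f P" using column_rep_exists[OF \<delta>(2)] by blast
  define s where "s = (\<Sum>j<m. \<delta> j)"
  have detP: "poly (mdet m P) w = w powi s * c" if w: "w \<in> S1" for w
  proof -
    have z: "inverse w \<in> S1" by (rule S1_inverse[OF w])
    have "c = inverse w powi s * poly (mdet m P) w"
      using mdet_column_rep[OF P z] det z by (simp add: s_def)
    then show ?thesis using S1_nz[OF w] by (simp add: power_int_inverse)
  qed
  consider "s = 0" | "s < 0" | "s > 0" by linarith
  then show ?case
  proof cases
    case 1
    then show ?thesis using less.prems joined_refl[OF f] unfolding s_def by blast
  next
    case 2
    have "monom 1 (nat (- s)) * mdet m P = [:c:]"
    proof (rule poly_eq_on_S1)
      fix w :: complex assume w: "w \<in> S1"
      have "w ^ nat (- s) * w powi s = 1"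
        using 2 S1_nz[OF w] by (simp add: power_int_def field_simps)
      then show "poly (monom 1 (nat (- s)) * mdet m P) w = poly [:c:] w"
        using detP[OF w] by (simp add: poly_monom flip: mult.assoc)
    qed
    then have "poly (monom 1 (nat (- s)) * mdet m P) 0 = c" by simp
    moreover have "nat (- s) \<noteq> 0" using 2 by simp
    ultimately have "c = 0" by (simp add: poly_monom power_0_left)
    then show ?thesis using c by simp
  next
    case 3
    have "mdet m P = monom c (nat s)"
      by (rule poly_eq_on_S1) (use 3 detP in \<open>simp add: poly_monom power_int_def mult.commute\<close>)
    then have "mdet m (\<lambda>i j. poly (P i j) 0) = 0" using 3 by (simp add: mdet_poly poly_monom)
    then obtain v l where l: "l < m" "v l = 1" "\<forall>k<m. v k \<noteq> 0 \<longrightarrow> \<delta> k \<le> \<delta> l"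
      and ker: "\<forall>i<m. (\<Sum>k<m. poly (P i k) 0 * v k) = 0"
      using normalized_kernel_vector by blast
    obtain g Q where g: "admissible d m g" "joined d m f g" "\<forall>z\<in>S1. mdet m (g z) = mdet m (f z)"
      and Q: "column_rep m \<delta> g Q" "\<forall>i<m. poly (Q i l) 0 = 0"
      using column_operation[OF f \<delta>(1) P l ker] by blast
    define \<delta>' where "\<delta>' = \<delta>(l := \<delta> l - 1)"
    have "(\<Sum>j<m. \<delta>' j) = s - 1"
      unfolding s_def \<delta>'_def using l(1) by (simp add: sum.remove[of "{..<m}" l])
    then have less: "nat (\<Sum>j<m. \<delta>' j) < nat (\<Sum>j<m. \<delta> j)" using 3 s_def by simp
    have deg_le: "deg_le (\<delta>' j) (\<lambda>z. g z i j)" if ij: "i < m" "j < m" for i j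
    proof (cases "j = l")
      case True
      have "deg_le (\<delta> l - 1) (\<lambda>z. g z i l / (1 - 0 * z))"
        by (rule root_division(1)[of _ _ "Q i l"]) (use column_repD[OF Q(1)] Q(2) ij l in auto)
      then show ?thesis using True by (simp add: \<delta>'_def)
    next
      case False
      then show ?thesis using column_rep_deg_le[OF Q(1) ij] by (simp add: \<delta>'_def)
    qed
    have "\<forall>j<m. \<delta>' j \<le> int d"
    proof (intro allI impI)
      fix j assume "j < m"
      then have "\<delta> j \<le> int d" using \<delta>(1) by blast
      then show "\<delta>' j \<le> int d" by (cases "j = l") (auto simp: \<delta>'_def)
    qed
    moreover have "\<forall>z\<in>S1. mdet m (g z) = c" using g(3) det by simp
    ultimately have "\<exists>h \<delta>. admissible d m h \<and> joined d m g h \<and> (\<forall>z\<in>S1. mdet m (h z) = c) \<and> (\<Sum>j<m. \<delta> j) = 0 \<and>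
        (\<forall>j<m. \<delta> j \<le> int d) \<and> (\<forall>i<m. \<forall>j<m. deg_le (\<delta> j) (\<lambda>z. h z i j))"
      using deg_le by (intro less.hyps[OF less g(1) c]) blast+
    then show ?thesis using joined_trans[OF g(2)] by blast
  qed
qed

section \<open>Deformation to a constant matrix\<close>

lemma admissible_laurent:
  assumes f: "admissible d m f" and \<delta>: "\<And>i j. i < m \<Longrightarrow> j < m \<Longrightarrow> deg_le (\<delta> j) (\<lambda>z. f z i j)"
    and ij: "i < m" "j < m"
  shows "\<exists>c. \<forall>z\<in>S1. f z i j = (\<Sum>k=-\<delta> i..\<delta> j. c k * z powi k)"
proof (rule laurent_coeffs[OF \<delta>[OF ij]])
  show "deg_le (\<delta> i) (\<lambda>z. cnj (f z i j))"
  proof (rule deg_le_eqI[OF \<delta>[OF ij(2,1)]])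
    fix z assume "z \<in> S1"
    then show "cnj (f z i j) = f z j i"
      using f ij unfolding admissible_def by (intro hermitianD[symmetric]) auto
  qed
qed

text \<open>
  A path of constant matrices stays within the degree bound when it is conjugated by the diagonal
  matrix of the powers \<open>e\<^sub>j\<close> of \<open>z\<close>.
\<close>

lemma joined_const_path:
  fixes B :: "real \<Rightarrow> nat \<Rightarrow> nat \<Rightarrow> complex"
  assumes e: "\<And>i j. i < m \<Longrightarrow> j < m \<Longrightarrow> e j - e i \<le> int d"
    and cont: "\<And>i j. i < m \<Longrightarrow> j < m \<Longrightarrow> continuous_on {0..1} (\<lambda>t. B t i j)"
    and B: "\<And>t. t \<in> {0..1} \<Longrightarrow> hermitian m (B t)" "\<And>t. t \<in> {0..1} \<Longrightarrow> mdet m (B t) \<noteq> 0"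
  shows "joined d m (\<lambda>z i j. B 0 i j * z powi (e j - e i)) (\<lambda>z i j. B 1 i j * z powi (e j - e i))"
proof (rule joined_path[where F = "\<lambda>t z i j. B t i j * z powi (e j - e i)"])
  fix i j assume ij: "i < m" "j < m"
  have "continuous_on ({0..1} \<times> S1) (\<lambda>p. B (fst p) i j)"
    by (rule continuous_on_compose2[OF cont[OF ij]]) (auto intro: continuous_intros)
  moreover have "continuous_on ({0..1} \<times> S1) (\<lambda>p. snd p powi (e j - e i))"
    using S1_nz by (intro continuous_on_power_int continuous_on_snd continuous_on_id disjI2) auto
  ultimately show "continuous_on ({0..1} \<times> S1) (\<lambda>(t, z). B t i j * z powi (e j - e i))"
    unfolding case_prod_unfold by (rule continuous_on_mult)
next
  fix t :: real assume t: "t \<in> {0..1}"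
  define V where "V z i j = (if i = j then z powi e j else 0)" for z :: complex and i j :: nat
  have V: "congr m (V z) (B t) i j = B t i j * z powi (e j - e i)" if "z \<in> S1" "i < m" "j < m" for z i j
  proof -
    have "cnj (z powi e i) = inverse (z powi e i)"
      using S1_cnj[OF that(1)] by (simp add: power_int_inverse)
    then show ?thesis
      unfolding V_def[abs_def] congr_diag[OF that(2,3)]
      using S1_nz[OF that(1)] by (simp only: power_int_diff divide_inverse mult_ac simp_thms)
  qed
  have detV: "mdet m (V z) \<noteq> 0" if "z \<in> S1" for z
  proof -
    have "mdet m (V z) = mdet m (\<lambda>i j. if i = j then z powi e i else 0)"
      by (rule mdet_cong) (simp add: V_def)
    then show ?thesis using S1_nz[OF that] by (simp add: mdet_diag)
  qed
  show "admissible d m (\<lambda>z i j. B t i j * z powi (e j - e i))"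
    unfolding admissible_def
  proof (intro conjI allI impI ballI)
    fix i j assume "i < m" "j < m"
    then show "deg_le (int d) (\<lambda>z. B t i j * z powi (e j - e i))" using e by (intro deg_le_powi)
  next
    fix z assume z: "z \<in> S1"
    have "hermitian m (congr m (V z) (B t))" using B(1)[OF t] by (rule hermitian_congr)
    then show "hermitian m (\<lambda>i j. B t i j * z powi (e j - e i))"
      using V[OF z] unfolding hermitian_def by simp
    have "mdet m (\<lambda>i j. B t i j * z powi (e j - e i)) = mdet m (congr m (V z) (B t))"
      by (rule mdet_cong) (simp add: V[OF z])
    then show "mdet m (\<lambda>i j. B t i j * z powi (e j - e i)) \<noteq> 0"
      using detV[OF z] B(2)[OF t] by (simp add: mdet_congr)
  qed
qed auto

lemma sign_mat_path:
  assumes T: "mdet m T \<noteq> 0"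
  obtains B :: "real \<Rightarrow> nat \<Rightarrow> nat \<Rightarrow> complex"
  where "\<And>i j. continuous_on {0..1} (\<lambda>t. B t i j)"
    "\<And>t. t \<in> {0..1} \<Longrightarrow> hermitian m (B t)" "\<And>t. t \<in> {0..1} \<Longrightarrow> mdet m (B t) \<noteq> 0"
    "\<And>i j. i < m \<Longrightarrow> j < m \<Longrightarrow> B 0 i j = sign_mat A i j"
    "\<And>i j. i < m \<Longrightarrow> j < m \<Longrightarrow> B 1 i j = congr m T (sign_mat A) i j"
proof -
  obtain \<gamma> :: "real \<Rightarrow> complex" where \<gamma>: "continuous_on {0..1} \<gamma>" "\<gamma> 0 = 0" "\<gamma> 1 = 1"
    "\<And>t. t \<in> {0..1} \<Longrightarrow> mdet m (\<lambda>i j. (1 - \<gamma> t) * id_mat i j + \<gamma> t * T i j) \<noteq> 0"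
    using GL_path[OF T] by blast
  define B where "B t = congr m (\<lambda>i j. (1 - \<gamma> t) * id_mat i j + \<gamma> t * T i j) (sign_mat A)" for t
  show ?thesis
  proof
    show "continuous_on {0..1} (\<lambda>t. B t i j)" for i j
      unfolding B_def congr_entry using \<gamma>(1) by (intro continuous_intros)
    show "hermitian m (B t)" for t unfolding B_def by (intro hermitian_congr hermitian_sign_mat)
    show "mdet m (B t) \<noteq> 0" if "t \<in> {0..1}" for t
      unfolding B_def mdet_congr using \<gamma>(4)[OF that] mdet_sign_mat by simp
    show "B 0 i j = sign_mat A i j" if "i < m" "j < m" for i j
      unfolding B_def \<gamma>(2) using congr_id_mat[OF that] by simp
    show "B 1 i j = congr m T (sign_mat A) i j" if "i < m" "j < m" for i j
      unfolding B_def \<gamma>(3) by simp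
  qed
qed

lemma joined_cong:
  assumes "joined d m f g"
    and "\<And>z i j. z \<in> S1 \<Longrightarrow> i < m \<Longrightarrow> j < m \<Longrightarrow> f z i j = f' z i j"
    and "\<And>z i j. z \<in> S1 \<Longrightarrow> i < m \<Longrightarrow> j < m \<Longrightarrow> g z i j = g' z i j"
  shows "joined d m f' g'"
proof -
  have "of_symbol m f = of_symbol m f'" "of_symbol m g = of_symbol m g'" using assms(2,3) by (auto intro!: of_symbol_cong)
  then show ?thesis using assms(1) by (simp add: joined_def)
qed

text \<open>
  The path multiplies the entry \<open>(i, j)\<close> by \<open>s\<close> to the power \<open>\<delta>\<^sub>i + \<delta>\<^sub>j\<close>. For \<open>s > 0\<close> this is a congruence
  with determinant \<open>s\<close> to the power \<open>\<Sum>\<delta>\<^sub>j = 0\<close>; the determinant is a polynomial in \<open>s\<close>, so it keeps its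
  nonzero value at \<open>s = 0\<close>.
\<close>

lemma degree_zero_endpoint:
  assumes f: "admissible d m f" and c: "c \<noteq> 0" "\<And>z. z \<in> S1 \<Longrightarrow> mdet m (f z) = c"
    and sum: "(\<Sum>j<m. \<delta> j) = 0" and \<delta>d: "\<And>j. j < m \<Longrightarrow> \<delta> j \<le> int d"
    and \<delta>: "\<And>i j. i < m \<Longrightarrow> j < m \<Longrightarrow> deg_le (\<delta> j) (\<lambda>z. f z i j)"
  obtains L where "hermitian m L" "mdet m L \<noteq> 0"
    "joined d m f (\<lambda>z i j. L i j * z powi (max (\<delta> j) 0 - max (\<delta> i) 0))"
proof -
  have lau: "\<exists>c. \<forall>z\<in>S1. f z i j = (\<Sum>k=-\<delta> i..\<delta> j. c k * z powi k)" if "i < m" "j < m" for i j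
    using admissible_laurent[OF f \<delta> that] .
  have zero: "f z i j = 0" if "\<delta> i + \<delta> j < 0" "z \<in> S1" "i < m" "j < m" for z i j
    using lau[OF that(3,4)] that(1,2) by auto
  \<comment> \<open>where \<open>\<delta> i + \<delta> j < 0\<close> the truncated exponent is harmless because \<open>f z i j = 0\<close>\<close>
  define F where "F s z i j = of_real s ^ nat (\<delta> i + \<delta> j) * f z i j" for s :: real and z i j
  define L where "L i j = (if \<delta> i + \<delta> j = 0 then f 1 i j else 0)" for i j
  have mono: "f z i j = f 1 i j * z powi \<delta> j" if 0: "\<delta> i + \<delta> j = 0" and z: "z \<in> S1" and ij: "i < m" "j < m" for z i j
  proof -
    have "- \<delta> i = \<delta> j" using 0 by simp
    then obtain c where c: "\<forall>z\<in>S1. f z i j = c (\<delta> j) * z powi \<delta> j"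
      using lau[OF ij] by auto
    from bspec[OF c z] bspec[OF c, of 1] show ?thesis by simp
  qed
  have F0: "F 0 z i j = L i j * z powi (max (\<delta> j) 0 - max (\<delta> i) 0)" if z: "z \<in> S1" "i < m" "j < m" for z i j
  proof -
    consider "\<delta> i + \<delta> j < 0" | "\<delta> i + \<delta> j = 0" | "\<delta> i + \<delta> j > 0" by linarith
    then show ?thesis
    proof cases
      case 2
      then have "max (\<delta> j) 0 - max (\<delta> i) 0 = \<delta> j" by auto
      then show ?thesis using mono[OF 2 z] 2 by (simp add: F_def L_def)
    qed (use zero[OF _ z] in \<open>auto simp: F_def L_def\<close>)
  qed
  have F1: "F 1 z i j = f z i j" for z i j by (simp add: F_def)
  have herm: "hermitian m (F s z)" if "z \<in> S1" for s z
    unfolding hermitian_def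
  proof (intro allI impI)
    fix i j assume ij: "i < m" "j < m"
    have "f z j i = cnj (f z i j)" using f that ij unfolding admissible_def by (intro hermitianD) auto
    then show "F s z j i = cnj (F s z i j)" by (simp add: F_def add.commute)
  qed
  have det_pos: "mdet m (F s z) = c" if s: "s > 0" and z: "z \<in> S1" for s z
  proof -
    have "mdet m (F s z) = mdet m (congr m (\<lambda>i j. if i = j then of_real s powi \<delta> j else 0) (f z))"
    proof (rule mdet_cong)
      fix i j assume ij: "i < m" "j < m"
      have "F s z i j = of_real s powi \<delta> i * f z i j * of_real s powi \<delta> j"
      proof (cases "\<delta> i + \<delta> j < 0")
        case False
        then have "of_real s ^ nat (\<delta> i + \<delta> j) = (of_real s :: complex) powi (\<delta> i + \<delta> j)"
          by (simp add: power_int_def)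
        then show ?thesis using s by (simp add: F_def power_int_add)
      qed (use zero z ij in \<open>simp add: F_def\<close>)
      then show "F s z i j = congr m (\<lambda>i j. if i = j then of_real s powi \<delta> j else 0) (f z) i j"
        unfolding congr_diag[OF ij] by simp
    qed
    also have "\<dots> = cnj (\<Prod>j<m. of_real s powi \<delta> j) * c * (\<Prod>j<m. of_real s powi \<delta> j)"
      using mdet_diag[of m "\<lambda>j. (of_real s :: complex) powi \<delta> j"] c(2)[OF z]
      by (simp add: mdet_congr cong: if_cong)
    also have "(\<Prod>j<m. (of_real s :: complex) powi \<delta> j) = of_real s powi (\<Sum>j<m. \<delta> j)"
      using s by (induction m) (simp_all add: power_int_add)
    finally show ?thesis using sum by simp
  qed
  have det: "mdet m (F s z) = c" if s: "s \<ge> 0" and z: "z \<in> S1" for s z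
  proof -
    define p where "p = mdet m (\<lambda>i j. monom (f z i j) (nat (\<delta> i + \<delta> j)))"
    have p: "mdet m (F s z) = poly p (of_real s)" for s
      unfolding p_def mdet_poly[symmetric] by (rule mdet_cong) (simp add: F_def poly_monom mult.commute)
    have "p = [:c:]"
    proof (rule ccontr)
      assume "p \<noteq> [:c:]"
      then have "finite {x. poly (p - [:c:]) x = 0}" by (intro poly_roots_finite) simp
      moreover have "of_real ` {0<..<1::real} \<subseteq> {x. poly (p - [:c:]) x = 0}"
        using det_pos[OF _ z] by (auto simp flip: p)
      ultimately have "finite (complex_of_real ` {0<..<1})" by (rule finite_subset[rotated])
      then have "finite {0<..<1::real}" by (rule finite_imageD) (auto simp: inj_on_def)
      then show False by (simp add: infinite_Ioo)
    qed
    then show ?thesis by (simp add: p)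
  qed
  have Fh: "admissible d m (F s)" if "s \<ge> 0" for s
    unfolding admissible_def
  proof (intro conjI allI impI ballI)
    fix i j assume "i < m" "j < m"
    then show "deg_le (int d) (\<lambda>z. F s z i j)" using f unfolding F_def admissible_def by (intro deg_le_cmult) auto
  qed (use herm det that c in auto)
  have "joined d m f (\<lambda>z i j. L i j * z powi (max (\<delta> j) 0 - max (\<delta> i) 0))"
  proof (rule joined_path[where F = "\<lambda>t. F (1 - t)"])
    fix i j assume ij: "i < m" "j < m"
    have "continuous_on ({0..1::real} \<times> S1) (\<lambda>p. f (snd p) i j)"
      by (rule continuous_on_compose2[OF admissible_continuous[OF f ij]]) (auto intro: continuous_intros)
    then show "continuous_on ({0..1} \<times> S1) (\<lambda>(t, z). F (1 - t) z i j)"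
      unfolding F_def case_prod_unfold by (auto intro!: continuous_intros)
  qed (use Fh F0 F1 in auto)
  moreover have L1: "L i j = F 0 1 i j" if "i < m" "j < m" for i j
    using F0[of 1 i j] that by simp
  have "hermitian m L"
    unfolding hermitian_def
  proof (intro allI impI)
    fix i j assume ij: "i < m" "j < m"
    show "L j i = cnj (L i j)"
      unfolding L1[OF ij] L1[OF ij(2,1)] by (rule hermitianD[OF herm ij]) simp
  qed
  moreover have "mdet m L = mdet m (F 0 1)" by (rule mdet_cong) (rule L1)
  then have "mdet m L \<noteq> 0" using det[of 0 1] c by simp
  ultimately show ?thesis using that by blast
qed

text \<open>
  Conjugation by the powers of \<open>z\<close> leaves a diagonal matrix fixed, so the path of constant matrices
  from \<open>L\<close> to a diagonal matrix of signs also ends the nonconstant problem.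
\<close>

theorem joined_standard:
  assumes f: "admissible d m f"
  obtains q where "q \<le> m" "joined d m f (\<lambda>z. sign_mat {..<q})"
proof -
  obtain g c where g: "admissible d m g" "joined d m f g" "c \<noteq> 0" "\<And>z. z \<in> S1 \<Longrightarrow> mdet m (g z) = c"
    using to_constant_determinant[OF f] by blast
  have "deg_le (int d) (\<lambda>z. g z i j)" if "i < m" "j < m" for i j using g(1) that by (simp add: admissible_def)
  then obtain h \<delta> where h: "admissible d m h" "joined d m g h" "\<And>z. z \<in> S1 \<Longrightarrow> mdet m (h z) = c"
    "(\<Sum>j<m. \<delta> j) = 0" "\<And>j. j < m \<Longrightarrow> \<delta> j \<le> int d" "\<And>i j. i < m \<Longrightarrow> j < m \<Longrightarrow> deg_le (\<delta> j) (\<lambda>z. h z i j)"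
    using reduce_column_degrees[OF g(1,3), of "\<lambda>_. int d"] g(4) by auto
  define e where "e j = max (\<delta> j) 0" for j
  obtain L where L: "hermitian m L" "mdet m L \<noteq> 0" "joined d m h (\<lambda>z i j. L i j * z powi (e j - e i))"
    unfolding e_def by (rule degree_zero_endpoint[OF h(1) g(3) h(3,4,5,6)])
  obtain A T where A: "A \<subseteq> {..<m}" and T: "mdet m T \<noteq> 0"
    "\<And>i j. i < m \<Longrightarrow> j < m \<Longrightarrow> L i j = congr m T (sign_mat A) i j"
    using sylvester[OF L(1,2)] by metis
  obtain B :: "real \<Rightarrow> nat \<Rightarrow> nat \<Rightarrow> complex" where B: "\<And>i j. continuous_on {0..1} (\<lambda>t. B t i j)"
    "\<And>t. t \<in> {0..1} \<Longrightarrow> hermitian m (B t)" "\<And>t. t \<in> {0..1} \<Longrightarrow> mdet m (B t) \<noteq> 0"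
    "\<And>i j. i < m \<Longrightarrow> j < m \<Longrightarrow> B 0 i j = sign_mat A i j"
    "\<And>i j. i < m \<Longrightarrow> j < m \<Longrightarrow> B 1 i j = congr m T (sign_mat A) i j"
    by (rule sign_mat_path[OF T(1), of A]) blast
  have "joined d m (\<lambda>z i j. B 0 i j * z powi (e j - e i)) (\<lambda>z i j. B 1 i j * z powi (e j - e i))"
  proof (rule joined_const_path[OF _ B(1-3)])
    fix i j assume "i < m" "j < m"
    then show "e j - e i \<le> int d" using h(5)[of j] by (auto simp: e_def max_def)
  qed
  then have 1: "joined d m (\<lambda>z. sign_mat A) (\<lambda>z i j. L i j * z powi (e j - e i))"
    by (rule joined_cong) (auto simp: B(4,5) T(2) sign_mat_def)
  obtain R where R: "mdet m R \<noteq> 0"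
    "\<And>i j. i < m \<Longrightarrow> j < m \<Longrightarrow> congr m R (sign_mat A) i j = sign_mat {..<card A} i j"
    using sign_mat_permute[OF A] by metis
  obtain C :: "real \<Rightarrow> nat \<Rightarrow> nat \<Rightarrow> complex" where C: "\<And>i j. continuous_on {0..1} (\<lambda>t. C t i j)"
    "\<And>t. t \<in> {0..1} \<Longrightarrow> hermitian m (C t)" "\<And>t. t \<in> {0..1} \<Longrightarrow> mdet m (C t) \<noteq> 0"
    "\<And>i j. i < m \<Longrightarrow> j < m \<Longrightarrow> C 0 i j = sign_mat A i j"
    "\<And>i j. i < m \<Longrightarrow> j < m \<Longrightarrow> C 1 i j = congr m R (sign_mat A) i j"
    by (rule sign_mat_path[OF R(1), of A]) blast
  have "joined d m (\<lambda>z i j. C 0 i j * z powi (0 - 0)) (\<lambda>z i j. C 1 i j * z powi (0 - 0))"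
    by (rule joined_const_path[OF _ C(1-3)]) auto
  then have 2: "joined d m (\<lambda>z. sign_mat A) (\<lambda>z. sign_mat {..<card A})"
    by (rule joined_cong) (auto simp: C(4,5) R(2))
  have "joined d m f (\<lambda>z. sign_mat {..<card A})"
    using g(2) h(2) L(3) joined_sym[OF 1] 2 joined_trans by blast
  moreover have "card A \<le> m" using card_mono[OF _ A] by simp
  ultimately show ?thesis using that by blast
qed

section \<open>The K-group of an operator system whose components are classified by an index\<close>

text \<open>
  Everything about the direct limit and the Grothendieck group follows from an additive index that
  separates the path components and takes all values in \<open>{0..m}\<close>. Isolating this lets one argument
  serve both the operator system and its envelope.
\<close>

locale index_classified =
  fixes E :: "'a::unital_cstar_algebra set" and \<nu> :: "nat \<Rightarrow> (nat \<Rightarrow> nat \<Rightarrow> 'a) \<Rightarrow> nat"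
  assumes path_iff: "x \<in> H E m \<Longrightarrow> y \<in> H E m \<Longrightarrow> path_component (H E m) x y \<longleftrightarrow> \<nu> m x = \<nu> m y"
    and index_le: "x \<in> H E m \<Longrightarrow> \<nu> m x \<le> m"
    and index_surj: "q \<le> m \<Longrightarrow> \<exists>x\<in>H E m. \<nu> m x = q"
    and dsum_H: "x \<in> H E m \<Longrightarrow> y \<in> H E k \<Longrightarrow> mat_dsum m x y \<in> H E (m + k)"
    and index_dsum: "x \<in> H E m \<Longrightarrow> y \<in> H E k \<Longrightarrow> \<nu> (m + k) (mat_dsum m x y) = \<nu> m x + \<nu> k y"
    and one_H: "mat_one m \<in> H E m"
    and index_one: "\<nu> m (mat_one m) = 0"
begin

definition level :: "nat \<Rightarrow> nat \<Rightarrow> (nat \<Rightarrow> nat \<Rightarrow> 'a) set" where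
  "level m q = {x \<in> H E m. \<nu> m x = q}"

lemma H_class_level:
  assumes x: "x \<in> H E m"
  shows "H_class E m x = level m (\<nu> m x)"
proof (intro equalityI subsetI)
  fix y
  show "y \<in> level m (\<nu> m x)" if "y \<in> H_class E m x"
    using that path_component_mem(2)[of "H E m" x y] path_iff[OF x, of y] by (simp add: level_def)
  show "y \<in> H_class E m x" if "y \<in> level m (\<nu> m x)"
    using that path_iff[OF x, of y] by (simp add: level_def)
qed

lemma level_nonempty: "q \<le> m \<Longrightarrow> level m q \<noteq> {}"
  using index_surj by (auto simp: level_def)

lemma level_inj: "q \<le> m \<Longrightarrow> level m q = level m' q' \<Longrightarrow> m = m' \<Longrightarrow> q = q'"
  using level_nonempty[of q m] by (auto simp: level_def)

lemma V0_levels: "V0 E m = level m ` {..m}"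
proof
  show "V0 E m \<subseteq> level m ` {..m}"
    unfolding V0_def using H_class_level index_le by auto
  show "level m ` {..m} \<subseteq> V0 E m"
  proof
    fix c assume "c \<in> level m ` {..m}"
    then obtain q where q: "q \<le> m" "c = level m q" by auto
    then obtain x where "x \<in> H E m" "\<nu> m x = q" using index_surj by blast
    then show "c \<in> V0 E m" unfolding V0_def using H_class_level q by blast
  qed
qed

lemma UN_eq_const: "A \<noteq> {} \<Longrightarrow> (\<And>x. x \<in> A \<Longrightarrow> B x = C) \<Longrightarrow> (\<Union>x\<in>A. B x) = C"
  by auto

lemma V0_conn_level:
  assumes "q \<le> m" "m \<le> N"
  shows "V0_conn E m N (level m q) = level N q"
  unfolding V0_conn_def
proof (rule UN_eq_const[OF level_nonempty[OF assms(1)]])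
  fix x assume "x \<in> level m q"
  then have x: "x \<in> H E m" "\<nu> m x = q" by (auto simp: level_def)
  have "mat_dsum m x (mat_one (N - m)) \<in> H E N" "\<nu> N (mat_dsum m x (mat_one (N - m))) = q"
    using dsum_H[OF x(1) one_H[of "N - m"]] index_dsum[OF x(1) one_H[of "N - m"]] x(2) assms(2) index_one
    by simp_all
  then show "H_class E N (mat_dsum m x (mat_one (N - m))) = level N q" using H_class_level by simp
qed

text \<open>
  The element \<open>q\<close> of the direct limit: the components of index \<open>q\<close> at all levels where they exist.
  Adding units to a matrix does not change its index.
\<close>

definition stable :: "nat \<Rightarrow> (nat \<times> (nat \<Rightarrow> nat \<Rightarrow> 'a) set) set" where
  "stable q = {(m, level m q) | m. 1 \<le> m \<and> q \<le> m}"

lemma V0_lim_rel_level: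
  assumes "1 \<le> m" "q \<le> m"
  shows "V0_lim_rel E `` {(m, level m q)} = stable q"
proof (intro equalityI subsetI)
  fix p assume "p \<in> V0_lim_rel E `` {(m, level m q)}"
  then obtain m' c' N where p: "p = (m', c')" "1 \<le> m'" "c' \<in> V0 E m'" "m \<le> N" "m' \<le> N"
    "V0_conn E m N (level m q) = V0_conn E m' N c'"
    unfolding V0_lim_rel_def by auto
  then obtain q' where q': "q' \<le> m'" "c' = level m' q'" using V0_levels by auto
  have "level N q = level N q'"
    using p(6) V0_conn_level[OF assms(2) p(4)] V0_conn_level[OF q'(1) p(5)] q'(2) by simp
  then have "q = q'" using level_inj[of q N N q'] assms(2) p(4) by simp
  then show "p \<in> stable q" unfolding stable_def using p q' by auto
next
  fix p assume "p \<in> stable q"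
  then obtain m' where p: "p = (m', level m' q)" "1 \<le> m'" "q \<le> m'" unfolding stable_def by auto
  have "V0_conn E m (max m m') (level m q) = V0_conn E m' (max m m') (level m' q)"
    using V0_conn_level assms(2) p(3) by simp
  moreover have "level m q \<in> V0 E m" "level m' q \<in> V0 E m'"
    using V0_levels assms(2) p(3) by auto
  ultimately show "p \<in> V0_lim_rel E `` {(m, level m q)}"
    unfolding V0_lim_rel_def using p assms(1) by (auto intro!: exI[of _ "max m m'"])
qed

lemma carrier_V0_lim: "carrier (V0_lim E) = range stable"
proof
  show "carrier (V0_lim E) \<subseteq> range stable"
  proof
    fix P assume "P \<in> carrier (V0_lim E)"
    then obtain m c where "1 \<le> m" "c \<in> V0 E m" "P = V0_lim_rel E `` {(m, c)}"
      unfolding V0_lim_def by (auto elim!: quotientE)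
    then show "P \<in> range stable" using V0_levels V0_lim_rel_level by auto
  qed
  show "range stable \<subseteq> carrier (V0_lim E)"
  proof
    fix P assume "P \<in> range stable"
    then obtain q where q: "P = stable q" by auto
    have "P = V0_lim_rel E `` {(max 1 q, level (max 1 q) q)}"
      using V0_lim_rel_level[of "max 1 q" q] q by simp
    moreover have "level (max 1 q) q \<in> V0 E (max 1 q)" using V0_levels by auto
    ultimately show "P \<in> carrier (V0_lim E)"
      unfolding V0_lim_def by (auto intro!: quotientI)
  qed
qed

lemma stable_nonempty: "stable q \<noteq> {}"
  unfolding stable_def by (auto intro: exI[of _ "max 1 q"])

lemma inj_stable: "inj stable"
proof (rule injI)
  fix p q assume eq: "stable p = stable q"
  have "(max 1 p, level (max 1 p) p) \<in> stable p" unfolding stable_def by auto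
  then have "(max 1 p, level (max 1 p) p) \<in> stable q" using eq by simp
  then show "p = q" using level_inj[of p "max 1 p" "max 1 p" q] unfolding stable_def by auto
qed

lemma mult_V0_lim: "stable p \<otimes>\<^bsub>V0_lim E\<^esub> stable q = stable (p + q)"
proof -
  have inner: "V0_lim_rel E `` {(m + m', H_class E (m + m') (mat_dsum m x x'))} = stable (p + q)"
    if "1 \<le> m" "p \<le> m" "q \<le> m'" "x \<in> level m p" "x' \<in> level m' q" for m m' x x'
  proof -
    have x: "x \<in> H E m" "\<nu> m x = p" "x' \<in> H E m'" "\<nu> m' x' = q"
      using that by (auto simp: level_def)
    have "H_class E (m + m') (mat_dsum m x x') = level (m + m') (p + q)"
      using H_class_level[OF dsum_H[OF x(1,3)]] index_dsum[OF x(1,3)] x by simp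
    then show ?thesis using V0_lim_rel_level that by simp
  qed
  have "stable p \<otimes>\<^bsub>V0_lim E\<^esub> stable q =
      (\<Union>P\<in>stable p. \<Union>Q\<in>stable q. \<Union>x\<in>snd P. \<Union>x'\<in>snd Q.
        V0_lim_rel E `` {(fst P + fst Q, H_class E (fst P + fst Q) (mat_dsum (fst P) x x'))})"
    by (simp add: V0_lim_def case_prod_unfold)
  also have "\<dots> = stable (p + q)"
  proof (rule UN_eq_const[OF stable_nonempty], rule UN_eq_const[OF stable_nonempty])
    fix P Q assume "P \<in> stable p" "Q \<in> stable q"
    then obtain m m' where P: "P = (m, level m p)" "1 \<le> m" "p \<le> m" and Q: "Q = (m', level m' q)" "q \<le> m'"
      unfolding stable_def by auto
    show "(\<Union>x\<in>snd P. \<Union>x'\<in>snd Q. V0_lim_rel E ``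
        {(fst P + fst Q, H_class E (fst P + fst Q) (mat_dsum (fst P) x x'))}) = stable (p + q)"
      unfolding P(1) Q(1) fst_conv snd_conv
      by (rule UN_eq_const[OF level_nonempty[OF P(3)]], rule UN_eq_const[OF level_nonempty[OF Q(2)]])
        (rule inner[OF P(2,3) Q(2)])
  qed
  finally show ?thesis .
qed

lemma one_V0_lim: "\<one>\<^bsub>V0_lim E\<^esub> = stable 0"
  using H_class_level[OF one_H[of 1]] index_one V0_lim_rel_level[of 1 0] by (simp add: V0_lim_def)

end

text \<open>
  The class of a pair only depends on the difference of its entries.
\<close>

lemma grothendieck_group_nat:
  fixes f :: "nat \<Rightarrow> 'b"
  assumes carrier: "carrier M = range f" and inj: "inj f"
    and mult: "\<And>p q. f p \<otimes>\<^bsub>M\<^esub> f q = f (p + q)" and one: "\<one>\<^bsub>M\<^esub> = f 0"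
  shows "comm_group (grothendieck_group M)" "grothendieck_group M \<cong> integer_group"
proof -
  define C where "C k = {(f a, f b) | a b. int a - int b = k}" for k
  have rel: "((f a, f b), (f c, f d)) \<in> grothendieck_rel M \<longleftrightarrow> int a - int b = int c - int d" for a b c d
    unfolding grothendieck_rel_def carrier using inj by (auto simp: mult inj_eq)
  have rel_class: "grothendieck_rel M `` {(f a, f b)} = C (int a - int b)" for a b
  proof (intro equalityI subsetI)
    fix p assume p: "p \<in> grothendieck_rel M `` {(f a, f b)}"
    then have "fst p \<in> carrier M" "snd p \<in> carrier M" by (auto simp: grothendieck_rel_def)
    then obtain c d where "p = (f c, f d)" unfolding carrier by (metis imageE prod.collapse)
    then show "p \<in> C (int a - int b)" using p rel unfolding C_def by auto
  next
    fix p assume "p \<in> C (int a - int b)"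
    then show "p \<in> grothendieck_rel M `` {(f a, f b)}" unfolding C_def using rel by auto
  qed
  have C_witness: "\<exists>a b. k = int a - int b" for k
    by (rule exI[of _ "nat k"], rule exI[of _ "nat (- k)"]) auto
  have C_ne: "C k \<noteq> {}" for k using C_witness[of k] unfolding C_def by auto
  have C_inj: "C k = C l \<Longrightarrow> k = l" for k l
  proof -
    assume "C k = C l"
    obtain a b where ab: "k = int a - int b" using C_witness by blast
    then have "(f a, f b) \<in> C k" unfolding C_def by blast
    then have "(f a, f b) \<in> C l" using \<open>C k = C l\<close> by simp
    then show "k = l" using inj ab unfolding C_def by (auto simp: inj_eq)
  qed
  let ?K = "grothendieck_group M"
  have carK: "carrier ?K = range C"
  proof
    show "carrier ?K \<subseteq> range C"
      unfolding grothendieck_group_def using rel_class carrier by (auto elim!: quotientE)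
    show "range C \<subseteq> carrier ?K"
    proof
      fix P assume "P \<in> range C"
      then obtain k where "P = C k" by auto
      moreover obtain a b where "k = int a - int b" using C_witness by blast
      ultimately have "P = grothendieck_rel M `` {(f a, f b)}" using rel_class by simp
      then show "P \<in> carrier ?K" unfolding grothendieck_group_def using carrier by (auto intro!: quotientI)
    qed
  qed
  have multK: "C k \<otimes>\<^bsub>?K\<^esub> C l = C (k + l)" for k l
  proof -
    have "C k \<otimes>\<^bsub>?K\<^esub> C l = (\<Union>P\<in>C k. \<Union>Q\<in>C l. grothendieck_rel M ``
        {(fst P \<otimes>\<^bsub>M\<^esub> fst Q, snd P \<otimes>\<^bsub>M\<^esub> snd Q)})"
      by (simp add: grothendieck_group_def case_prod_unfold)
    also have "\<dots> = (\<Union>P\<in>C k. \<Union>Q\<in>C l. C (k + l))"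
    proof (intro SUP_cong refl)
      fix P Q assume "P \<in> C k" "Q \<in> C l"
      then obtain a b c d where P: "P = (f a, f b)" "int a - int b = k" and Q: "Q = (f c, f d)" "int c - int d = l"
        unfolding C_def by auto
      have "int (a + c) - int (b + d) = k + l" using P(2) Q(2) by simp
      then show "grothendieck_rel M `` {(fst P \<otimes>\<^bsub>M\<^esub> fst Q, snd P \<otimes>\<^bsub>M\<^esub> snd Q)} = C (k + l)"
        unfolding P(1) Q(1) fst_conv snd_conv mult rel_class by simp
    qed
    finally show ?thesis using C_ne by simp
  qed
  have oneK: "\<one>\<^bsub>?K\<^esub> = C 0" by (simp add: grothendieck_group_def one rel_class)
  show "comm_group ?K"
  proof (rule comm_groupI)
    fix x y z assume "x \<in> carrier ?K" "y \<in> carrier ?K" "z \<in> carrier ?K"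
    then obtain k l r where "x = C k" "y = C l" "z = C r" unfolding carK by blast
    then show "x \<otimes>\<^bsub>?K\<^esub> y \<otimes>\<^bsub>?K\<^esub> z = x \<otimes>\<^bsub>?K\<^esub> (y \<otimes>\<^bsub>?K\<^esub> z)" by (simp add: multK add.assoc)
  next
    fix x y assume "x \<in> carrier ?K" "y \<in> carrier ?K"
    then obtain k l where xy: "x = C k" "y = C l" unfolding carK by blast
    show "x \<otimes>\<^bsub>?K\<^esub> y \<in> carrier ?K" unfolding xy multK carK by blast
    show "x \<otimes>\<^bsub>?K\<^esub> y = y \<otimes>\<^bsub>?K\<^esub> x" unfolding xy multK by (simp add: add.commute)
  next
    show "\<one>\<^bsub>?K\<^esub> \<in> carrier ?K" unfolding oneK carK by blast
  next
    fix x assume "x \<in> carrier ?K"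
    then obtain k where x: "x = C k" unfolding carK by blast
    show "\<one>\<^bsub>?K\<^esub> \<otimes>\<^bsub>?K\<^esub> x = x" unfolding x oneK multK by simp
    show "\<exists>y\<in>carrier ?K. y \<otimes>\<^bsub>?K\<^esub> x = \<one>\<^bsub>?K\<^esub>"
      unfolding x oneK carK by (rule bexI[of _ "C (- k)"]) (simp_all add: multK)
  qed
  have "C \<in> iso integer_group ?K"
    by (rule isoI)
      (auto simp: hom_def carK multK bij_betw_def inj_on_def integer_group_def dest: C_inj)
  then have "integer_group \<cong> ?K" by (auto simp: is_iso_def)
  then show "?K \<cong> integer_group" by (rule group.iso_sym[OF group_integer_group])
qed

context index_classified
begin

theorem K0_comm_group: "comm_group (K0 E)"
  and K0_iso_int: "K0 E \<cong> integer_group"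
  unfolding K0_def
  by (rule grothendieck_group_nat[OF carrier_V0_lim inj_stable mult_V0_lim one_V0_lim])+

end

lemma V0_incl_level:
  assumes E: "index_classified E \<nu>" and F: "index_classified F \<nu>" and "E \<subseteq> F" and "q \<le> m"
  shows "V0_incl F m (index_classified.level E \<nu> m q) = index_classified.level F \<nu> m q"
proof -
  interpret E: index_classified E \<nu> by (rule E)
  interpret F: index_classified F \<nu> by (rule F)
  obtain x where x: "x \<in> H E m" "\<nu> m x = q" using E.index_surj assms(4) by blast
  have "H E m \<subseteq> H F m"
    using assms(3) unfolding H_def mat_over_def by (auto split: if_splits)
  then have "x \<in> H F m" using x by blast
  then show ?thesis
    using V0_incl_H_class[OF assms(3) x(1)] E.H_class_level[OF x(1)] F.H_class_level x(2) by simp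
qed

lemma V0_incl_bij:
  assumes E: "index_classified E \<nu>" and F: "index_classified F \<nu>" and "E \<subseteq> F"
  shows "bij_betw (V0_incl F m) (V0 E m) (V0 F m)"
proof -
  interpret E: index_classified E \<nu> by (rule E)
  interpret F: index_classified F \<nu> by (rule F)
  show ?thesis
    unfolding bij_betw_def
  proof
    show "inj_on (V0_incl F m) (V0 E m)"
      unfolding E.V0_levels
      by (auto intro!: inj_onI simp: V0_incl_level[OF assms] dest!: F.level_inj[rotated])
    show "V0_incl F m ` V0 E m = V0 F m"
      unfolding E.V0_levels F.V0_levels image_image
      by (rule image_cong) (auto simp: V0_incl_level[OF assms])
  qed
qed

lemma V0_incl_conn:
  assumes E: "index_classified E \<nu>" and F: "index_classified F \<nu>" and "E \<subseteq> F" and "m \<le> m'" "c \<in> V0 E m"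
  shows "V0_incl F m' (V0_conn E m m' c) = V0_conn F m m' (V0_incl F m c)"
proof -
  interpret E: index_classified E \<nu> by (rule E)
  interpret F: index_classified F \<nu> by (rule F)
  obtain q where q: "q \<le> m" "c = E.level m q" using assms(5) unfolding E.V0_levels by auto
  then show ?thesis
    using E.V0_conn_level F.V0_conn_level V0_incl_level[OF assms(1-3)] assms(4) by simp
qed

section \<open>Stone--Weierstrass on the circle\<close>

lemma operator_system_zero: "operator_system E \<Longrightarrow> 0 \<in> E"
proof -
  assume "operator_system E"
  then have "0 *\<^sub>C 1 \<in> E" by (simp add: operator_system_def)
  then show ?thesis using scaleC_of_real[of 0 "1::'a"] by simp
qed

definition Zfun :: CS1 where "Zfun = Bcontfun circle_pt"

lemma Zfun_apply: "apply_bcontfun Zfun z = circle_pt z"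
  using Bcontfun_apply[of "\<lambda>z. z"] by (simp add: Zfun_def continuous_on_id)

text \<open>
  Real and imaginary parts of functions in \<open>B\<close> again lie in \<open>B\<close>, so the real theorem applies to the
  real-valued members.
\<close>

lemma stone_weierstrass_circle:
  assumes B: "operator_system B" "\<And>f g. f \<in> B \<Longrightarrow> g \<in> B \<Longrightarrow> f * g \<in> B" "Zfun \<in> B"
    and "\<eta> > 0"
  shows "\<exists>g\<in>B. dist f g < \<eta>"
proof -
  have B_add: "g + h \<in> B" if "g \<in> B" "h \<in> B" for g h using B(1) that by (simp add: operator_system_def)
  have B_scale: "a *\<^sub>C g \<in> B" if "g \<in> B" for g a using B(1) that by (simp add: operator_system_def)
  have B_star: "star g \<in> B" if "g \<in> B" for g using B(1) that by (simp add: operator_system_def)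
  have B_one: "1 \<in> B" using B(1) by (simp add: operator_system_def)
  define R where "R = {r :: circle \<Rightarrow> real. \<exists>g\<in>B. \<forall>z. apply_bcontfun g z = complex_of_real (r z)}"
  interpret function_ring_on R "UNIV :: circle set"
  proof
    show "compact (UNIV :: circle set)" by (rule compact_UNIV_circle)
  next
    fix r assume "r \<in> R"
    then obtain g where g: "\<And>z. apply_bcontfun g z = complex_of_real (r z)" unfolding R_def by blast
    have "continuous_on UNIV (\<lambda>z. Re (apply_bcontfun g z))"
      by (intro continuous_on_Re continuous_on_apply_bcontfun)
    then show "continuous_on UNIV r" by (simp add: g)
  next
    fix r s assume "r \<in> R" "s \<in> R"
    then obtain g h where g: "g \<in> B" "\<And>z. apply_bcontfun g z = complex_of_real (r z)"
      and h: "h \<in> B" "\<And>z. apply_bcontfun h z = complex_of_real (s z)" unfolding R_def by blast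
    show "(\<lambda>z. r z + s z) \<in> R"
      unfolding R_def using B_add[OF g(1) h(1)] by (intro CollectI bexI[of _ "g + h"]) (simp_all add: g h)
    show "(\<lambda>z. r z * s z) \<in> R"
      unfolding R_def using B(2)[OF g(1) h(1)]
      by (intro CollectI bexI[of _ "g * h"]) (simp_all add: g h bcontfun_alg_simps)
  next
    fix c :: real
    show "(\<lambda>_. c) \<in> R"
      unfolding R_def using B_scale[OF B_one, of "of_real c"]
      by (intro CollectI bexI[of _ "of_real c *\<^sub>C 1"]) (simp_all add: bcontfun_alg_simps scaleC_complex_def)
  next
    fix x y :: circle assume "x \<noteq> y"
    then have "circle_pt x \<noteq> circle_pt y" by (simp add: circle_pt_inject)
    have re: "(\<lambda>z. Re (circle_pt z)) \<in> R"
      unfolding R_def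
      by (intro CollectI bexI[of _ "(1/2) *\<^sub>C (Zfun + star Zfun)"] B_scale B_add B_star B(3))
        (simp add: bcontfun_alg_simps scaleC_complex_def star_complex_def Zfun_apply complex_add_cnj)
    have im: "(\<lambda>z. Im (circle_pt z)) \<in> R"
      unfolding R_def
      by (intro CollectI bexI[of _ "(- \<i> / 2) *\<^sub>C (Zfun + (- 1) *\<^sub>C star Zfun)"] B_scale B_add B_star B(3))
        (simp add: bcontfun_alg_simps scaleC_complex_def star_complex_def Zfun_apply complex_eq_iff)
    show "\<exists>f\<in>R. f x \<noteq> f y"
      using re im \<open>circle_pt x \<noteq> circle_pt y\<close> by (meson complex_eqI)
  qed
  have "continuous_on UNIV (\<lambda>z. Re (apply_bcontfun f z))" "continuous_on UNIV (\<lambda>z. Im (apply_bcontfun f z))"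
    by (intro continuous_on_Re continuous_on_Im continuous_on_apply_bcontfun)+
  then obtain r s where rs: "r \<in> R" "s \<in> R" "\<And>z. \<bar>Re (apply_bcontfun f z) - r z\<bar> < \<eta> / 3"
    "\<And>z. \<bar>Im (apply_bcontfun f z) - s z\<bar> < \<eta> / 3"
    using Stone_Weierstrass_basic[of _ "\<eta> / 3"] \<open>\<eta> > 0\<close> by (metis UNIV_I zero_less_divide_iff zero_less_numeral)
  obtain g h where g: "g \<in> B" "\<And>z. apply_bcontfun g z = complex_of_real (r z)"
    and h: "h \<in> B" "\<And>z. apply_bcontfun h z = complex_of_real (s z)" using rs(1,2) unfolding R_def by blast
  have "dist f (g + \<i> *\<^sub>C h) \<le> 2 * \<eta> / 3"
  proof (rule dist_bound)
    fix z
    define w where "w = apply_bcontfun f z - apply_bcontfun (g + \<i> *\<^sub>C h) z"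
    have "Re w = Re (apply_bcontfun f z) - r z" "Im w = Im (apply_bcontfun f z) - s z"
      by (simp_all add: w_def g h bcontfun_alg_simps scaleC_complex_def)
    then have "cmod w \<le> 2 * \<eta> / 3"
      using cmod_le[of w] rs(3)[of z] rs(4)[of z] by linarith
    then show "dist (apply_bcontfun f z) (apply_bcontfun (g + \<i> *\<^sub>C h) z) \<le> 2 * \<eta> / 3"
      by (simp add: dist_norm w_def)
  qed
  moreover have "g + \<i> *\<^sub>C h \<in> B" by (intro B_add B_scale g h)
  ultimately show ?thesis using \<open>\<eta> > 0\<close> by (intro bexI[of _ "g + \<i> *\<^sub>C h"]) auto
qed

section \<open>The Fejer--Riesz operator systems\<close>

lemma fejer_riesz_iff:
  "x \<in> fejer_riesz (d + 1) \<longleftrightarrow> deg_le (int d) (\<lambda>z. apply_bcontfun x (Abs_circle z)) \<and>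
     deg_le (int d) (\<lambda>z. cnj (apply_bcontfun x (Abs_circle z)))"
proof
  assume "x \<in> fejer_riesz (d + 1)"
  then obtain c where c: "\<forall>z. apply_bcontfun x z = (\<Sum>k=-int d..int d. c k * circle_pt z powi k)"
    unfolding fejer_riesz_def by auto
  have "apply_bcontfun x (Abs_circle z) = (\<Sum>k=-int d..int d. c k * z powi k)" if "z \<in> S1" for z
    using c that by (simp add: Abs_circle_inverse)
  then show "deg_le (int d) (\<lambda>z. apply_bcontfun x (Abs_circle z)) \<and>
     deg_le (int d) (\<lambda>z. cnj (apply_bcontfun x (Abs_circle z)))"
    by (intro conjI deg_le_laurent[where c = c]) auto
next
  assume "deg_le (int d) (\<lambda>z. apply_bcontfun x (Abs_circle z)) \<and>
     deg_le (int d) (\<lambda>z. cnj (apply_bcontfun x (Abs_circle z)))"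
  then obtain c where c: "\<forall>z\<in>S1. apply_bcontfun x (Abs_circle z) = (\<Sum>k=-int d..int d. c k * z powi k)"
    using laurent_coeffs[of "int d" _ "int d"] by blast
  have "apply_bcontfun x z = (\<Sum>k=-int d..int d. c k * circle_pt z powi k)" for z
    using bspec[OF c, of "circle_pt z"] by (simp add: circle_pt_inverse)
  then show "x \<in> fejer_riesz (d + 1)" unfolding fejer_riesz_def by auto
qed

lemma fejer_riesz_mono: "d \<le> d' \<Longrightarrow> fejer_riesz (d + 1) \<subseteq> fejer_riesz (d' + 1)"
  unfolding fejer_riesz_iff subset_iff using deg_le_mono[of "int d" _ "int d'"] by auto

lemma fejer_riesz_mult:
  "x \<in> fejer_riesz (d + 1) \<Longrightarrow> y \<in> fejer_riesz (d' + 1) \<Longrightarrow> x * y \<in> fejer_riesz (d + d' + 1)"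
  unfolding fejer_riesz_iff using deg_le_mult[of "int d" _ "int d'"]
  by (simp add: bcontfun_alg_simps)

lemma Zfun_fejer_riesz: "d \<ge> 1 \<Longrightarrow> Zfun \<in> fejer_riesz (d + 1)"
proof -
  assume "d \<ge> 1"
  have "deg_le (int d) (\<lambda>z. apply_bcontfun Zfun (Abs_circle z))"
    using \<open>d \<ge> 1\<close> by (intro deg_le_eqI[OF deg_le_powi[of 1 "int d" 1]]) (auto simp: Zfun_apply Abs_circle_inverse)
  moreover have "deg_le (int d) (\<lambda>z. cnj (apply_bcontfun Zfun (Abs_circle z)))"
    by (intro deg_le_eqI[OF deg_le_powi[of "-1" "int d" 1]])
      (auto simp: Zfun_apply Abs_circle_inverse S1_cnj power_int_minus)
  ultimately show ?thesis unfolding fejer_riesz_iff by blast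
qed

lemma trigonometric_density:
  assumes "\<eta> > 0"
  shows "\<exists>d. \<exists>g\<in>fejer_riesz (d + 1). dist f g < \<eta>"
proof -
  let ?B = "\<Union>d. fejer_riesz (d + 1)"
  have os: "operator_system (fejer_riesz (d + 1))" for d
    by (rule operator_system_fejer_riesz) simp
  have "operator_system ?B"
    unfolding operator_system_def
  proof (intro conjI ballI allI)
    show "1 \<in> ?B" using os unfolding operator_system_def by blast
    fix x assume "x \<in> ?B"
    then obtain d where d: "x \<in> fejer_riesz (d + 1)" by blast
    show "star x \<in> ?B" "a *\<^sub>C x \<in> ?B" for a using os d unfolding operator_system_def by blast+
    fix y assume "y \<in> ?B"
    then obtain d' where d': "y \<in> fejer_riesz (d' + 1)" by blast
    have "x \<in> fejer_riesz (max d d' + 1)" "y \<in> fejer_riesz (max d d' + 1)"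
      using d d' fejer_riesz_mono[of d "max d d'"] fejer_riesz_mono[of d' "max d d'"] by auto
    then have "x + y \<in> fejer_riesz (max d d' + 1)"
      using os[of "max d d'"] unfolding operator_system_def by blast
    then show "x + y \<in> ?B" by blast
  qed
  moreover have "x * y \<in> ?B" if "x \<in> ?B" "y \<in> ?B" for x y using that fejer_riesz_mult by blast
  moreover have "Zfun \<in> ?B" using Zfun_fejer_riesz[of 1] by blast
  ultimately have "\<exists>g\<in>?B. dist f g < \<eta>" using assms by (intro stone_weierstrass_circle) auto
  then show ?thesis by blast
qed

section \<open>The C*-envelope of the Fejer--Riesz operator system\<close>

lemma cstar_generated_fejer_riesz:
  assumes "d \<ge> 1"
  shows "cstar_generated (fejer_riesz (d + 1)) = UNIV"
proof -
  have "f \<in> B" if B: "cstar_subalgebra B" "fejer_riesz (d + 1) \<subseteq> B" for f B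
  proof -
    have "\<exists>g\<in>B. dist f g < e" if "e > 0" for e
      using B Zfun_fejer_riesz[OF assms] that
      by (intro stone_weierstrass_circle) (auto simp: cstar_subalgebra_def)
    then have "f \<in> closure B" unfolding closure_approachable by (metis dist_commute)
    then show "f \<in> B" using B(1) by (simp add: cstar_subalgebra_def closure_closed)
  qed
  then show ?thesis unfolding cstar_generated_def by blast
qed

text \<open>
  Let \<open>f\<close> be in the ideal with \<open>f(z\<^sub>0) \<noteq> 0\<close>. The function \<open>r - Re(z w)\<close>, with \<open>w\<close> the conjugate of \<open>z\<^sub>0\<close>
  and \<open>r < 1\<close> close to \<open>1\<close>, is negative at \<open>z\<^sub>0\<close> but nonnegative away from a neighbourhood of it. A large
  multiple of \<open>|f|\<^sup>2\<close>, which lies in the ideal, makes it nonnegative everywhere. Hence it is positive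
  modulo the ideal without being positive.
\<close>

lemma boundary_ideal_fejer_riesz:
  assumes "d \<ge> 1" and J: "boundary_ideal (fejer_riesz (d + 1)) J"
  shows "J = {0}"
proof (rule ccontr)
  assume "J \<noteq> {0}"
  have ideal: "closed_ideal J" using J by (simp add: boundary_ideal_def)
  then have J0: "0 \<in> J" and Jmult: "\<And>a x. x \<in> J \<Longrightarrow> a * x \<in> J" by (auto simp: closed_ideal_def)
  obtain f where f: "f \<in> J" "f \<noteq> 0" using \<open>J \<noteq> {0}\<close> J0 by blast
  then obtain z0 where z0: "apply_bcontfun f z0 \<noteq> 0" by (metis bcontfun_eqI zero_bcontfun.rep_eq)
  define w0 where "w0 = circle_pt z0"
  define G where "G z = (cmod (apply_bcontfun f z))\<^sup>2" for z
  define c where "c = G z0 / 2"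
  have c: "c > 0" using z0 by (simp add: c_def G_def)
  have Gcont: "continuous_on UNIV G"
    unfolding G_def by (intro continuous_intros continuous_on_apply_bcontfun)
  then obtain \<delta> where \<delta>: "\<delta> > 0" "\<And>z. dist z z0 < \<delta> \<Longrightarrow> dist (G z) (G z0) < c"
    unfolding continuous_on_iff using c by (metis UNIV_I)
  \<comment> \<open>chosen so that \<open>\<xi>\<close> below is negative only within distance \<open>\<delta>\<close> of \<open>z\<^sub>0\<close>\<close>
  define r where "r = 1 - (min \<delta> 1)\<^sup>2 / 4"
  have "(min \<delta> 1)\<^sup>2 > 0" "(min \<delta> 1)\<^sup>2 \<le> 1" using \<delta>(1) by (auto simp: power_le_one_iff)
  then have r: "r < 1" "r > 0" by (auto simp: r_def)
  define \<xi> where "\<xi> z = r - Re (circle_pt z * cnj w0)" for z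
  have norm_diff: "(cmod (a - b))\<^sup>2 = (cmod a)\<^sup>2 + (cmod b)\<^sup>2 - 2 * Re (a * cnj b)" for a b
    unfolding cmod_power2 by (simp add: power2_eq_square algebra_simps)
  have X_neg: "G z > c" if "\<xi> z < 0" for z
  proof -
    have "(cmod (circle_pt z - w0))\<^sup>2 = (cmod (circle_pt z))\<^sup>2 + (cmod w0)\<^sup>2 - 2 * Re (circle_pt z * cnj w0)"
      by (rule norm_diff)
    also have "\<dots> = 2 - 2 * Re (circle_pt z * cnj w0)" by (simp add: w0_def)
    also have "\<dots> < 2 - 2 * r" using that by (simp add: \<xi>_def)
    also have "\<dots> = (min \<delta> 1)\<^sup>2 / 2" by (simp add: r_def)
    also have "\<dots> < \<delta>\<^sup>2"
    proof -
      have "(min \<delta> 1)\<^sup>2 \<le> \<delta>\<^sup>2" using \<delta>(1) by (intro power_mono) auto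
      moreover have "\<delta>\<^sup>2 > 0" using \<delta>(1) by simp
      ultimately show ?thesis by linarith
    qed
    finally have "cmod (circle_pt z - w0) < \<delta>" using \<delta>(1) by (simp add: power2_less_imp_less)
    then have "dist z z0 < \<delta>" by (simp add: dist_circle_def dist_norm w0_def)
    then have "dist (G z) (G z0) < c" by (rule \<delta>(2))
    then show ?thesis unfolding dist_real_def c_def by linarith
  qed
  have X_bound: "\<xi> z \<ge> - 1" for z
  proof -
    have "Re (circle_pt z * cnj w0) \<le> cmod (circle_pt z * cnj w0)" by (rule complex_Re_le_cmod)
    also have "\<dots> = 1" by (simp add: norm_mult w0_def)
    finally show ?thesis using r by (simp add: \<xi>_def)
  qed
  define p where "p z = \<xi> z + 2 / c * G z" for z
  have p_nonneg: "p z \<ge> 0" for z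
  proof (cases "\<xi> z < 0")
    case True
    have "2 / c * G z \<ge> 2 / c * c" using X_neg[OF True] c by (intro mult_left_mono) auto
    then show ?thesis using X_bound[of z] c by (simp add: p_def)
  next
    case False
    have "2 / c * G z \<ge> 0" using c by (simp add: G_def)
    then show ?thesis using False by (simp add: p_def)
  qed
  have pcont: "continuous_on UNIV p"
    unfolding p_def \<xi>_def by (intro continuous_intros Gcont continuous_on_circle_pt)
  define y where "y = Bcontfun (\<lambda>z. complex_of_real (sqrt (p z)))"
  have y: "apply_bcontfun y z = complex_of_real (sqrt (p z))" for z
  proof -
    have "continuous_on UNIV (\<lambda>z. complex_of_real (sqrt (p z)))" by (intro continuous_intros pcont)
    then show ?thesis unfolding y_def using Bcontfun_inverse[OF continuous_imp_bcontfun_circle] by simp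
  qed
  define x where "x = complex_of_real r *\<^sub>C 1 + (- 1 / 2) *\<^sub>C (cnj w0 *\<^sub>C Zfun + star (cnj w0 *\<^sub>C Zfun))"
  have xX: "apply_bcontfun x z = complex_of_real (\<xi> z)" for z
    by (simp add: x_def \<xi>_def bcontfun_alg_simps scaleC_complex_def star_complex_def Zfun_apply complex_eq_iff)
      (simp add: field_simps)
  have x_in: "x \<in> fejer_riesz (d + 1)"
    using operator_system_fejer_riesz[of "d + 1"] Zfun_fejer_riesz[OF assms(1)]
    unfolding x_def operator_system_def by auto
  have star_x: "star x = x"
    by (rule bcontfun_eqI) (simp add: bcontfun_alg_simps star_complex_def xX)
  define M where "M a = (\<lambda>(i :: nat) (j :: nat). if i < 1 \<and> j < 1 then a else 0)" for a :: CS1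
  have star0: "star (0 :: CS1) = 0" by (rule bcontfun_eqI) (simp add: bcontfun_alg_simps star_complex_def)
  have M_in: "M a \<in> mat_over 1 F" if "a \<in> F" for a F using that by (auto simp: M_def mat_over_def)
  have "mat_star (M x) = M x" by (intro ext) (auto simp: mat_star_def M_def star_x star0)
  moreover have "M (star y * y) = mat_mult 1 (mat_star (M y)) (M y)"
    by (intro ext) (auto simp: mat_mult_def mat_star_def M_def star0)
  then have "mat_pos 1 (M (star y * y))" unfolding mat_pos_def using M_in[of y UNIV] by auto
  moreover have "M x i j - M (star y * y) i j \<in> J" if "i < 1" "j < 1" for i j
  proof -
    have "x - star y * y = ((- complex_of_real (2 / c)) *\<^sub>C star f) * f"
    proof (rule bcontfun_eqI)
      fix z
      have "complex_of_real (sqrt (p z)) * complex_of_real (sqrt (p z)) = complex_of_real (p z)"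
        using p_nonneg[of z] by (simp flip: of_real_mult)
      moreover have "cnj (apply_bcontfun f z) * apply_bcontfun f z = complex_of_real (G z)"
        unfolding G_def complex_norm_square by (rule mult.commute)
      ultimately show "apply_bcontfun (x - star y * y) z =
          apply_bcontfun (((- complex_of_real (2 / c)) *\<^sub>C star f) * f) z"
        by (simp add: bcontfun_alg_simps scaleC_complex_def star_complex_def xX y p_def mult.assoc)
    qed
    then show ?thesis using Jmult[OF f(1)] that by (simp add: M_def)
  qed
  ultimately have "mat_pos 1 (M x)"
    using J M_in[OF x_in] unfolding boundary_ideal_def by blast
  then obtain u where "M x = mat_mult 1 (mat_star u) u" unfolding mat_pos_def by blast
  then have "M x 0 0 = star (u 0 0) * u 0 0" by (simp add: mat_mult_def mat_star_def)
  then have "apply_bcontfun x z0 = cnj (apply_bcontfun (u 0 0) z0) * apply_bcontfun (u 0 0) z0"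
    by (simp add: M_def bcontfun_alg_simps star_complex_def)
  then have "complex_of_real (\<xi> z0) = complex_of_real ((cmod (apply_bcontfun (u 0 0) z0))\<^sup>2)"
    by (simp only: xX complex_norm_square mult.commute)
  then have "\<xi> z0 \<ge> 0" by (simp only: of_real_eq_iff) simp
  moreover have "Re (w0 * cnj w0) = 1" unfolding complex_norm_square[symmetric] by (simp add: w0_def)
  ultimately show False using r by (simp add: \<xi>_def w0_def)
qed

lemma envelope_fejer_riesz:
  assumes "d \<ge> 1"
  shows "ambient_is_cstar_envelope (fejer_riesz (d + 1))"
  using cstar_generated_fejer_riesz[OF assms] boundary_ideal_fejer_riesz[OF assms]
  by (simp add: ambient_is_cstar_envelope_def)

section \<open>The index\<close>

lemma continuous_on_symbol_path:
  assumes "continuous_on T g"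
  shows "continuous_on T (\<lambda>t. symbol (g t) z i j)"
proof -
  have "continuous_on T (\<lambda>t. g t i)" by (rule continuous_on_product_then_coordinatewise[OF assms])
  then have gij: "continuous_on T (\<lambda>t. g t i j)" by (rule continuous_on_product_then_coordinatewise)
  have "continuous_on UNIV (\<lambda>f :: CS1. apply_bcontfun f (Abs_circle z))"
    unfolding continuous_on_iff
  proof (intro ballI allI impI)
    fix f :: CS1 and e :: real assume "e > 0"
    then show "\<exists>\<delta>>0. \<forall>g\<in>UNIV. dist g f < \<delta> \<longrightarrow>
        dist (apply_bcontfun g (Abs_circle z)) (apply_bcontfun f (Abs_circle z)) < e"
      using le_less_trans[OF dist_bounded] by blast
  qed
  then show ?thesis
    unfolding symbol_def by (rule continuous_on_compose2[OF _ gij]) simp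
qed

definition index :: "nat \<Rightarrow> (nat \<Rightarrow> nat \<Rightarrow> CS1) \<Rightarrow> nat" where
  "index m x = neg_index m (symbol x 1)"

lemma index_path:
  assumes "path_component (H E m) x y"
  shows "index m x = index m y"
proof -
  obtain g where g: "path g" "path_image g \<subseteq> H E m" "pathstart g = x" "pathfinish g = y"
    using assms unfolding path_component_def by blast
  have H: "g t \<in> H E m" if "t \<in> {0..1}" for t using g(2) that unfolding path_image_def by blast
  have "neg_index m (symbol (g 0) 1) = neg_index m (symbol (g 1) 1)"
  proof (rule neg_index_path)
    show "continuous_on {0..1} (\<lambda>t. symbol (g t) 1 i j)" for i j
      using g(1) unfolding path_def by (rule continuous_on_symbol_path)
    show "hermitian m (symbol (g t) 1)" "mdet m (symbol (g t) 1) \<noteq> 0" if "t \<in> {0..1}" for t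
      using H[OF that] by (auto simp: H_iff)
  qed
  then show ?thesis using g(3,4) by (simp add: index_def pathstart_def pathfinish_def)
qed

definition standard :: "nat \<Rightarrow> nat \<Rightarrow> nat \<Rightarrow> nat \<Rightarrow> CS1" where
  "standard m q = of_symbol m (\<lambda>z. sign_mat {..<q})"

lemma admissible_sign_mat: "admissible d m (\<lambda>z. sign_mat A)"
  by (simp add: admissible_def deg_le_const hermitian_sign_mat mdet_sign_mat)

lemma admissible_of_symbol_H:
  assumes "admissible d m f"
  shows "of_symbol m f \<in> H (fejer_riesz (d + 1)) m"
proof (rule of_symbol_in_H)
  fix i j assume ij: "i < m" "j < m"
  have "deg_le (int d) (\<lambda>z. f z i j)" using assms ij by (simp add: admissible_def)
  then show "of_symbol m f i j \<in> fejer_riesz (d + 1)"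
    using of_symbol_in_fejer_riesz[of d f i j m] admissible_deg_le_cnj[OF assms ij] ij by blast
  show "continuous_on S1 (\<lambda>z. f z i j)" by (rule admissible_continuous[OF assms ij])
qed (use assms in \<open>auto simp: admissible_def\<close>)

lemma H_mono: "E \<subseteq> F \<Longrightarrow> H E m \<subseteq> H F m"
  using mat_over_mono[of E F m] by (auto simp: H_def)

lemma standard_H: "standard m q \<in> H (fejer_riesz (d + 1)) m"
  unfolding standard_def by (rule admissible_of_symbol_H[OF admissible_sign_mat])

lemma index_standard: "q \<le> m \<Longrightarrow> index m (standard m q) = q"
proof -
  assume "q \<le> m"
  have "index m (standard m q) = neg_index m (sign_mat {..<q})"
    unfolding index_def standard_def by (rule neg_index_cong) (simp add: symbol_of_symbol)
  also have "\<dots> = q" using neg_index_sign_mat[of "{..<q}" m] \<open>q \<le> m\<close> by auto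
  finally show ?thesis .
qed

lemma H_fejer_riesz_standard:
  assumes x: "x \<in> H (fejer_riesz (d + 1)) m"
  obtains q where "q \<le> m" "path_component (H (fejer_riesz (d + 1)) m) x (standard m q)"
proof -
  have mat: "x \<in> mat_over m (fejer_riesz (d + 1))" using x by (simp add: H_def)
  have "x i j \<in> fejer_riesz (d + 1)" if "i < m" "j < m" for i j
    using mat that by (auto simp: mat_over_def)
  then have "deg_le (int d) (\<lambda>z. symbol x z i j)" if "i < m" "j < m" for i j
    using that fejer_riesz_iff unfolding symbol_def by blast
  then have "admissible d m (symbol x)" using x by (auto simp: admissible_def H_iff)
  then obtain q where "q \<le> m" "joined d m (symbol x) (\<lambda>z. sign_mat {..<q})" by (rule joined_standard)
  moreover have "of_symbol m (symbol x) = x"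
    using mat mat_over_mono[of "fejer_riesz (d + 1)" UNIV m] by (intro of_symbol_symbol) auto
  ultimately show ?thesis using that by (simp add: joined_def standard_def)
qed

section \<open>Density of trigonometric polynomials and the components\<close>

text \<open>
  If \<open>b v = 0\<close> and \<open>b\<close> is within \<open>\<eta>\<close> of \<open>x(z)\<close>, then \<open>x(z) v\<close> is small compared with the largest entry of
  \<open>v\<close>, and applying the inverse of \<open>x\<close>, whose entries are bounded uniformly in \<open>z\<close>, shows \<open>v = 0\<close>.
\<close>

lemma bounded_inverse:
  fixes x :: "nat \<Rightarrow> nat \<Rightarrow> CS1"
  assumes x: "x \<in> H UNIV m"
  obtains \<eta> where "\<eta> > 0"
    "\<And>z b. \<lbrakk>z \<in> S1; \<forall>i<m. \<forall>j<m. cmod (symbol x z i j - b i j) \<le> \<eta>\<rbrakk> \<Longrightarrow> mdet m b \<noteq> 0"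
proof -
  obtain w where w: "mat_mult m w x = mat_one m"
    using x unfolding H_def mat_invertible_def by blast
  define Y where "Y = (\<Sum>i<m. \<Sum>j<m. norm (w i j))"
  \<comment> \<open>any positive value with \<open>Y m \<eta> < 1\<close> would do\<close>
  define \<eta> where "\<eta> = 1 / ((Y + 1) * (m + 1))"
  have Y: "Y \<ge> 0" unfolding Y_def by (intro sum_nonneg) auto
  then have \<eta>: "\<eta> > 0" by (simp add: \<eta>_def)
  have "mdet m b \<noteq> 0" if z: "z \<in> S1" and b: "\<forall>i<m. \<forall>j<m. cmod (symbol x z i j - b i j) \<le> \<eta>" for z b
  proof
    assume "mdet m b = 0"
    then obtain v where v: "\<exists>i<m. v i \<noteq> 0" "\<forall>i<m. (\<Sum>j<m. b i j * v j) = 0"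
      unfolding mdet_eq_0_iff by blast
    have "m > 0" using v(1) by auto
    have "Max ((\<lambda>i. cmod (v i)) ` {..<m}) \<in> (\<lambda>i. cmod (v i)) ` {..<m}"
      using \<open>m > 0\<close> by (intro Max_in) auto
    then obtain a where a: "a < m" "Max ((\<lambda>i. cmod (v i)) ` {..<m}) = cmod (v a)" by blast
    have max: "cmod (v i) \<le> cmod (v a)" if "i < m" for i
      using Max_ge[of "(\<lambda>i. cmod (v i)) ` {..<m}" "cmod (v i)"] that a(2) by simp
    have va: "cmod (v a) > 0" 
    proof -
      obtain i where "i < m" "v i \<noteq> 0" using v(1) by blast
      then show ?thesis using max[of i] by (metis less_le_trans zero_less_norm_iff)
    qed
    have row: "cmod (\<Sum>j<m. symbol x z i j * v j) \<le> m * \<eta> * cmod (v a)" if i: "i < m" for i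
    proof -
      have "(\<Sum>j<m. symbol x z i j * v j) = (\<Sum>j<m. (symbol x z i j - b i j) * v j)"
        using v(2) i by (simp add: left_diff_distrib sum_subtractf)
      also have "cmod \<dots> \<le> (\<Sum>j<m. \<eta> * cmod (v a))"
      proof (rule sum_norm_le)
        fix j assume "j \<in> {..<m}"
        then show "cmod ((symbol x z i j - b i j) * v j) \<le> \<eta> * cmod (v a)"
          unfolding norm_mult using b i max \<eta> by (intro mult_mono) auto
      qed
      finally show ?thesis by simp
    qed
    have "v a = (\<Sum>j<m. id_mat a j * v j)" using a(1) by (simp add: id_mat_def mult_delta_left cong: if_cong)
    also have "\<dots> = (\<Sum>j<m. mat_mult m (symbol w z) (symbol x z) a j * v j)"
      using a(1) by (intro sum.cong refl) (simp add: symbol_mat_one w flip: symbol_mat_mult)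
    also have "\<dots> = (\<Sum>j<m. \<Sum>i<m. symbol w z a i * (symbol x z i j * v j))"
      by (simp add: mat_mult_def sum_distrib_right mult.assoc)
    also have "\<dots> = (\<Sum>i<m. symbol w z a i * (\<Sum>j<m. symbol x z i j * v j))"
      by (subst sum.swap) (simp add: sum_distrib_left)
    also have "cmod \<dots> \<le> (\<Sum>i<m. norm (w a i) * (m * \<eta> * cmod (v a)))"
    proof (rule sum_norm_le)
      fix i assume "i \<in> {..<m}"
      then show "cmod (symbol w z a i * (\<Sum>j<m. symbol x z i j * v j)) \<le> norm (w a i) * (m * \<eta> * cmod (v a))"
        unfolding norm_mult using row norm_bounded[of "w a i"] by (intro mult_mono) (auto simp: symbol_def)
    qed
    also have "\<dots> = (\<Sum>i<m. norm (w a i)) * (m * \<eta> * cmod (v a))" by (simp add: sum_distrib_right)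
    also have "\<dots> \<le> Y * (m * \<eta> * cmod (v a))"
    proof (rule mult_right_mono)
      show "(\<Sum>i<m. norm (w a i)) \<le> Y"
        unfolding Y_def using a(1) by (intro member_le_sum) (auto intro: sum_nonneg)
    qed (use \<eta> in auto)
    finally have "1 \<le> Y * (m * \<eta>)" using va by (simp add: field_simps)
    moreover have "Y * (m * \<eta>) < 1"
    proof -
      have "Y * m < (Y + 1) * (m + 1)" using Y by (simp add: algebra_simps)
      then show ?thesis using Y by (simp add: \<eta>_def)
    qed
    ultimately show False by simp
  qed
  then show ?thesis using that \<eta> by blast
qed

text \<open>
  A Hermitian approximation with trigonometric polynomial entries is joined to \<open>x\<close> by a segment. Its
  degree is arbitrarily large, which is harmless: the endpoint of the deformation is constant.
\<close>

lemma H_UNIV_standard: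
  fixes x :: "nat \<Rightarrow> nat \<Rightarrow> CS1"
  assumes x: "x \<in> H UNIV m"
  obtains q where "q \<le> m" "path_component (H UNIV m) x (standard m q)"
proof -
  obtain \<eta> where \<eta>: "\<eta> > 0"
    "\<And>z b. \<lbrakk>z \<in> S1; \<forall>i<m. \<forall>j<m. cmod (symbol x z i j - b i j) \<le> \<eta>\<rbrakk> \<Longrightarrow> mdet m b \<noteq> 0"
    using bounded_inverse[OF x] by metis
  have "\<forall>i j. \<exists>g. dist (x i j) g < \<eta> \<and> (\<exists>d. g \<in> fejer_riesz (d + 1))"
    using trigonometric_density[OF \<eta>(1)] by blast
  then obtain g D where g: "\<And>i j. dist (x i j) (g i j) < \<eta>" "\<And>i j. g i j \<in> fejer_riesz (D i j + 1)"
    by metis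
  define d where "d = Max ((\<lambda>(i, j). D i j) ` ({..<m} \<times> {..<m}) \<union> {0})"
  have gd: "g i j \<in> fejer_riesz (d + 1)" if "i < m" "j < m" for i j
  proof -
    have "D i j \<le> d" unfolding d_def using that by (intro Max_ge) (auto intro!: image_eqI[of _ _ "(i, j)"])
    then show ?thesis using g(2) fejer_riesz_mono by blast
  qed
  have g_close: "cmod (symbol x z i j - symbol g z i j) \<le> \<eta>" for z i j
    using dist_bounded[of "x i j" "Abs_circle z" "g i j"] g(1)[of i j] by (simp add: symbol_def dist_norm)
  \<comment> \<open>the Hermitian part keeps both the closeness and the degree\<close>
  define h where "h z i j = (symbol g z i j + cnj (symbol g z j i)) / 2" for z i j
  have xh: "symbol x z j i = cnj (symbol x z i j)" if "z \<in> S1" "i < m" "j < m" for z i j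
    using x that by (intro hermitianD) (auto simp: H_iff)
  have h_close: "cmod (symbol x z i j - h z i j) \<le> \<eta>" if "z \<in> S1" "i < m" "j < m" for z i j
  proof -
    have "symbol x z i j = cnj (symbol x z j i)" using xh[OF that(1,3,2)] .
    then have eq: "symbol x z i j - h z i j = ((symbol x z i j - symbol g z i j) + cnj (symbol x z j i - symbol g z j i)) / 2"
      by (simp add: h_def field_simps)
    have "cmod (symbol x z i j - h z i j) =
        cmod ((symbol x z i j - symbol g z i j) + cnj (symbol x z j i - symbol g z j i)) / 2"
      unfolding eq by (simp only: norm_divide norm_numeral)
    also have "\<dots> \<le> (cmod (symbol x z i j - symbol g z i j) + cmod (cnj (symbol x z j i - symbol g z j i))) / 2"
      by (intro divide_right_mono norm_triangle_ineq) simp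
    also have "\<dots> = (cmod (symbol x z i j - symbol g z i j) + cmod (symbol x z j i - symbol g z j i)) / 2"
      by (simp only: complex_mod_cnj)
    also have "\<dots> \<le> \<eta>" using g_close[of z i j] g_close[of z j i] by simp
    finally show ?thesis .
  qed
  have gTD: "deg_le (int d) (\<lambda>z. symbol g z i j)" "deg_le (int d) (\<lambda>z. cnj (symbol g z i j))" if "i < m" "j < m" for i j
    using gd[OF that] fejer_riesz_iff unfolding symbol_def by blast+
  have h_deg_le: "deg_le (int d) (\<lambda>z. h z i j)" if "i < m" "j < m" for i j
    using deg_le_cmult[OF deg_le_add[OF gTD(1)[OF that] gTD(2)[OF that(2,1)]], of "1 / 2"] by (simp add: h_def)
  have h_herm: "hermitian m (h z)" for z unfolding hermitian_def h_def by (simp add: add.commute)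
  have seg: "mdet m (\<lambda>i j. (1 - of_real t) * symbol x z i j + of_real t * h z i j) \<noteq> 0"
    if "t \<in> {0..1}" "z \<in> S1" for t z
  proof (rule \<eta>(2)[OF that(2)], intro allI impI)
    fix i j assume ij: "i < m" "j < m"
    have "symbol x z i j - ((1 - of_real t) * symbol x z i j + of_real t * h z i j) =
        of_real t * (symbol x z i j - h z i j)" by (simp add: algebra_simps)
    also have "cmod \<dots> \<le> 1 * \<eta>"
      unfolding norm_mult using h_close[OF that(2) ij] that(1) by (intro mult_mono) auto
    finally show "cmod (symbol x z i j - ((1 - of_real t) * symbol x z i j + of_real t * h z i j)) \<le> \<eta>" by simp
  qed
  have hh: "admissible d m h"
    using h_deg_le h_herm seg[of 1] by (simp add: admissible_def)
  then obtain q where q: "q \<le> m" "joined d m h (\<lambda>z. sign_mat {..<q})" by (rule joined_standard)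
  have "path_component (H UNIV m) (of_symbol m h) (standard m q)"
    using path_component_of_subset[OF H_mono[OF subset_UNIV]] q(2)
    unfolding joined_def standard_def by blast
  moreover have "path_component (H UNIV m) (of_symbol m (symbol x)) (of_symbol m h)"
  proof -
    define F where "F t z i j = (1 - complex_of_real t) * symbol x z i j + of_real t * h z i j" for t z i j
    have "path_component (H UNIV m) (of_symbol m (F 0)) (of_symbol m (F 1))"
    proof (rule path_component_of_symbol)
      fix i j assume ij: "i < m" "j < m"
      have "continuous_on ({0..1::real} \<times> S1) (\<lambda>p. symbol x (snd p) i j)"
        by (rule continuous_on_compose2[OF continuous_on_symbol]) (auto intro: continuous_intros)
      moreover have "continuous_on ({0..1::real} \<times> S1) (\<lambda>p. h (snd p) i j)"
        by (rule continuous_on_compose2[OF admissible_continuous[OF hh ij]]) (auto intro: continuous_intros)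
      ultimately show "continuous_on ({0..1} \<times> S1) (\<lambda>(t, z). F t z i j)"
        unfolding F_def case_prod_unfold by (intro continuous_intros)
    next
      fix t :: real and z assume t: "t \<in> {0..1}" "z \<in> S1"
      show "mdet m (F t z) \<noteq> 0" unfolding F_def using seg[OF t] .
      show "hermitian m (F t z)"
        unfolding hermitian_def
      proof (intro allI impI)
        fix i j assume ij: "i < m" "j < m"
        show "F t z j i = cnj (F t z i j)"
          unfolding F_def xh[OF t(2) ij] hermitianD[OF h_herm ij] by simp
      qed
    qed auto
    moreover have "F 0 = symbol x" "F 1 = h" by (intro ext, simp add: F_def)+
    ultimately show ?thesis by simp
  qed
  moreover have "of_symbol m (symbol x) = x" using x by (intro of_symbol_symbol) (simp add: H_def)
  ultimately show ?thesis using that q(1) path_component_trans by metis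
qed

section \<open>Direct sums\<close>

lemma sum_lessThan_add: "(\<Sum>i<m + k. f i) = (\<Sum>i<m. f i) + (\<Sum>i<k. f (m + i))" for f :: "nat \<Rightarrow> 'a::comm_monoid_add"
  by (induction k) (simp_all add: add.assoc)

lemma congr_dsum:
  assumes "i < m + k" "j < m + k"
  shows "congr (m + k) (mat_dsum m T R) (mat_dsum m a b) i j = mat_dsum m (congr m T a) (congr k R b) i j"
  unfolding congr_entry sum_lessThan_add using assms by (auto simp: mat_dsum_def congr_entry)

lemma kernel_trivial:
  fixes a :: "nat \<Rightarrow> nat \<Rightarrow> complex"
  assumes "mdet m a \<noteq> 0" "\<And>i. i < m \<Longrightarrow> (\<Sum>j<m. a i j * v j) = 0" "i < m"
  shows "v i = 0"
  using assms mdet_eq_0_iff[of m a] by blast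

lemma mdet_dsum_nz:
  fixes a b :: "nat \<Rightarrow> nat \<Rightarrow> complex"
  assumes "mdet m a \<noteq> 0" "mdet k b \<noteq> 0"
  shows "mdet (m + k) (mat_dsum m a b) \<noteq> 0"
proof
  assume "mdet (m + k) (mat_dsum m a b) = 0"
  then obtain v where v: "\<exists>i<m + k. v i \<noteq> 0" "\<forall>i<m + k. (\<Sum>j<m + k. mat_dsum m a b i j * v j) = 0"
    unfolding mdet_eq_0_iff by blast
  have 1: "(\<Sum>j<m. a i j * v j) = 0" if "i < m" for i
    using v(2)[rule_format, of i] that unfolding sum_lessThan_add by (simp add: mat_dsum_def)
  have 2: "(\<Sum>j<k. b i j * v (m + j)) = 0" if "i < k" for i
    using v(2)[rule_format, of "m + i"] that unfolding sum_lessThan_add by (simp add: mat_dsum_def)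
  have "v i = 0" if "i < m" for i by (rule kernel_trivial[OF assms(1) 1 that])
  moreover have "v (m + i) = 0" if "i < k" for i
    by (rule kernel_trivial[OF assms(2), of "\<lambda>i. v (m + i)"]) (use 2 that in auto)
  ultimately have "v i = 0" if "i < m + k" for i
    using that by (metis add_less_cancel_left le_add_diff_inverse not_less)
  then show False using v(1) by blast
qed

lemma hermitian_dsum: "hermitian m a \<Longrightarrow> hermitian k b \<Longrightarrow> hermitian (m + k) (mat_dsum m a b)"
  unfolding hermitian_def[of "m + k"]
proof (intro allI impI)
  fix i j assume "hermitian m a" "hermitian k b" "i < m + k" "j < m + k"
  then show "mat_dsum m a b j i = cnj (mat_dsum m a b i j)"
    using hermitianD[of m a i j] hermitianD[of k b "i - m" "j - m"] by (auto simp: mat_dsum_def)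
qed

lemma neg_index_unique:
  assumes A: "A \<subseteq> {..<m}" and T: "mdet m T \<noteq> 0"
    and h: "\<And>i j. i < m \<Longrightarrow> j < m \<Longrightarrow> h i j = congr m T (sign_mat A) i j"
  shows "neg_index m h = card A"
proof -
  obtain R where R: "\<And>i j. i < m \<Longrightarrow> j < m \<Longrightarrow> mat_mult m T R i j = id_mat i j"
    using mat_inverse_exists[OF T] by metis
  have id: "sign_mat A i j = congr m R h i j" if "i < m" "j < m" for i j
    using congr_inverse[OF R h[symmetric] that] .
  have "hermitian m h"
    unfolding hermitian_def
  proof (intro allI impI)
    fix i j assume ij: "i < m" "j < m"
    show "h j i = cnj (h i j)"
      unfolding h[OF ij] h[OF ij(2,1)] by (rule hermitianD[OF hermitian_congr[OF hermitian_sign_mat] ij])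
  qed
  moreover have "mdet m h = mdet m (congr m T (sign_mat A))" by (rule mdet_cong) (rule h)
  then have "mdet m h \<noteq> 0" using T mdet_sign_mat by (simp add: mdet_congr)
  ultimately show ?thesis
    by (rule neg_index_close[OF A, where R = R]) (simp flip: id)
qed

lemma neg_index_dsum:
  assumes a: "hermitian m a" "mdet m a \<noteq> 0" and b: "hermitian k b" "mdet k b \<noteq> 0"
  shows "neg_index (m + k) (mat_dsum m a b) = neg_index m a + neg_index k b"
proof -
  obtain A T where A: "A \<subseteq> {..<m}" "card A = neg_index m a" "mdet m T \<noteq> 0"
    "\<And>i j. i < m \<Longrightarrow> j < m \<Longrightarrow> a i j = congr m T (sign_mat A) i j"
    using neg_index_witness[OF a] by metis
  obtain B R where B: "B \<subseteq> {..<k}" "card B = neg_index k b" "mdet k R \<noteq> 0"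
    "\<And>i j. i < k \<Longrightarrow> j < k \<Longrightarrow> b i j = congr k R (sign_mat B) i j"
    using neg_index_witness[OF b] by metis
  define C where "C = A \<union> (\<lambda>i. m + i) ` B"
  have "neg_index (m + k) (mat_dsum m a b) = card C"
  proof (rule neg_index_unique)
    show "C \<subseteq> {..<m + k}" using A(1) B(1) by (auto simp: C_def)
    show "mdet (m + k) (mat_dsum m T R) \<noteq> 0" by (rule mdet_dsum_nz[OF A(3) B(3)])
    fix i j assume ij: "i < m + k" "j < m + k"
    have D: "sign_mat C i j = mat_dsum m (sign_mat A) (sign_mat B) i j" if "i < m + k" "j < m + k" for i j
      using A(1) that by (auto simp: sign_mat_def mat_dsum_def C_def image_iff)
    have "mat_dsum m a b i j = mat_dsum m (congr m T (sign_mat A)) (congr k R (sign_mat B)) i j"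
      using A(4) B(4) ij by (auto simp: mat_dsum_def)
    also have "\<dots> = congr (m + k) (mat_dsum m T R) (mat_dsum m (sign_mat A) (sign_mat B)) i j"
      using congr_dsum[OF ij] by simp
    also have "\<dots> = congr (m + k) (mat_dsum m T R) (sign_mat C) i j"
      using D ij by (intro congr_cong) auto
    finally show "mat_dsum m a b i j = congr (m + k) (mat_dsum m T R) (sign_mat C) i j" .
  qed
  also have "card C = card A + card B"
    unfolding C_def using A(1) B(1) finite_subset[OF A(1)] finite_subset[OF B(1)]
    by (subst card_Un_disjoint) (auto simp: card_image inj_on_def)
  finally show ?thesis using A(2) B(2) by simp
qed

lemma symbol_dsum: "symbol (mat_dsum m x y) z = mat_dsum m (symbol x z) (symbol y z)"
  by (intro ext) (simp add: symbol_def mat_dsum_def)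

section \<open>Classification of the components\<close>

text \<open>
  Once every element is joined to a standard one, the invariance of the index under paths and its
  values on the standard elements determine the components.
\<close>

lemma index_classified_CS1:
  assumes E: "operator_system (E :: CS1 set)" and std: "\<And>m q. standard m q \<in> H E m"
    and conn: "\<And>m x. x \<in> H E m \<Longrightarrow> \<exists>q\<le>m. path_component (H E m) x (standard m q)"
  shows "index_classified E index"
proof
  fix m k x y
  show "path_component (H E m) x y \<longleftrightarrow> index m x = index m y" if xy: "x \<in> H E m" "y \<in> H E m"
  proof
    assume "path_component (H E m) x y"
    then show "index m x = index m y" by (rule index_path)
  next
    assume eq: "index m x = index m y"
    obtain p q where p: "p \<le> m" "path_component (H E m) x (standard m p)"
      and q: "q \<le> m" "path_component (H E m) y (standard m q)" using conn xy by blast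
    have "p = q" using index_path[OF p(2)] index_path[OF q(2)] index_standard p(1) q(1) eq by simp
    then show "path_component (H E m) x y" 
      using path_component_trans[OF p(2)] path_component_sym[OF q(2)] by blast
  qed
  show "index m x \<le> m" if x: "x \<in> H E m"
  proof -
    obtain p where p: "p \<le> m" "path_component (H E m) x (standard m p)" using conn x by blast
    then show ?thesis using index_path[OF p(2)] index_standard by simp
  qed
  show "\<exists>x\<in>H E m. index m x = q" if "q \<le> m" for q using std index_standard that by blast
  show "mat_dsum m x y \<in> H E (m + k)" if x: "x \<in> H E m" and y: "y \<in> H E k"
  proof -
    have "mat_dsum m x y \<in> mat_over (m + k) E"
      unfolding mat_over_def mem_Collect_eq
    proof (intro allI)
      fix i j
      have xE: "x \<in> mat_over m E" and yE: "y \<in> mat_over k E" using x y by (auto simp: H_def)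
      have "x i j \<in> E" if "i < m" "j < m" using xE that by (auto simp: mat_over_def)
      moreover have "y (i - m) (j - m) \<in> E" if "i - m < k" "j - m < k"
        using yE that by (auto simp: mat_over_def)
      moreover have "y (i - m) (j - m) = 0" if "\<not> (i - m < k \<and> j - m < k)"
        by (rule mat_over_zero[OF yE that])
      moreover have "\<not> i < m + k \<Longrightarrow> m \<le> i \<and> \<not> i - m < k" "\<not> j < m + k \<Longrightarrow> m \<le> j \<and> \<not> j - m < k"
        "i < m + k \<Longrightarrow> m \<le> i \<Longrightarrow> i - m < k" "j < m + k \<Longrightarrow> m \<le> j \<Longrightarrow> j - m < k" by linarith+
      ultimately show "if i < m + k \<and> j < m + k then mat_dsum m x y i j \<in> E else mat_dsum m x y i j = 0"
        using operator_system_zero[OF E] by (auto simp: mat_dsum_def)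
    qed
    then show ?thesis using x y by (simp add: H_iff symbol_dsum hermitian_dsum mdet_dsum_nz)
  qed
  show "index (m + k) (mat_dsum m x y) = index m x + index k y" if x: "x \<in> H E m" and y: "y \<in> H E k"
    unfolding index_def symbol_dsum using x y by (intro neg_index_dsum) (auto simp: H_iff)
  have one: "mat_one m = standard m 0"
    by (intro ext bcontfun_eqI)
      (auto simp: mat_one_def standard_def of_symbol_def sign_mat_def bcontfun_alg_simps Bcontfun_inverse const_bcontfun)
  show "mat_one m \<in> H E m" unfolding one by (rule std)
  show "index m (mat_one m) = 0" unfolding one by (rule index_standard) simp
qed

theorem mainTheorem6:
  fixes n :: nat
  assumes "n \<ge> 2"
  shows "ambient_is_cstar_envelope (fejer_riesz n) \<and>
    (\<forall>m\<ge>1. bij_betw (V0_incl UNIV m) (V0 (fejer_riesz n) m) (V0 (UNIV :: CS1 set) m)) \<and>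
    (\<forall>m\<ge>1. \<forall>m'\<ge>m. \<forall>c\<in>V0 (fejer_riesz n) m.
       V0_incl UNIV m' (V0_conn (fejer_riesz n) m m' c) = V0_conn UNIV m m' (V0_incl UNIV m c)) \<and>
    comm_group (K0 (fejer_riesz n)) \<and> comm_group (K0 (UNIV :: CS1 set)) \<and>
    K0 (fejer_riesz n) \<cong> K0 (UNIV :: CS1 set) \<and>
    K0 (UNIV :: CS1 set) \<cong> integer_group"
proof -
  define d where "d = n - 1"
  have d: "d \<ge> 1" "n = d + 1" using assms by (auto simp: d_def)
  have E: "index_classified (fejer_riesz n) index"
  proof (rule index_classified_CS1)
    show "operator_system (fejer_riesz n)" using assms by (intro operator_system_fejer_riesz) simp
    show "standard m q \<in> H (fejer_riesz n) m" for m q unfolding d(2) by (rule standard_H)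
    show "\<exists>q\<le>m. path_component (H (fejer_riesz n) m) x (standard m q)"
      if "x \<in> H (fejer_riesz n) m" for m x
      using H_fejer_riesz_standard[OF that[unfolded d(2)]] unfolding d(2) by blast
  qed
  have F: "index_classified (UNIV :: CS1 set) index"
  proof (rule index_classified_CS1)
    show "operator_system (UNIV :: CS1 set)" by (simp add: operator_system_def)
    show "standard m q \<in> H UNIV m" for m q using standard_H[of m q 1] H_mono[OF subset_UNIV] by blast
    show "\<exists>q\<le>m. path_component (H UNIV m) x (standard m q)" if "x \<in> H UNIV m" for m and x :: "nat \<Rightarrow> nat \<Rightarrow> CS1"
      using H_UNIV_standard[OF that] by blast
  qed
  have K: "K0 (fejer_riesz n) \<cong> integer_group" "K0 (UNIV :: CS1 set) \<cong> integer_group"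
    "comm_group (K0 (fejer_riesz n))" "comm_group (K0 (UNIV :: CS1 set))"
    using index_classified.K0_iso_int[OF E] index_classified.K0_iso_int[OF F]
      index_classified.K0_comm_group[OF E] index_classified.K0_comm_group[OF F] by auto
  have "integer_group \<cong> K0 (UNIV :: CS1 set)"
    using group.iso_sym[OF comm_group.axioms(2)[OF K(4)] K(2)] .
  then have "K0 (fejer_riesz n) \<cong> K0 (UNIV :: CS1 set)" by (rule iso_trans[OF K(1)])
  then show ?thesis
    using envelope_fejer_riesz[OF d(1)] V0_incl_bij[OF E F subset_UNIV]
      V0_incl_conn[OF E F subset_UNIV] K unfolding d(2)[symmetric] by blast
qed

end
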